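(* Let $[A,(B_{::})]$ be an array of $q\ge 2$ linear time-invariant systems with relative actuation, let $k,\ell\in\{1,\dots,q\}$ be distinct, and let $\mu_\kappa$, $\Lambda_\kappa$, $Q_{i\sigma}^{[\kappa]}$, $\mathcal{I}_\kappa$ ($\kappa=1,\dots,m$) and $\mathcal{R}$ be as defined in the context. Assume: (i) if $\mu_\kappa\notin\mathbb{R}$ satisfies $\mathrm{Re}\,\mu_\kappa=\mu_\nu$ for some $\nu\in\{1,\dots,m\}$, then $\Lambda_\kappa=0$; (ii) if $\mathrm{cl}\,\mathcal{R}\supset\mathrm{range}[(e_k-e_\ell)\otimes I_n]$ then $\mathcal{R}\supset\mathrm{range}[(e_k-e_\ell)\otimes I_n]$ (where $\mathrm{cl}$ denotes closure). Then the following two conditions are equivalent. 1. The array $[A,(B_{::})]$ is positively $(k,\ell)$-controllable. 2. The following statements simultaneously hold. (a) $\mathrm{inc}(Q_{:\sigma}^{[\kappa]})_{\sigma\in\mathcal{I}_\kappa}$ is strongly $(k,\ell)$-connected for all $\kappa$ with $\mu_\kappa\in\mathbb{R}$. (b) $\mathrm{inc}(Q_{:\sigma}^{[\kappa]})_{\sigma\in\mathcal{I}_\kappa}$ is $(k,\ell)$-connected for all $\kappa$ with $\mu_\kappa\notin\mathbb{R}$.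
   Context: Array. Let $q\ge 2$, $n,p\ge 1$ be integers, $A\in\mathbb{R}^{n\times n}$, and $B_{i\sigma}\in\mathbb{R}^{n\times 1}$ ($i=1,\dots,q$; $\sigma=1,\dots,p$) satisfying $\sum_{i=1}^{q}B_{i\sigma}=0$ for every $\sigma$ (relative actuation). The array $[A,(B_{::})]$ is the collection of systems $\dot x_i=Ax_i+\sum_{\sigma=1}^{p}B_{i\sigma}u_\sigma$, $i=1,\dots,q$, with states $x_i\in\mathbb{R}^n$ and scalar inputs $u_\sigma\in\mathbb{R}$. Input signals are (Lebesgue) integrable functions on bounded intervals. Positive $(k,\ell)$-controllability. For distinct $k,\ell$, the array is positively $(k,\ell)$-controllable if for each set of initial conditions $(x_1(0),\dots,x_q(0))$ there exist a finite time $\tau>0$ and input signals $u_\sigma:[0,\tau]\to\mathbb{R}_{\ge0}$ such that $x_k(\tau)=x_\ell(\tau)$ and $x_i(\tau)=e^{A\tau}x_i(0)$ for all $i\ne k,\ell$. Notation. $M^{*}$ is the conjugate transpose of $M$; $e_i$ is the $i$th standard basis vector of $\mathbb{R}^q$. For a collection of matrices $(C_{i\sigma})$ of equal size and $\mathcal{I}\subset\{1,\dots,p\}$, $\mathrm{inc}(C_{:\sigma})_{\sigma\in\mathcal{I}}$ is the block matrix with $q$ block rows and one block column for each $\sigma\in\mathcal{I}$, whose $(i,\sigma)$ block is $C_{i\sigma}$; $\mathrm{inc}(C_{::})$ is the case $\mathcal{I}=\{1,\dots,p\}$. If $\mathcal I=\emptyset$ its range and cone are $\{0\}$. For real $G$,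 $\mathrm{cone}\,G=\{G\alpha:\alpha\ge0\}$ ($\alpha\ge 0$ entrywise). Let $\mathbf{A}=I_q\otimes A$ and $\mathbf{B}=\mathrm{inc}(B_{::})$. The positively reachable set is $$\mathcal{R}=\Big\{\xi\in(\mathbb{R}^n)^q:\ \xi=\int_0^\tau e^{\mathbf{A}(\tau-t)}\mathbf{B}\mathbf{u}(t)\,dt\ \text{for some }\mathbf{u}:[0,\tau]\to\mathbb{R}^p_{\ge0}\text{ with }\tau\ge0\Big\}.$$ Generalized eigenspaces. $\mu_1,\dots,\mu_m$ are the distinct eigenvalues of $A^{*}$ with algebraic multiplicities $n_1,\dots,n_m$, ordered so that $\mathrm{Re}\,\mu_1\ge\mathrm{Re}\,\mu_2\ge\cdots\ge\mathrm{Re}\,\mu_m$ and so that $\mathrm{Re}\,\mu_\kappa=\mu_\nu$ with $\kappa\ne\nu$ implies $\kappa>\nu$. For each $\kappa$, $U_\kappa\in\mathbb{C}^{n\times n_\kappa}$ is a full column rank matrix with $\mathrm{range}\,U_\kappa=\mathrm{null}\big((A^{*}-\mu_\kappa I_n)^{n_\kappa}\big)$, taken real when $\mu_\kappa$ is real; $A_\kappa\in\mathbb{C}^{n_\kappa\times n_\kappa}$ is the matrix satisfying $A^{*}U_\kappa=U_\kappa A_\kappa^{*}$; $\Lambda_\kappa=(A_\kappa^{*}-\mu_\kappa I_{n_\kappa})^{*}$ (nilpotent). Put $B_{i\sigma}^{[\kappa]}=U_\kappa^{*}B_{i\sigma}$, $B_{:\sigma}^{[\kappa]}=[B_{1\sigma}^{[\kappa]*}\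 \cdots\ B_{q\sigma}^{[\kappa]*}]^{*}$ and $Q_{i\sigma}^{[\kappa]}=[B_{i\sigma}^{[\kappa]}\ \Lambda_\kappa B_{i\sigma}^{[\kappa]}\ \cdots\ \Lambda_\kappa^{n_\kappa-1}B_{i\sigma}^{[\kappa]}]$. Index sets (defined recursively). $\mathcal{I}_1=\{1,\dots,p\}$ and $\mathcal{I}_{\kappa+1}=\mathcal{I}_\kappa\setminus\mathcal{I}_\kappa^{-}$, where $\mathcal{I}_\kappa^{-}=\emptyset$ if $\mu_\kappa\notin\mathbb{R}$, and if $\mu_\kappa\in\mathbb{R}$, $$\mathcal{I}_\kappa^{-}=\{\sigma\in\mathcal{I}_\kappa:\ (I_q\otimes\Lambda_\kappa^{r})B_{:\sigma}^{[\kappa]}\notin\mathcal{Q}_\kappa\ \text{for some }r\in\{0,1,\dots,n_\kappa-1\}\},$$ where (for $\mu_\kappa\in\mathbb{R}$) $\mathcal{Q}_\kappa\subset(\mathbb{R}^{n_\kappa})^q$ is the largest subspace contained in $\mathrm{cone}[\mathrm{inc}(Q_{:\sigma}^{[\kappa]})_{\sigma\in\mathcal{I}_\kappa}]$. Connectedness. For a positive integer $d$, $\mathcal{S}_d=\mathrm{range}(\mathbf{1}_q\otimes I_d)$, where $\mathbf{1}_q$ is the $q$-vector of all ones; a matrix $G$ with $qd$ rows belongs to class-$\mathcal{G}_d$ if $\mathrm{range}\,G\subset\mathcal{S}_d^{\perp}$. A class-$\mathcal{G}_d$ matrix $G$ is $(k,\ell)$-connected if $\mathrm{range}\,G\supset\mathrm{range}[(e_k-e_\ell)\otimes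 I_d]$ (over $\mathbb{C}$ for complex $G$), and strongly $(k,\ell)$-connected if it is real and $\mathrm{cone}\,G\supset\mathrm{range}[(e_k-e_\ell)\otimes I_d]$. The matrices $\mathrm{inc}(Q_{:\sigma}^{[\kappa]})_{\sigma\in\mathcal{I}_\kappa}$ are in class-$\mathcal{G}_{n_\kappa}$. *)

theory Defs
  imports "HOL-Analysis.Analysis" "HOL-Computational_Algebra.Polynomial"
begin

section \<open>Matrices with type-indexed dimensions\<close>

primrec matpow :: "'a::semiring_1^'n^'n \<Rightarrow> nat \<Rightarrow> 'a^'n^'n" where
  "matpow M 0 = mat 1"
| "matpow M (Suc r) = M ** matpow M r"

definition mexp :: "real^'n^'n \<Rightarrow> real^'n^'n" where
  "mexp M = (\<Sum>r. matpow M r /\<^sub>R fact r)"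

definition kron :: "'a::times^'c^'r \<Rightarrow> 'a^'d^'s \<Rightarrow> 'a^('c \<times> 'd)^('r \<times> 's)" where
  "kron M N = (\<chi> x y. M $ fst x $ fst y * N $ snd x $ snd y)"

definition conj_transpose :: "complex^'n^'m \<Rightarrow> complex^'m^'n" where
  "conj_transpose M = (\<chi> i j. cnj (M $ j $ i))"

definition complex_matrix :: "real^'n^'m \<Rightarrow> complex^'n^'m" where
  "complex_matrix M = (\<chi> i j. complex_of_real (M $ i $ j))"

definition charpoly :: "'a::comm_ring_1^'n^'n \<Rightarrow> 'a poly" where
  "charpoly M = det (\<chi> i j. (if i = j then [:0, 1:] else 0) - [:M $ i $ j:])"

definition is_eigenvalue :: "'a::field^'n^'n \<Rightarrow> 'a \<Rightarrow> bool" where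
  "is_eigenvalue M z \<longleftrightarrow> (\<exists>v. v \<noteq> 0 \<and> M *v v = z *s v)"

definition alg_multiplicity :: "'a::field^'n^'n \<Rightarrow> 'a \<Rightarrow> nat" where
  "alg_multiplicity M z = order z (charpoly M)"


section \<open>Arrays and positive controllability\<close>

definition relative_actuation :: "('q::finite \<Rightarrow> 'p \<Rightarrow> real^'n) \<Rightarrow> bool" where
  "relative_actuation B \<longleftrightarrow> (\<forall>\<sigma>. (\<Sum>i\<in>UNIV. B i \<sigma>) = 0)"

definition positive_input :: "real \<Rightarrow> (real \<Rightarrow> real^'p) \<Rightarrow> bool" where
  "positive_input \<tau> u \<longleftrightarrow>
     u absolutely_integrable_on {0..\<tau>} \<and> (\<forall>t\<in>{0..\<tau>}. \<forall>\<sigma>. 0 \<le> u t $ \<sigma>)"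

text \<open>Since inputs are merely integrable, solutions of
  \<open>x\<^sub>i' = A x\<^sub>i + \<Sum>\<^sub>\<sigma> B\<^sub>i\<^sub>\<sigma> u\<^sub>\<sigma>\<close> are understood in the sense of Caratheodory,
  that is, as solutions of the corresponding integral equation.\<close>

definition array_solution ::
  "real^'n^'n \<Rightarrow> ('q \<Rightarrow> 'p::finite \<Rightarrow> real^'n) \<Rightarrow> real \<Rightarrow> (real \<Rightarrow> real^'p) \<Rightarrow>
   ('q \<Rightarrow> real \<Rightarrow> real^'n) \<Rightarrow> bool" where
  "array_solution A B \<tau> u x \<longleftrightarrow>
     (\<forall>i. \<forall>t\<in>{0..\<tau>}.
        ((\<lambda>s. A *v x i s + (\<Sum>\<sigma>\<in>UNIV. (u s $ \<sigma>) *\<^sub>R B i \<sigma>)) has_integral (x i t - x i 0)) {0..t})"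

definition positively_controllable ::
  "real^'n^'n \<Rightarrow> ('q \<Rightarrow> 'p::finite \<Rightarrow> real^'n) \<Rightarrow> 'q \<Rightarrow> 'q \<Rightarrow> bool" where
  "positively_controllable A B k l \<longleftrightarrow>
     (\<forall>x0 :: 'q \<Rightarrow> real^'n. \<exists>\<tau>>0. \<exists>u x.
        positive_input \<tau> u \<and> array_solution A B \<tau> u x \<and> (\<forall>i. x i 0 = x0 i) \<and>
        x k \<tau> = x l \<tau> \<and>
        (\<forall>i. i \<noteq> k \<and> i \<noteq> l \<longrightarrow> x i \<tau> = mexp (\<tau> *\<^sub>R A) *v x0 i))"

text \<open>The stacked space \<open>(\<real>\<^sup>n)\<^sup>q\<close> is rendered as \<open>real^('q \<times> 'n)\<close>.\<close>

definition stacked_A :: "real^'n^'n \<Rightarrow> real^('q::finite \<times> 'n)^('q \<times> 'n)" where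
  "stacked_A A = kron (mat 1) A"

definition stacked_B :: "('q::finite \<Rightarrow> 'p \<Rightarrow> real^'n) \<Rightarrow> real^'p^('q \<times> 'n)" where
  "stacked_B B = (\<chi> x \<sigma>. B (fst x) \<sigma> $ snd x)"

definition positively_reachable ::
  "real^'n^'n \<Rightarrow> ('q::finite \<Rightarrow> 'p::finite \<Rightarrow> real^'n) \<Rightarrow> (real^('q \<times> 'n)) set" where
  "positively_reachable A B =
     {\<xi>. \<exists>\<tau>\<ge>0. \<exists>u. positive_input \<tau> u \<and>
        ((\<lambda>t. mexp ((\<tau> - t) *\<^sub>R stacked_A A) *v (stacked_B B *v u t)) has_integral \<xi>) {0..\<tau>}}"

definition difference_range :: "'q::finite \<Rightarrow> 'q \<Rightarrow> (real^('q \<times> 'n::finite)) set" where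
  "difference_range k l =
     range ((*v) (kron (columnvector (axis k 1 - axis l 1) :: real^1^'q) (mat 1 :: real^'n^'n)))"


section \<open>Matrices given by families of columns\<close>

text \<open>The dimensions \<open>n\<^sub>\<kappa>\<close> of the generalized eigenspaces are not types. A matrix with rows
  indexed by \<open>'r\<close> and with a finite set \<open>C\<close> of columns is therefore a family \<open>G\<close> such that
  \<open>G c x\<close>, for \<open>c \<in> C\<close>, is the entry in row \<open>x\<close> and column \<open>c\<close>. A vector of dimension
  \<open>d\<close> is a function on \<open>nat\<close> that vanishes at all \<open>j \<ge> d\<close>, and a vector in the \<open>q\<close>-fold
  product of the \<open>d\<close>-dimensional space is a function on \<open>'q \<times> nat\<close> that vanishes at all
  \<open>(i, j)\<close> with \<open>j \<ge> d\<close>.\<close>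

definition col_range :: "'c set \<Rightarrow> ('c \<Rightarrow> 'r \<Rightarrow> 'a::comm_ring_1) \<Rightarrow> ('r \<Rightarrow> 'a) set" where
  "col_range C G = {(\<lambda>x. \<Sum>c\<in>C. \<alpha> c * G c x) | \<alpha>. True}"

definition col_cone :: "'c set \<Rightarrow> ('c \<Rightarrow> 'r \<Rightarrow> real) \<Rightarrow> ('r \<Rightarrow> real) set" where
  "col_cone C G = {(\<lambda>x. \<Sum>c\<in>C. \<alpha> c * G c x) | \<alpha>. \<forall>c\<in>C. 0 \<le> \<alpha> c}"

definition linear_subspace :: "('r \<Rightarrow> real) set \<Rightarrow> bool" where
  "linear_subspace S \<longleftrightarrow>
     (\<lambda>x. 0) \<in> S \<and> (\<forall>v\<in>S. \<forall>w\<in>S. (\<lambda>x. v x + w x) \<in> S) \<and> (\<forall>a. \<forall>v\<in>S. (\<lambda>x. a * v x) \<in> S)"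

definition largest_subspace :: "('r \<Rightarrow> real) set \<Rightarrow> ('r \<Rightarrow> real) set" where
  "largest_subspace K = (GREATEST S. linear_subspace S \<and> S \<subseteq> K)"

text \<open>The largest subspace contained in a cone exists.\<close>

lemma largest_subspace_col_cone:
  "linear_subspace (largest_subspace (col_cone C G))"
  "largest_subspace (col_cone C G) \<subseteq> col_cone C G"
  "linear_subspace S \<Longrightarrow> S \<subseteq> col_cone C G \<Longrightarrow> S \<subseteq> largest_subspace (col_cone C G)"
proof -
  let ?K = "col_cone C G"
  define L where "L = {v \<in> ?K. (\<lambda>x. - v x) \<in> ?K}"
  have zero: "(\<lambda>x. 0) \<in> ?K"
    unfolding col_cone_def by (auto intro!: exI[of _ "\<lambda>_. 0"])
  have add: "(\<lambda>x. v x + w x) \<in> ?K" if vw: "v \<in> ?K" "w \<in> ?K" for v w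
  proof -
    from vw obtain a b where "v = (\<lambda>x. \<Sum>c\<in>C. a c * G c x)" "\<forall>c\<in>C. 0 \<le> a c"
      and "w = (\<lambda>x. \<Sum>c\<in>C. b c * G c x)" "\<forall>c\<in>C. 0 \<le> b c"
      unfolding col_cone_def by auto
    then show ?thesis unfolding col_cone_def
      by (auto simp: algebra_simps sum.distrib intro!: exI[of _ "\<lambda>c. a c + b c"])
  qed
  have scale: "(\<lambda>x. a * v x) \<in> ?K" if v: "v \<in> ?K" and a: "0 \<le> a" for v a
  proof -
    from v obtain b where "v = (\<lambda>x. \<Sum>c\<in>C. b c * G c x)" "\<forall>c\<in>C. 0 \<le> b c"
      unfolding col_cone_def by auto
    with a show ?thesis unfolding col_cone_def
      by (auto simp: sum_distrib_left mult.assoc intro!: exI[of _ "\<lambda>c. a * b c"])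
  qed
  have sub: "linear_subspace L"
    unfolding linear_subspace_def
  proof (intro conjI ballI allI)
    show "(\<lambda>x. 0) \<in> L" using zero by (simp add: L_def)
    show "(\<lambda>x. v x + w x) \<in> L" if "v \<in> L" "w \<in> L" for v w
      using that add[of v w] add[of "\<lambda>x. - v x" "\<lambda>x. - w x"] by (simp add: L_def)
    show "(\<lambda>x. a * v x) \<in> L" if "v \<in> L" for a v
    proof (cases "0 \<le> a")
      case True
      then show ?thesis using that scale[of v a] scale[of "\<lambda>x. - v x" a] by (simp add: L_def)
    next
      case False
      then show ?thesis using that scale[of v "- a"] scale[of "\<lambda>x. - v x" "- a"]
        by (simp add: L_def)
    qed
  qed
  have max: "T \<subseteq> L" if T: "linear_subspace T" "T \<subseteq> ?K" for T
  proof
    fix v assume v: "v \<in> T"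
    then have "(\<lambda>x. (- 1) * v x) \<in> T" using T(1) unfolding linear_subspace_def by blast
    then show "v \<in> L" using v T(2) by (auto simp: L_def)
  qed
  have "largest_subspace ?K = L"
    unfolding largest_subspace_def
    by (rule Greatest_equality) (use sub max in \<open>auto simp: L_def\<close>)
  then show "linear_subspace (largest_subspace ?K)" "largest_subspace ?K \<subseteq> ?K"
    "linear_subspace S \<Longrightarrow> S \<subseteq> ?K \<Longrightarrow> S \<subseteq> largest_subspace ?K"
    using sub max by (auto simp: L_def)
qed

text \<open>The columns of \<open>w \<otimes> I\<^sub>d\<close> are those with index \<open>c < d\<close>.\<close>

definition kron_id :: "('q \<Rightarrow> 'a::comm_ring_1) \<Rightarrow> nat \<Rightarrow> 'q \<times> nat \<Rightarrow> 'a" where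
  "kron_id w c = (\<lambda>(i, j). w i * (if j = c then 1 else 0))"

definition basis_difference :: "'q \<Rightarrow> 'q \<Rightarrow> 'q \<Rightarrow> 'a::comm_ring_1" where
  "basis_difference k l = (\<lambda>i. (if i = k then 1 else 0) - (if i = l then 1 else 0))"

definition class_G :: "nat \<Rightarrow> 'c set \<Rightarrow> ('c \<Rightarrow> 'q::finite \<times> nat \<Rightarrow> complex) \<Rightarrow> bool" where
  "class_G d C G \<longleftrightarrow>
     (\<forall>v\<in>col_range C G. \<forall>w\<in>col_range {..<d} (kron_id (\<lambda>_. 1)).
        (\<Sum>i\<in>UNIV. \<Sum>j<d. cnj (w (i, j)) * v (i, j)) = 0)"

definition connected_pair ::
  "nat \<Rightarrow> 'q::finite \<Rightarrow> 'q \<Rightarrow> 'c set \<Rightarrow> ('c \<Rightarrow> 'q \<times> nat \<Rightarrow> complex) \<Rightarrow> bool" where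
  "connected_pair d k l C G \<longleftrightarrow>
     class_G d C G \<and> col_range {..<d} (kron_id (basis_difference k l)) \<subseteq> col_range C G"

definition strongly_connected_pair ::
  "nat \<Rightarrow> 'q::finite \<Rightarrow> 'q \<Rightarrow> 'c set \<Rightarrow> ('c \<Rightarrow> 'q \<times> nat \<Rightarrow> complex) \<Rightarrow> bool" where
  "strongly_connected_pair d k l C G \<longleftrightarrow>
     class_G d C G \<and> (\<forall>c\<in>C. \<forall>x. G c x \<in> \<real>) \<and>
     col_range {..<d} (kron_id (basis_difference k l)) \<subseteq> col_cone C (\<lambda>c x. Re (G c x))"


section \<open>Generalized eigenspaces and index sets\<close>

text \<open>The distinct eigenvalues are \<open>\<mu> 0, \<dots>, \<mu> (m - 1)\<close>: numbering starts at 0.\<close>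

definition ordered_eigenvalues :: "complex^'n^'n \<Rightarrow> nat \<Rightarrow> (nat \<Rightarrow> complex) \<Rightarrow> bool" where
  "ordered_eigenvalues M m \<mu> \<longleftrightarrow>
     bij_betw \<mu> {..<m} {z. is_eigenvalue M z} \<and>
     (\<forall>\<kappa> \<nu>. \<kappa> < \<nu> \<and> \<nu> < m \<longrightarrow> Re (\<mu> \<nu>) \<le> Re (\<mu> \<kappa>)) \<and>
     (\<forall>\<kappa><m. \<forall>\<nu><m. complex_of_real (Re (\<mu> \<kappa>)) = \<mu> \<nu> \<and> \<kappa> \<noteq> \<nu> \<longrightarrow> \<nu> < \<kappa>)"

text \<open>\<open>V 0, \<dots>, V (d - 1)\<close> are the columns of the matrix whose range is the generalized
  eigenspace of \<open>M\<close> at \<open>z\<close>.\<close>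

definition gen_eigenspace_matrix ::
  "complex^'n^'n \<Rightarrow> complex \<Rightarrow> nat \<Rightarrow> (nat \<Rightarrow> complex^'n) \<Rightarrow> bool" where
  "gen_eigenspace_matrix M z d V \<longleftrightarrow>
     vec.dim (V ` {..<d}) = d \<and>
     {(\<Sum>j<d. c j *s V j) | c. True} = {v. matpow (M - mat z) d *v v = 0} \<and>
     (z \<in> \<real> \<longrightarrow> (\<forall>j<d. \<forall>r. V j $ r \<in> \<real>))"

text \<open>In the following two definitions \<open>D j i\<close> is the entry in row \<open>j\<close> and column \<open>i\<close> of a
  \<open>d \<times> d\<close> matrix. The first says that \<open>M V = V D\<^sup>*\<close>; the second is \<open>(D\<^sup>* - z I)\<^sup>*\<close>.\<close>

definition restriction_matrix ::
  "complex^'n^'n \<Rightarrow> nat \<Rightarrow> (nat \<Rightarrow> complex^'n) \<Rightarrow> (nat \<Rightarrow> nat \<Rightarrow> complex) \<Rightarrow> bool" where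
  "restriction_matrix M d V D \<longleftrightarrow> (\<forall>j<d. M *v V j = (\<Sum>i<d. cnj (D j i) *s V i))"

definition nilpotent_part ::
  "complex \<Rightarrow> (nat \<Rightarrow> nat \<Rightarrow> complex) \<Rightarrow> nat \<Rightarrow> nat \<Rightarrow> complex" where
  "nilpotent_part z D j i = cnj (cnj (D j i) - (if i = j then z else 0))"

definition sq_apply :: "nat \<Rightarrow> (nat \<Rightarrow> nat \<Rightarrow> complex) \<Rightarrow> (nat \<Rightarrow> complex) \<Rightarrow> nat \<Rightarrow> complex" where
  "sq_apply d L v = (\<lambda>j. if j < d then \<Sum>i<d. L j i * v i else 0)"

definition adjoint_apply :: "nat \<Rightarrow> (nat \<Rightarrow> complex^'n) \<Rightarrow> real^'n \<Rightarrow> nat \<Rightarrow> complex" where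
  "adjoint_apply d V b =
     (\<lambda>j. if j < d then \<Sum>r\<in>UNIV. cnj (V j $ r) * complex_of_real (b $ r) else 0)"

text \<open>Column \<open>(\<sigma>, r)\<close> of the incidence matrix of the \<open>Q\<^sub>i\<^sub>\<sigma>\<close>, whose \<open>i\<close>-th block
  is \<open>\<Lambda>\<^sup>r U\<^sup>* B\<^sub>i\<^sub>\<sigma>\<close>; it equals \<open>I\<^sub>q \<otimes> \<Lambda>\<^sup>r\<close> applied to the stacked
  vector of the \<open>U\<^sup>* B\<^sub>i\<^sub>\<sigma>\<close>.\<close>

definition inc_Q ::
  "('q \<Rightarrow> 'p \<Rightarrow> real^'n) \<Rightarrow> nat \<Rightarrow> (nat \<Rightarrow> complex^'n) \<Rightarrow> (nat \<Rightarrow> nat \<Rightarrow> complex) \<Rightarrow>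
   'p \<times> nat \<Rightarrow> 'q \<times> nat \<Rightarrow> complex" where
  "inc_Q B d V L = (\<lambda>(\<sigma>, r) (i, j). (sq_apply d L ^^ r) (adjoint_apply d V (B i \<sigma>)) j)"

text \<open>The set removed from \<open>I\<close> at a real eigenvalue. There all entries of the incidence
  matrix are real, and taking real parts only changes their type.\<close>

definition removed_indices ::
  "('q \<Rightarrow> 'p \<Rightarrow> real^'n) \<Rightarrow> nat \<Rightarrow> (nat \<Rightarrow> complex^'n) \<Rightarrow> (nat \<Rightarrow> nat \<Rightarrow> complex) \<Rightarrow>
   'p set \<Rightarrow> 'p set" where
  "removed_indices B d V L I =
     {\<sigma>\<in>I. \<exists>r<d. (\<lambda>x. Re (inc_Q B d V L (\<sigma>, r) x))
        \<notin> largest_subspace (col_cone (I \<times> {..<d}) (\<lambda>c x. Re (inc_Q B d V L c x)))}"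

primrec index_set ::
  "('q \<Rightarrow> 'p \<Rightarrow> real^'n) \<Rightarrow> (nat \<Rightarrow> complex) \<Rightarrow> (nat \<Rightarrow> nat) \<Rightarrow> (nat \<Rightarrow> nat \<Rightarrow> complex^'n) \<Rightarrow>
   (nat \<Rightarrow> nat \<Rightarrow> nat \<Rightarrow> complex) \<Rightarrow> nat \<Rightarrow> 'p set" where
  "index_set B \<mu> N U \<Lambda> 0 = UNIV"
| "index_set B \<mu> N U \<Lambda> (Suc \<kappa>) = index_set B \<mu> N U \<Lambda> \<kappa> -
     (if \<mu> \<kappa> \<in> \<real>
      then removed_indices B (N \<kappa>) (U \<kappa>) (\<Lambda> \<kappa>) (index_set B \<mu> N U \<Lambda> \<kappa>)
      else {})"

end

theory Submission
  imports Defs "HOL-Computational_Algebra.Fundamental_Theorem_Algebra"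
begin

text \<open>Write \<open>N\<close> for \<open>A\<^sup>* - \<mu>\<close> on the generalized eigenspace of \<open>A\<^sup>*\<close> at \<open>\<mu>\<close>, and \<open>I \<kappa>\<close> for the
index sets. Both sides of the equivalence are statements about one dual object: the cone of all families
\<open>(\<eta>\<^sub>i)\<close> of real vectors with \<open>\<Sum>\<^sub>i \<eta>\<^sub>i \<bullet> e\<^sup>t\<^sup>A B\<^sub>i\<^sub>\<sigma> \<ge> 0\<close> for all \<open>\<sigma>\<close> and \<open>t \<ge> 0\<close>. These are the
functionals that are nonnegative on the positively reachable cone.

Controllability holds exactly when every \<open>\<eta>\<close> in the dual cone satisfies \<open>\<eta>\<^sub>k = \<eta>\<^sub>l\<close>
(\<open>positively_controllable_iff_dual\<close>). In one direction, \<open>\<eta>\<close> is paired with a final state given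
by variation of constants. In the other, separation from the closure of the reachable cone
puts the differences \<open>(e\<^sub>k - e\<^sub>l) \<otimes> v\<close> into that closure, and the hypothesis on closures
moves them into the cone itself.

By Farkas' lemma the connectedness conditions and the index sets dualize as well. A
coordinate functional on the rows of an incidence matrix is a family \<open>(w\<^sub>i)\<close> of generalized
eigenvectors, and its value on the column \<open>(\<sigma>, r)\<close> is the moment \<open>\<Sum>\<^sub>i \<langle>N\<^sup>r w\<^sub>i, B\<^sub>i\<^sub>\<sigma>\<rangle>\<close>, which
is the coefficient of \<open>t\<^sup>r / r!\<close> in the response of \<open>(w\<^sub>i)\<close> to the input \<open>\<sigma>\<close>. Strong
connectedness at a real \<open>\<mu>\<close> says that \<open>w\<^sub>k = w\<^sub>l\<close> for each real family whose moments over the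
current indices are nonnegative; connectedness at a nonreal \<open>\<mu>\<close> says this for each family
whose moments vanish; and an index is removed when some family with nonnegative moments has a
positive moment at it.

It remains to compare these conditions with the dual cone.

\<^item> Given \<open>\<eta>\<close> in the dual cone, its response to each input is a nonnegative exponential
  polynomial. Averaging shows that, among its exponents of largest real part, there is a real
  one whose polynomial has a positive leading coefficient
  (\<open>nonneg_exp_poly_dominant_real\<close>). In the given order of eigenvalues, this forces the
  component of \<open>\<eta>\<close> at \<open>\<kappa>\<close> to have no response to the indices that survive step \<open>\<kappa>\<close>, and to take
  equal values at \<open>k\<close> and \<open>l\<close> (\<open>criterion_imp_dual\<close>).

\<^item> Conversely, a family at \<open>\<kappa>\<close> that violates the condition there has a nonnegative response only
  to the indices in \<open>I \<kappa>\<close>. Every other index was removed at a real eigenvalue \<open>\<nu>\<close> before step \<open>\<kappa>\<close>,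
  where some family has a response that grows at least like the exponential with rate \<open>\<nu>\<close>; large
  multiples of such families restore nonnegativity (\<open>compensation\<close>). Growth is the only
  obstacle: a nonreal eigenvalue with the same real part as a real one must not produce powers of \<open>t\<close>, which is
  what semisimplicity of its mode provides. The correction lies in other eigenspaces, so it
  cannot cancel the difference between \<open>k\<close> and \<open>l\<close>.\<close>

section \<open>Finitely generated cones and their duals\<close>

definition pair_on :: "'r set \<Rightarrow> ('r \<Rightarrow> real) \<Rightarrow> ('r \<Rightarrow> real) \<Rightarrow> real" where
  "pair_on X y g = (\<Sum>x\<in>X. y x * g x)"

lemma pair_on_diff_left: "pair_on X (\<lambda>x. y x - a * z x) g = pair_on X y g - a * pair_on X z g"
  by (simp add: pair_on_def algebra_simps sum_subtractf sum_distrib_left)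

lemma pair_on_diff_right: "pair_on X y (\<lambda>x. g x - a * h x) = pair_on X y g - a * pair_on X y h"
  by (simp add: pair_on_def algebra_simps sum_subtractf sum_distrib_left)

lemma pair_on_sum_right:
  "pair_on X y (\<lambda>x. \<Sum>c\<in>C. a c * G c x) = (\<Sum>c\<in>C. a c * pair_on X y (G c))"
proof -
  have "pair_on X y (\<lambda>x. \<Sum>c\<in>C. a c * G c x) = (\<Sum>x\<in>X. \<Sum>c\<in>C. a c * (y x * G c x))"
    by (simp add: pair_on_def sum_distrib_left mult_ac)
  also have "\<dots> = (\<Sum>c\<in>C. a c * pair_on X y (G c))"
    by (subst sum.swap) (simp add: pair_on_def sum_distrib_left)
  finally show ?thesis .
qed

text \<open>Induction on the number of columns, without topology. If the last column matters, some \<open>y\<close> is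
nonnegative on the others and negative on \<open>v\<close>, hence negative on the last column; subtracting
multiples of that column moves everything into the hyperplane orthogonal to \<open>y\<close>, where one
column fewer is left. Working with functions on a finite index set avoids fixing a dimension.\<close>

theorem Farkas:
  assumes "finite C" "finite X"
    and "\<And>y. (\<forall>c\<in>C. 0 \<le> pair_on X y (G c)) \<Longrightarrow> 0 \<le> pair_on X y v"
  shows "\<exists>\<alpha>. (\<forall>c\<in>C. 0 \<le> \<alpha> c) \<and> (\<forall>x\<in>X. v x = (\<Sum>c\<in>C. \<alpha> c * G c x))"
  using assms(1,3)
proof (induction C arbitrary: G v rule: finite_induct)
  case empty
  \<comment> \<open>Without columns the hypothesis holds for all \<open>y\<close>, in particular for \<open>- v\<close>.\<close>
  have "0 \<le> pair_on X (\<lambda>x. - v x) v" by (rule empty) simp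
  then have "(\<Sum>x\<in>X. v x * v x) \<le> 0" by (simp add: pair_on_def sum_negf)
  moreover have "0 \<le> (\<Sum>x\<in>X. v x * v x)" by (intro sum_nonneg) simp
  ultimately have "(\<Sum>x\<in>X. v x * v x) = 0" by linarith
  then have "\<forall>x\<in>X. v x = 0"
    using \<open>finite X\<close> by (subst (asm) sum_nonneg_eq_0_iff) auto
  then show ?case by simp
next
  case (insert e C)
  show ?case
  proof (cases "\<forall>y. (\<forall>c\<in>C. 0 \<le> pair_on X y (G c)) \<longrightarrow> 0 \<le> pair_on X y v")
    case True
    then obtain \<alpha> where \<alpha>: "\<forall>c\<in>C. 0 \<le> \<alpha> c" "\<forall>x\<in>X. v x = (\<Sum>c\<in>C. \<alpha> c * G c x)"
      using insert.IH[of G v] by blast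
    have "(\<Sum>c\<in>C. (\<alpha>(e := 0)) c * G c x) = (\<Sum>c\<in>C. \<alpha> c * G c x)" for x
      using insert.hyps by (intro sum.cong) auto
    with \<alpha> insert.hyps show ?thesis
      by (intro exI[of _ "\<alpha>(e := 0)"]) auto
  next
    case False
    then obtain y where y: "\<forall>c\<in>C. 0 \<le> pair_on X y (G c)" "pair_on X y v < 0"
      by (auto simp: not_le)
    define b where "b = pair_on X y (G e)"
    have b: "b < 0"
    proof (rule ccontr)
      assume "\<not> b < 0"
      with y(1) have "0 \<le> pair_on X y v" by (intro insert.prems) (auto simp: b_def)
      with y(2) show False by simp
    qed
    \<comment> \<open>Project along the last column onto the hyperplane orthogonal to \<open>y\<close>.\<close>
    define G' where "G' = (\<lambda>c x. G c x - (pair_on X y (G c) / b) * G e x)"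
    define v' where "v' = (\<lambda>x. v x - (pair_on X y v / b) * G e x)"
    have "0 \<le> pair_on X z v'" if z: "\<forall>c\<in>C. 0 \<le> pair_on X z (G' c)" for z
    proof -
      define z' where "z' = (\<lambda>x. z x - (pair_on X z (G e) / b) * y x)"
      have shift: "pair_on X z' g = pair_on X z (\<lambda>x. g x - (pair_on X y g / b) * G e x)" for g
        unfolding z'_def pair_on_diff_left pair_on_diff_right by simp
      have "pair_on X z' (G e) = 0"
        unfolding z'_def pair_on_diff_left using b by (simp add: b_def)
      moreover have "0 \<le> pair_on X z' (G c)" if "c \<in> C" for c
        using z that by (simp add: shift G'_def)
      ultimately have "0 \<le> pair_on X z' v" by (intro insert.prems) auto
      then show ?thesis by (simp add: shift v'_def)
    qed
    then obtain \<alpha> where \<alpha>: "\<forall>c\<in>C. 0 \<le> \<alpha> c" "\<forall>x\<in>X. v' x = (\<Sum>c\<in>C. \<alpha> c * G' c x)"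
      using insert.IH[of G' v'] by blast
    define a where "a = (pair_on X y v - (\<Sum>c\<in>C. \<alpha> c * pair_on X y (G c))) / b"
    have "0 \<le> (\<Sum>c\<in>C. \<alpha> c * pair_on X y (G c))"
      using \<alpha>(1) y(1) by (intro sum_nonneg) auto
    then have a: "0 \<le> a"
      unfolding a_def using y(2) b by (intro divide_nonpos_neg) auto
    have "v x = (\<Sum>c\<in>insert e C. (\<alpha>(e := a)) c * G c x)" if x: "x \<in> X" for x
    proof -
      have "v x = v' x + (pair_on X y v / b) * G e x" by (simp add: v'_def)
      also have "\<dots> = (\<Sum>c\<in>C. \<alpha> c * G' c x) + (pair_on X y v / b) * G e x"
        using \<alpha>(2) x by simp
      also have "(\<Sum>c\<in>C. \<alpha> c * G' c x) =
          (\<Sum>c\<in>C. \<alpha> c * G c x) - (\<Sum>c\<in>C. \<alpha> c * pair_on X y (G c)) / b * G e x"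
        by (simp add: G'_def algebra_simps sum_subtractf sum_distrib_left sum_divide_distrib
          sum_distrib_right)
      also have "(\<Sum>c\<in>C. \<alpha> c * G c x) = (\<Sum>c\<in>C. (\<alpha>(e := a)) c * G c x)"
        using insert.hyps by (intro sum.cong) auto
      finally show ?thesis
        using insert.hyps by (simp add: a_def diff_divide_distrib algebra_simps)
    qed
    with \<alpha>(1) a show ?thesis by (intro exI[of _ "\<alpha>(e := a)"]) auto
  qed
qed

lemma col_cone_iff:
  assumes "finite C" "finite X" "\<And>c x. x \<notin> X \<Longrightarrow> G c x = 0" "\<And>x. x \<notin> X \<Longrightarrow> v x = 0"
  shows "v \<in> col_cone C G \<longleftrightarrow> (\<forall>y. (\<forall>c\<in>C. 0 \<le> pair_on X y (G c)) \<longrightarrow> 0 \<le> pair_on X y v)"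
proof
  assume "v \<in> col_cone C G"
  then obtain \<alpha> where v: "v = (\<lambda>x. \<Sum>c\<in>C. \<alpha> c * G c x)" and \<alpha>: "\<forall>c\<in>C. 0 \<le> \<alpha> c"
    by (auto simp: col_cone_def)
  show "\<forall>y. (\<forall>c\<in>C. 0 \<le> pair_on X y (G c)) \<longrightarrow> 0 \<le> pair_on X y v"
    unfolding v pair_on_sum_right using \<alpha> by (auto intro!: sum_nonneg)
next
  assume "\<forall>y. (\<forall>c\<in>C. 0 \<le> pair_on X y (G c)) \<longrightarrow> 0 \<le> pair_on X y v"
  then obtain \<alpha> where \<alpha>: "\<forall>c\<in>C. 0 \<le> \<alpha> c" "\<forall>x\<in>X. v x = (\<Sum>c\<in>C. \<alpha> c * G c x)"
    using Farkas[OF assms(1,2), of G v] by blast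
  have "v x = (\<Sum>c\<in>C. \<alpha> c * G c x)" for x
    using \<alpha>(2) assms(3,4) by (cases "x \<in> X") auto
  with \<alpha>(1) show "v \<in> col_cone C G" unfolding col_cone_def by blast
qed

text \<open>The largest subspace of a cone consists of the vectors whose negatives also lie in the cone,
so a generator outside it is detected by a functional that is positive there.\<close>

lemma not_in_largest_subspace_iff:
  assumes fin: "finite C" "finite X" and supp: "\<And>c x. x \<notin> X \<Longrightarrow> G c x = 0" and c: "c \<in> C"
  shows "G c \<notin> largest_subspace (col_cone C G) \<longleftrightarrow>
    (\<exists>y. (\<forall>c'\<in>C. 0 \<le> pair_on X y (G c')) \<and> 0 < pair_on X y (G c))"
proof -
  note largest = largest_subspace_col_cone[where C = C and G = G]
  have neg: "pair_on X y (\<lambda>x. - G c x) = - pair_on X y (G c)" for y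
    by (simp add: pair_on_def sum_negf)
  have iff: "(\<lambda>x. - G c x) \<in> col_cone C G \<longleftrightarrow>
      (\<forall>y. (\<forall>c'\<in>C. 0 \<le> pair_on X y (G c')) \<longrightarrow> pair_on X y (G c) \<le> 0)"
    by (subst col_cone_iff[OF fin supp]) (auto simp: supp neg)
  have "G c \<in> largest_subspace (col_cone C G) \<longleftrightarrow> (\<lambda>x. - G c x) \<in> col_cone C G"
  proof
    assume "G c \<in> largest_subspace (col_cone C G)"
    then have "(\<lambda>x. (- 1) * G c x) \<in> largest_subspace (col_cone C G)"
      using largest(1) unfolding linear_subspace_def by blast
    then show "(\<lambda>x. - G c x) \<in> col_cone C G" using largest(2) by auto
  next
    assume "(\<lambda>x. - G c x) \<in> col_cone C G"
    then obtain \<alpha> where \<alpha>: "(\<lambda>x. - G c x) = (\<lambda>x. \<Sum>c\<in>C. \<alpha> c * G c x)" "\<forall>c\<in>C. 0 \<le> \<alpha> c"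
      by (auto simp: col_cone_def)
    define S where "S = range (\<lambda>a x. a * G c x)"
    have "linear_subspace S"
      unfolding linear_subspace_def
    proof (intro conjI ballI allI)
      show "(\<lambda>x. 0) \<in> S" unfolding S_def by (rule range_eqI[of _ _ 0]) simp
      show "(\<lambda>x. v x + w x) \<in> S" if vw: "v \<in> S" "w \<in> S" for v w
      proof -
        obtain a b where "v = (\<lambda>x. a * G c x)" "w = (\<lambda>x. b * G c x)" using vw by (auto simp: S_def)
        then show ?thesis unfolding S_def by (intro range_eqI[of _ _ "a + b"]) (simp add: algebra_simps)
      qed
      show "(\<lambda>x. b * v x) \<in> S" if v: "v \<in> S" for b v
      proof -
        obtain a where "v = (\<lambda>x. a * G c x)" using v by (auto simp: S_def)
        then show ?thesis unfolding S_def by (intro range_eqI[of _ _ "b * a"]) (simp add: algebra_simps)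
      qed
    qed
    moreover have "S \<subseteq> col_cone C G"
    proof
      fix v assume "v \<in> S"
      then obtain a where v: "v = (\<lambda>x. a * G c x)" by (auto simp: S_def)
      show "v \<in> col_cone C G"
      proof (cases "0 \<le> a")
        case True
        have "v = (\<lambda>x. \<Sum>c'\<in>C. (if c' = c then a else 0) * G c' x)"
          using fin(1) c by (simp add: v if_distrib[of "\<lambda>r. r * _"] cong: if_cong)
        then show ?thesis using True unfolding col_cone_def
          by (auto intro!: exI[of _ "\<lambda>c'. if c' = c then a else 0"])
      next
        case False
        have "v = (\<lambda>x. (- a) * (- G c x))" by (simp add: v)
        also have "\<dots> = (\<lambda>x. (- a) * (\<Sum>c\<in>C. \<alpha> c * G c x))"
          using fun_cong[OF \<alpha>(1)] by simp
        also have "\<dots> = (\<lambda>x. \<Sum>c\<in>C. (- a * \<alpha> c) * G c x)" by (simp add: sum_distrib_left mult.assoc)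
        finally show ?thesis using False \<alpha>(2) unfolding col_cone_def
          by (intro CollectI exI[of _ "\<lambda>c. - a * \<alpha> c"]) (simp add: mult_nonpos_nonneg)
      qed
    qed
    moreover have "G c \<in> S" unfolding S_def by (rule range_eqI[of _ _ 1]) simp
    ultimately show "G c \<in> largest_subspace (col_cone C G)" using largest(3) by blast
  qed
  with iff show ?thesis by (auto simp: not_le)
qed

lemma col_range_iff:
  fixes G :: "'c \<Rightarrow> 'r \<Rightarrow> complex"
  assumes fin: "finite C" "finite X" and supp: "\<And>c x. x \<notin> X \<Longrightarrow> G c x = 0" "\<And>x. x \<notin> X \<Longrightarrow> v x = 0"
  shows "v \<in> col_range C G \<longleftrightarrow>
    (\<forall>y. (\<forall>c\<in>C. (\<Sum>x\<in>X. cnj (y x) * G c x) = 0) \<longrightarrow> (\<Sum>x\<in>X. cnj (y x) * v x) = 0)"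
proof
  assume "v \<in> col_range C G"
  then obtain \<alpha> where v: "v = (\<lambda>x. \<Sum>c\<in>C. \<alpha> c * G c x)" by (auto simp: col_range_def)
  have "(\<Sum>x\<in>X. cnj (y x) * v x) = (\<Sum>c\<in>C. \<alpha> c * (\<Sum>x\<in>X. cnj (y x) * G c x))" for y
  proof -
    have "(\<Sum>x\<in>X. cnj (y x) * v x) = (\<Sum>x\<in>X. \<Sum>c\<in>C. \<alpha> c * (cnj (y x) * G c x))"
      unfolding v by (simp add: sum_distrib_left mult_ac)
    then show ?thesis by (subst (asm) sum.swap) (simp add: sum_distrib_left)
  qed
  then show "\<forall>y. (\<forall>c\<in>C. (\<Sum>x\<in>X. cnj (y x) * G c x) = 0) \<longrightarrow> (\<Sum>x\<in>X. cnj (y x) * v x) = 0" by simp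
next
  assume ann: "\<forall>y. (\<forall>c\<in>C. (\<Sum>x\<in>X. cnj (y x) * G c x) = 0) \<longrightarrow> (\<Sum>x\<in>X. cnj (y x) * v x) = 0"
  \<comment> \<open>Over the reals, the complex span is the cone generated by the columns multiplied by the
    four units.\<close>
  define Q :: "complex set" where "Q = {1, - 1, \<i>, - \<i>}"
  define re where "re = (\<lambda>(g :: 'r \<Rightarrow> complex) (x, b). if b then Re (g x) else Im (g x))"
  define G' where "G' = (\<lambda>(c, u). re (\<lambda>x. u * G c x))"
  define X' where "X' = X \<times> (UNIV :: bool set)"
  have pair: "pair_on X' y (re g) = Re (\<Sum>x\<in>X. cnj (Complex (y (x, True)) (y (x, False))) * g x)" for y g
  proof -
    have "pair_on X' y (re g) = (\<Sum>x\<in>X. \<Sum>b\<in>UNIV. y (x, b) * re g (x, b))"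
      unfolding pair_on_def X'_def by (simp add: sum.cartesian_product case_prod_beta)
    then show ?thesis by (simp add: UNIV_bool re_def add.commute)
  qed
  have "\<exists>\<alpha>. (\<forall>c\<in>C \<times> Q. 0 \<le> \<alpha> c) \<and> (\<forall>x\<in>X'. re v x = (\<Sum>c\<in>C \<times> Q. \<alpha> c * G' c x))"
  proof (rule Farkas)
    show "finite (C \<times> Q)" "finite X'" using fin by (auto simp: Q_def X'_def)
    fix y assume y: "\<forall>c\<in>C \<times> Q. 0 \<le> pair_on X' y (G' c)"
    define y' where "y' = (\<lambda>x. Complex (y (x, True)) (y (x, False)))"
    have "(\<Sum>x\<in>X. cnj (y' x) * G c x) = 0" if c: "c \<in> C" for c
    proof -
      define s where "s = (\<Sum>x\<in>X. cnj (y' x) * G c x)"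
      have "0 \<le> Re (u * s)" if "u \<in> Q" for u
      proof -
        have "0 \<le> pair_on X' y (G' (c, u))" using y c that by blast
        also have "\<dots> = Re (\<Sum>x\<in>X. cnj (y' x) * (u * G c x))" by (simp add: G'_def pair y'_def)
        also have "(\<Sum>x\<in>X. cnj (y' x) * (u * G c x)) = u * s" by (simp add: s_def sum_distrib_left mult_ac)
        finally show ?thesis .
      qed
      from this[of 1] this[of "- 1"] this[of "\<i>"] this[of "- \<i>"] have "s = 0"
        by (simp add: Q_def complex_eq_iff)
      then show ?thesis by (simp add: s_def)
    qed
    then have "(\<Sum>x\<in>X. cnj (y' x) * v x) = 0" using ann by blast
    moreover have "pair_on X' y (re v) = Re (\<Sum>x\<in>X. cnj (y' x) * v x)" by (simp only: pair y'_def)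
    ultimately show "0 \<le> pair_on X' y (re v)" by simp
  qed
  then obtain \<alpha> where \<alpha>: "\<forall>x\<in>X'. re v x = (\<Sum>c\<in>C \<times> Q. \<alpha> c * G' c x)" by blast
  define \<beta> where "\<beta> = (\<lambda>c. \<Sum>u\<in>Q. of_real (\<alpha> (c, u)) * u)"
  have "v x = (\<Sum>c\<in>C. \<beta> c * G c x)" if x: "x \<in> X" for x
  proof -
    have "(\<Sum>c\<in>C. \<beta> c * G c x) = (\<Sum>c\<in>C. \<Sum>u\<in>Q. of_real (\<alpha> (c, u)) * (u * G c x))"
      by (simp add: \<beta>_def sum_distrib_right mult.assoc)
    also have "\<dots> = (\<Sum>c\<in>C \<times> Q. of_real (\<alpha> c) * (snd c * G (fst c) x))"
      by (simp add: sum.cartesian_product case_prod_beta)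
    finally have eq: "(\<Sum>c\<in>C. \<beta> c * G c x) = (\<Sum>c\<in>C \<times> Q. of_real (\<alpha> c) * (snd c * G (fst c) x))" .
    have "Re (v x) = (\<Sum>c\<in>C \<times> Q. \<alpha> c * Re (snd c * G (fst c) x))"
      using \<alpha>[rule_format, of "(x, True)"] x by (simp add: X'_def re_def G'_def case_prod_beta)
    moreover have "Im (v x) = (\<Sum>c\<in>C \<times> Q. \<alpha> c * Im (snd c * G (fst c) x))"
      using \<alpha>[rule_format, of "(x, False)"] x by (simp add: X'_def re_def G'_def case_prod_beta)
    ultimately show ?thesis unfolding eq complex_eq_iff
      by (simp only: Re_sum Im_sum scaleR_conv_of_real[symmetric] scaleR_complex.simps simp_thms)
  qed
  then have "v x = (\<Sum>c\<in>C. \<beta> c * G c x)" for x using supp by (cases "x \<in> X") auto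
  then show "v \<in> col_range C G" unfolding col_range_def by blast
qed

section \<open>Nonnegative exponential polynomials\<close>

lemma Cesaro_mean_null:
  fixes a :: "nat \<Rightarrow> complex"
  assumes "a \<longlonglongrightarrow> 0"
  shows "(\<lambda>N. (\<Sum>n<N. a n) / of_nat N) \<longlonglongrightarrow> 0"
proof (rule LIMSEQ_I)
  fix e :: real assume e: "0 < e"
  obtain M where M: "\<And>n. n \<ge> M \<Longrightarrow> norm (a n) < e / 2"
    using LIMSEQ_D[OF assms, of "e / 2"] e by auto
  define S where "S = (\<Sum>n<M. norm (a n))"
  obtain K :: nat where K: "2 * S / e < of_nat K" using reals_Archimedean2 by blast
  show "\<exists>N0. \<forall>N\<ge>N0. norm ((\<Sum>n<N. a n) / of_nat N - 0) < e"
  proof (intro exI allI impI)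
    fix N assume N: "N \<ge> max (Suc M) K"
    then have pos: "0 < real N" and "M \<le> N" by auto
    have "norm (\<Sum>n<N. a n) \<le> (\<Sum>n<N. norm (a n))" by (rule norm_sum)
    also have "\<dots> = S + (\<Sum>n\<in>{M..<N}. norm (a n))"
      unfolding S_def using \<open>M \<le> N\<close>
      by (simp add: lessThan_atLeast0 sum.atLeastLessThan_concat)
    also have "(\<Sum>n\<in>{M..<N}. norm (a n)) \<le> (\<Sum>n\<in>{M..<N}. e / 2)"
      by (intro sum_mono) (use M in \<open>auto intro: less_imp_le\<close>)
    also have "\<dots> \<le> real N * (e / 2)" using e by (auto intro!: mult_right_mono)
    also have "S < real N * (e / 2)"
      using K N e by (simp add: field_simps) (smt (verit) mult_left_mono of_nat_mono)
    finally have "norm (\<Sum>n<N. a n) < real N * e" by (simp add: field_simps)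
    then have "norm (\<Sum>n<N. a n) / real N < real N * e / real N"
      using pos by (rule divide_strict_right_mono)
    then have "norm (\<Sum>n<N. a n) / real N < e" using pos by simp
    then show "norm ((\<Sum>n<N. a n) / of_nat N - 0) < e" by (simp add: norm_divide)
  qed
qed

lemma mean_of_powers:
  fixes z :: complex
  assumes "norm z = 1"
  shows "(\<lambda>N. (\<Sum>n<N. z ^ n) / of_nat N) \<longlonglongrightarrow> (if z = 1 then 1 else 0)"
proof (cases "z = 1")
  case True
  have "(\<lambda>N. (\<Sum>n<N. z ^ n) / of_nat N) \<longlonglongrightarrow> 1"
    by (rule tendsto_eventually, rule eventually_mono[OF eventually_gt_at_top[of 0]])
       (simp add: True)
  with True show ?thesis by simp
next
  case False
  have "(\<lambda>N. (\<Sum>n<N. z ^ n) / of_nat N) \<longlonglongrightarrow> 0"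
  proof (rule Lim_null_comparison)
    have "norm ((\<Sum>n<N. z ^ n) / of_nat N) \<le> (2 / norm (z - 1)) / real N" for N
    proof -
      have "norm (z ^ N - 1) \<le> 2"
        using norm_triangle_ineq4[of "z ^ N" 1] assms by (simp add: norm_power)
      then show ?thesis
        using False by (simp add: geometric_sum norm_divide norm_mult divide_right_mono)
    qed
    then show "\<forall>\<^sub>F N in sequentially. norm ((\<Sum>n<N. z ^ n) / of_nat N) \<le> (2 / norm (z - 1)) / real N"
      by simp
    show "(\<lambda>N. (2 / norm (z - 1)) / real N) \<longlonglongrightarrow> 0"
      by (rule lim_const_over_n)
  qed
  with False show ?thesis by simp
qed

text \<open>The mean of \<open>G n * cnj w ^ n\<close> picks out the coefficient at frequency \<open>w\<close>; since \<open>G\<close> is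
nonnegative, its modulus is at most the mean of \<open>G\<close> itself, the coefficient at frequency \<open>1\<close>.\<close>

lemma Fourier_coefficient_bound:
  fixes c z :: "'i \<Rightarrow> complex" and G :: "nat \<Rightarrow> real" and a :: "nat \<Rightarrow> complex"
  assumes "finite J" and z: "\<And>j. j \<in> J \<Longrightarrow> norm (z j) = 1"
    and a: "a \<longlonglongrightarrow> 0"
    and G: "\<And>n. of_real (G n) = (\<Sum>j\<in>J. c j * z j ^ n) + a n" "\<And>n. 0 \<le> G n"
    and w: "norm w = 1"
  shows "(\<Sum>j | j \<in> J \<and> z j = 1. c j) \<in> \<real>"
    and "norm (\<Sum>j | j \<in> J \<and> z j = w. c j) \<le> Re (\<Sum>j | j \<in> J \<and> z j = 1. c j)"
proof -
  define C where "C = (\<lambda>w. \<Sum>j | j \<in> J \<and> z j = w. c j)"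
  have lim: "(\<lambda>N. (\<Sum>n<N. of_real (G n) * cnj v ^ n) / of_nat N) \<longlonglongrightarrow> C v" if v: "norm v = 1" for v
  proof -
    have unit: "z j * cnj v = 1 \<longleftrightarrow> z j = v" if "j \<in> J" for j
    proof -
      have "v * cnj v = 1" using v by (metis complex_norm_square of_real_1 one_power2)
      then show ?thesis by (metis mult.commute mult.left_commute mult_1_right)
    qed
    have eq: "(\<Sum>n<N. of_real (G n) * cnj v ^ n) / of_nat N =
        (\<Sum>j\<in>J. c j * ((\<Sum>n<N. (z j * cnj v) ^ n) / of_nat N)) +
        (\<Sum>n<N. a n * cnj v ^ n) / of_nat N" for N
    proof -
      have "(\<Sum>n<N. of_real (G n) * cnj v ^ n) =
          (\<Sum>n<N. \<Sum>j\<in>J. c j * (z j * cnj v) ^ n) + (\<Sum>n<N. a n * cnj v ^ n)"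
        unfolding G(1) by (simp add: distrib_right sum.distrib sum_distrib_right power_mult_distrib mult.assoc)
      also have "(\<Sum>n<N. \<Sum>j\<in>J. c j * (z j * cnj v) ^ n) = (\<Sum>j\<in>J. c j * (\<Sum>n<N. (z j * cnj v) ^ n))"
        by (subst sum.swap) (simp add: sum_distrib_left)
      finally show ?thesis by (simp only: add_divide_distrib sum_divide_distrib[where A = J] times_divide_eq_right)
    qed
    have a': "(\<lambda>n. a n * cnj v ^ n) \<longlonglongrightarrow> 0"
      by (rule Lim_null_comparison[OF _ tendsto_norm_zero[OF a]]) (simp add: norm_mult norm_power v)
    have "(\<lambda>N. (\<Sum>j\<in>J. c j * ((\<Sum>n<N. (z j * cnj v) ^ n) / of_nat N)) +
        (\<Sum>n<N. a n * cnj v ^ n) / of_nat N)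
        \<longlonglongrightarrow> (\<Sum>j\<in>J. c j * (if z j * cnj v = 1 then 1 else 0)) + 0"
      by (intro tendsto_add tendsto_sum tendsto_mult tendsto_const mean_of_powers
          Cesaro_mean_null a') (simp add: norm_mult z v)
    also have "(\<Sum>j\<in>J. c j * (if z j * cnj v = 1 then 1 else 0)) + 0 = C v"
      unfolding C_def using \<open>finite J\<close> by (simp add: unit if_distrib sum.If_cases Int_def cong: if_cong sum.cong)
    finally show ?thesis unfolding eq .
  qed
  have lim1: "(\<lambda>N. complex_of_real ((\<Sum>n<N. G n) / real N)) \<longlonglongrightarrow> C 1"
    using lim[of 1] by (simp add: of_real_sum)
  then have limRe: "(\<lambda>N. (\<Sum>n<N. G n) / real N) \<longlonglongrightarrow> Re (C 1)"
    using tendsto_Re by fastforce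
  have "(\<lambda>N. 0::real) \<longlonglongrightarrow> Im (C 1)"
    using tendsto_Im[OF lim1] by simp
  then have "Im (C 1) = 0" by (simp add: LIMSEQ_const_iff)
  then show "(\<Sum>j | j \<in> J \<and> z j = 1. c j) \<in> \<real>" by (simp add: C_def complex_is_Real_iff)
  have "norm (C w) \<le> Re (C 1)"
  proof (rule tendsto_le[OF _ limRe tendsto_norm[OF lim[OF w]]])
    have "norm ((\<Sum>n<N. complex_of_real (G n) * cnj w ^ n) / of_nat N) \<le> (\<Sum>n<N. G n) / real N" for N
    proof -
      have "norm (\<Sum>n<N. complex_of_real (G n) * cnj w ^ n) \<le> (\<Sum>n<N. norm (complex_of_real (G n) * cnj w ^ n))"
        by (rule norm_sum)
      also have "\<dots> = (\<Sum>n<N. G n)" by (simp add: norm_mult norm_power w G(2))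
      finally show ?thesis by (simp add: norm_divide divide_right_mono)
    qed
    then show "\<forall>\<^sub>F N in sequentially.
        norm ((\<Sum>n<N. complex_of_real (G n) * cnj w ^ n) / of_nat N) \<le> (\<Sum>n<N. G n) / real N" by simp
  qed simp
  then show "norm (\<Sum>j | j \<in> J \<and> z j = w. c j) \<le> Re (\<Sum>j | j \<in> J \<and> z j = 1. c j)"
    by (simp add: C_def)
qed

lemma poly_over_power_tendsto_coeff:
  fixes p :: "complex poly"
  assumes "degree p \<le> d"
  shows "((\<lambda>t::real. poly p (of_real t) / of_real t ^ d) \<longlongrightarrow> coeff p d) at_top"
proof -
  have "((\<lambda>t::real. \<Sum>i\<le>d. coeff p i * of_real (t ^ i / t ^ d)) \<longlongrightarrow>
      (\<Sum>i\<le>d. coeff p i * of_real (if i = d then 1 else 0))) at_top"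
  proof (intro tendsto_sum tendsto_mult tendsto_const tendsto_of_real)
    fix i assume i: "i \<in> {..d}"
    show "((\<lambda>t::real. t ^ i / t ^ d) \<longlongrightarrow> (if i = d then 1 else 0)) at_top"
    proof (cases "i = d")
      case True
      then show ?thesis
        by (auto intro!: tendsto_eventually eventually_mono[OF eventually_gt_at_top[of 0]])
    next
      case False
      then have "0 < d - i" using i by auto
      then have "((\<lambda>t::real. inverse (t ^ (d - i))) \<longlongrightarrow> 0) at_top"
        by (intro tendsto_inverse_0_at_top filterlim_pow_at_top filterlim_ident)
      moreover have "\<forall>\<^sub>F t::real in at_top. inverse (t ^ (d - i)) = t ^ i / t ^ d"
        using eventually_gt_at_top[of 0]
        by eventually_elim (use i in \<open>simp add: power_diff field_simps\<close>)
      ultimately show ?thesis using False by (simp add: tendsto_cong)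
    qed
  qed
  also have "(\<Sum>i\<le>d. coeff p i * of_real (if i = d then 1 else 0)) = coeff p d"
    by (simp add: if_distrib cong: if_cong)
  also have "(\<lambda>t::real. \<Sum>i\<le>d. coeff p i * of_real (t ^ i / t ^ d)) =
      (\<lambda>t::real. poly p (of_real t) / of_real t ^ d)"
    proof
    fix t :: real
    have "poly p (of_real t) = (\<Sum>i\<le>d. coeff p i * of_real t ^ i)"
      unfolding poly_altdef using assms
      by (intro sum.mono_neutral_left) (auto simp: coeff_eq_0)
    then show "(\<Sum>i\<le>d. coeff p i * of_real (t ^ i / t ^ d)) = poly p (of_real t) / of_real t ^ d"
      by (simp add: sum_divide_distrib)
  qed
  finally show ?thesis .
qed

lemma poly_times_decay_tendsto_0:
  fixes p :: "complex poly"
  assumes "a < 0"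
  shows "((\<lambda>t::real. exp (of_real (a * t)) * poly p (of_real t) / of_real t ^ d) \<longlongrightarrow> 0) at_top"
proof -
  have "((\<lambda>t::real. complex_of_real (t ^ degree p * exp (a * t)) * (1 / of_real t ^ d) *
      (poly p (of_real t) / of_real t ^ degree p)) \<longlongrightarrow> of_real 0 * (if d = 0 then 1 else 0) * coeff p (degree p)) at_top"
  proof (intro tendsto_mult tendsto_of_real poly_over_power_tendsto_coeff order_refl)
    show "((\<lambda>t. t ^ degree p * exp (a * t)) \<longlongrightarrow> 0) at_top"
    proof -
      have "((\<lambda>s::real. s ^ degree p / exp s) \<longlongrightarrow> 0) at_top"
        by (rule tendsto_power_div_exp_0)
      moreover have "filterlim (\<lambda>t. - a * t) at_top at_top"
        using assms by (intro filterlim_tendsto_pos_mult_at_top[OF tendsto_const]) (auto simp: filterlim_ident)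
      ultimately have "((\<lambda>t. (- a * t) ^ degree p / exp (- a * t)) \<longlongrightarrow> 0) at_top"
        by (rule filterlim_compose)
      then have "((\<lambda>t. (1 / (- a) ^ degree p) * ((- a * t) ^ degree p / exp (- a * t))) \<longlongrightarrow> (1 / (- a) ^ degree p) * 0) at_top"
        by (intro tendsto_mult tendsto_const)
      moreover have "(1 / (- a) ^ degree p) * ((- a * t) ^ degree p / exp (- a * t)) = t ^ degree p * exp (a * t)" for t
        using assms power_mult_distrib[of "- a" t "degree p"] by (simp add: exp_minus field_simps)
      ultimately show ?thesis by simp
    qed
    show "((\<lambda>t::real. 1 / complex_of_real t ^ d) \<longlongrightarrow> (if d = 0 then 1 else 0)) at_top"
    proof (cases "d = 0")
      case False
      then have "((\<lambda>t::real. complex_of_real (inverse (t ^ d))) \<longlongrightarrow> of_real 0) at_top"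
        by (intro tendsto_of_real tendsto_inverse_0_at_top filterlim_pow_at_top filterlim_ident) auto
      with False show ?thesis by (simp add: inverse_eq_divide)
    qed simp
  qed
  then have "((\<lambda>t::real. complex_of_real (t ^ degree p * exp (a * t)) * (1 / of_real t ^ d) *
      (poly p (of_real t) / of_real t ^ degree p)) \<longlongrightarrow> 0) at_top" by simp
  then show ?thesis
    by (rule Lim_transform_eventually)
       (use eventually_gt_at_top[of 0] in \<open>eventually_elim, simp only: exp_of_real, simp add: field_simps\<close>)
qed

lemma exp_ii_neq_1:
  fixes x :: real
  assumes "x \<noteq> 0" "\<bar>x\<bar> < 2 * pi"
  shows "exp (\<i> * of_real x) \<noteq> 1"
proof
  assume "exp (\<i> * of_real x) = 1"
  then obtain n :: int where n: "x = of_int (2 * n) * pi" by (auto simp: exp_eq_1)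
  then have "n \<noteq> 0" using assms(1) by auto
  then have "1 \<le> \<bar>real_of_int n\<bar>" by linarith
  then have "2 * pi * 1 \<le> 2 * pi * \<bar>real_of_int n\<bar>" by (intro mult_left_mono) auto
  with n assms(2) show False by (simp add: abs_mult)
qed

text \<open>Divide by \<open>e\<^sup>\<rho>\<^sup>t t\<^sup>d\<close>, where \<open>\<rho>\<close> is the largest real part and \<open>d\<close> the largest degree that goes with
it. What is left is, up to a null function, a trigonometric sum that is nonnegative in the
limit, and for such a sum the constant term dominates all other coefficients.\<close>

theorem nonneg_exp_poly_dominant_real:
  fixes \<mu> :: "'i \<Rightarrow> complex" and P :: "'i \<Rightarrow> complex poly" and f :: "real \<Rightarrow> real"
  assumes J: "finite J" "inj_on \<mu> J"
    and f: "\<And>t. 0 \<le> t \<Longrightarrow> of_real (f t) = (\<Sum>j\<in>J. exp (\<mu> j * of_real t) * poly (P j) (of_real t))"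
      "\<And>t. 0 \<le> t \<Longrightarrow> 0 \<le> f t"
    and j0: "j0 \<in> J" "P j0 \<noteq> 0"
    and top: "\<And>j. j \<in> J \<Longrightarrow> P j \<noteq> 0 \<Longrightarrow> Re (\<mu> j) \<le> Re (\<mu> j0)"
  shows "\<exists>j\<in>J. \<mu> j = of_real (Re (\<mu> j0)) \<and> lead_coeff (P j) \<in> \<real> \<and> 0 < Re (lead_coeff (P j))"
proof -
  define \<rho> where "\<rho> = Re (\<mu> j0)"
  define T where "T = {j \<in> J. P j \<noteq> 0 \<and> Re (\<mu> j) = \<rho>}"
  define d where "d = Max ((\<lambda>j. degree (P j)) ` T)"
  have T: "finite T" "j0 \<in> T" using J j0 by (auto simp: T_def \<rho>_def)
  have deg: "degree (P j) \<le> d" if "j \<in> T" for j using that T by (auto simp: d_def)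
  obtain j1 where j1: "j1 \<in> T" "degree (P j1) = d"
  proof -
    have "d \<in> (\<lambda>j. degree (P j)) ` T" unfolding d_def using T by (intro Max_in) auto
    then show ?thesis using that by auto
  qed
  define c where "c = (\<lambda>j. if j \<in> T then coeff (P j) d else 0)"
  define h where "h = 1 / (1 + 2 * (\<Sum>j\<in>J. \<bar>Im (\<mu> j)\<bar>))"
  define z where "z = (\<lambda>j. exp (\<i> * of_real (Im (\<mu> j) * h)))"
  have S: "0 \<le> (\<Sum>j\<in>J. \<bar>Im (\<mu> j)\<bar>)" by (intro sum_nonneg) simp
  then have "0 < 1 + 2 * (\<Sum>j\<in>J. \<bar>Im (\<mu> j)\<bar>)" by linarith
  then have h: "0 < h" unfolding h_def by (simp only: zero_less_divide_1_iff)
  have ImJ: "\<bar>Im (\<mu> j)\<bar> * h \<le> 1 / 2" if "j \<in> J" for j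
  proof -
    have "\<bar>Im (\<mu> j)\<bar> \<le> (\<Sum>j\<in>J. \<bar>Im (\<mu> j)\<bar>)" using J that by (intro member_le_sum) auto
    then show ?thesis using S by (simp add: h_def divide_le_eq)
  qed
  \<comment> \<open>The sampling step \<open>h\<close> is so small that no two frequencies are aliased.\<close>
  have z_inj: "Im (\<mu> i) = Im (\<mu> j)" if "i \<in> J" "j \<in> J" "z i = z j" for i j
  proof (rule ccontr)
    assume ne: "Im (\<mu> i) \<noteq> Im (\<mu> j)"
    have "\<bar>(Im (\<mu> i) - Im (\<mu> j)) * h\<bar> \<le> \<bar>Im (\<mu> i)\<bar> * h + \<bar>Im (\<mu> j)\<bar> * h"
      using h abs_triangle_ineq4[of "Im (\<mu> i) * h" "Im (\<mu> j) * h"] by (simp add: abs_mult left_diff_distrib)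
    also have "\<dots> < 2 * pi" using ImJ[OF that(1)] ImJ[OF that(2)] pi_gt3 by linarith
    finally have "exp (\<i> * of_real ((Im (\<mu> i) - Im (\<mu> j)) * h)) \<noteq> 1"
      using ne h by (intro exp_ii_neq_1) auto
    moreover have "exp (\<i> * of_real ((Im (\<mu> i) - Im (\<mu> j)) * h)) = z i / z j"
      by (simp add: z_def exp_diff[symmetric] algebra_simps)
    ultimately show False using that by (simp add: z_def)
  qed
  have z_one: "Im (\<mu> j) = 0" if "j \<in> J" "z j = 1" for j
  proof (rule ccontr)
    assume "Im (\<mu> j) \<noteq> 0"
    moreover have "\<bar>Im (\<mu> j) * h\<bar> < 2 * pi" using ImJ[OF that(1)] h pi_gt3 by (simp add: abs_mult)
    ultimately have "exp (\<i> * of_real (Im (\<mu> j) * h)) \<noteq> 1" using h by (intro exp_ii_neq_1) auto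
    with that show False by (simp add: z_def)
  qed
  have unique: "i = j" if "i \<in> T" "j \<in> T" "Im (\<mu> i) = Im (\<mu> j)" for i j
    using that J by (auto simp: T_def inj_on_def complex_eq_iff)
  define F where "F = (\<lambda>j (t::real). exp (\<mu> j * of_real t) * poly (P j) (of_real t) * exp (of_real (- \<rho> * t)) / of_real t ^ d)"
  have limF: "((\<lambda>t. F j t - c j * exp (\<i> * of_real (Im (\<mu> j) * t))) \<longlongrightarrow> 0) at_top" if j: "j \<in> J" for j
  proof -
    have split: "exp (\<mu> j * of_real t) * exp (of_real (- \<rho> * t)) =
        exp (of_real ((Re (\<mu> j) - \<rho>) * t)) * exp (\<i> * of_real (Im (\<mu> j) * t))" for t :: real
    proof -
      have "\<mu> j * of_real t + of_real (- \<rho> * t) =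
          of_real ((Re (\<mu> j) - \<rho>) * t) + \<i> * of_real (Im (\<mu> j) * t)"
        by (simp add: complex_eq_iff algebra_simps)
      then show ?thesis by (simp only: exp_add[symmetric])
    qed
    consider "j \<in> T" | "P j = 0" | "P j \<noteq> 0" "Re (\<mu> j) < \<rho>"
      using top[OF j] j by (force simp: T_def \<rho>_def)
    then show ?thesis
    proof cases
      case 1
      then have re: "Re (\<mu> j) = \<rho>" by (simp add: T_def)
      show ?thesis
      proof (rule Lim_null_comparison)
        have "((\<lambda>t::real. poly (P j) (of_real t) / of_real t ^ d - coeff (P j) d) \<longlongrightarrow> 0) at_top"
          using poly_over_power_tendsto_coeff[OF deg[OF 1]] by (simp add: LIM_zero_iff)
        then show "((\<lambda>t::real. norm (poly (P j) (of_real t) / of_real t ^ d - coeff (P j) d)) \<longlongrightarrow> 0) at_top"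
          by (rule tendsto_norm_zero)
        have "F j t - c j * exp (\<i> * of_real (Im (\<mu> j) * t)) =
            exp (\<i> * of_real (Im (\<mu> j) * t)) * (poly (P j) (of_real t) / of_real t ^ d - coeff (P j) d)" for t
        proof -
          have "F j t = exp (\<mu> j * of_real t) * exp (of_real (- \<rho> * t)) * (poly (P j) (of_real t) / of_real t ^ d)"
            by (simp add: F_def)
          also have "\<dots> = exp (\<i> * of_real (Im (\<mu> j) * t)) * (poly (P j) (of_real t) / of_real t ^ d)"
            unfolding split re by simp
          finally show ?thesis using 1 by (simp add: c_def algebra_simps)
        qed
        then show "\<forall>\<^sub>F t in at_top. norm (F j t - c j * exp (\<i> * of_real (Im (\<mu> j) * t)))
            \<le> norm (poly (P j) (of_real t) / of_real t ^ d - coeff (P j) d)"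
          by (simp add: norm_mult)
      qed
    next
      case 2
      then show ?thesis by (simp add: F_def c_def T_def)
    next
      case 3
      have c0: "c j = 0" using 3 by (simp add: c_def T_def)
      show ?thesis
      proof (rule Lim_null_comparison)
        show "((\<lambda>t::real. norm (exp (of_real ((Re (\<mu> j) - \<rho>) * t)) * poly (P j) (of_real t) / of_real t ^ d)) \<longlongrightarrow> 0) at_top"
          using 3 by (intro tendsto_norm_zero poly_times_decay_tendsto_0) simp
        have "F j t = exp (\<i> * of_real (Im (\<mu> j) * t)) * (exp (of_real ((Re (\<mu> j) - \<rho>) * t)) * poly (P j) (of_real t) / of_real t ^ d)" for t
        proof -
          have "F j t = exp (\<mu> j * of_real t) * exp (of_real (- \<rho> * t)) * (poly (P j) (of_real t) / of_real t ^ d)"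
            by (simp add: F_def)
          then show ?thesis unfolding split by simp
        qed
        then show "\<forall>\<^sub>F t in at_top. norm (F j t - c j * exp (\<i> * of_real (Im (\<mu> j) * t)))
            \<le> norm (exp (of_real ((Re (\<mu> j) - \<rho>) * t)) * poly (P j) (of_real t) / of_real t ^ d)"
          by (simp add: c0 norm_mult norm_divide del: of_real_mult)
      qed
    qed
  qed
  define s where "s = (\<lambda>n::nat. h * real (Suc n))"
  have s: "0 < s n" for n using h by (simp add: s_def)
  have s_top: "filterlim s at_top sequentially"
    unfolding s_def using h
    by (intro filterlim_tendsto_pos_mult_at_top[OF tendsto_const] filterlim_compose[OF filterlim_real_sequentially filterlim_Suc])
  define G where "G = (\<lambda>n. f (s n) * exp (- \<rho> * s n) / s n ^ d)"
  define a where "a = (\<lambda>n. \<Sum>j\<in>J. F j (s n) - c j * exp (\<i> * of_real (Im (\<mu> j) * s n)))"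
  have a: "a \<longlonglongrightarrow> 0"
    unfolding a_def by (rule tendsto_null_sum) (rule filterlim_compose[OF limF s_top])
  have G: "of_real (G n) = (\<Sum>j\<in>J. c j * z j * z j ^ n) + a n" for n
  proof -
    have zn: "exp (\<i> * of_real (Im (\<mu> j) * s n)) = z j * z j ^ n" for j
    proof -
      have "z j ^ Suc n = exp (of_nat (Suc n) * (\<i> * of_real (Im (\<mu> j) * h)))"
        unfolding z_def by (rule exp_of_nat_mult[symmetric])
      then show ?thesis by (simp add: s_def algebra_simps)
    qed
    have "of_real (G n) = (\<Sum>j\<in>J. F j (s n))"
      using f(1)[of "s n"] s[of n]
      by (simp add: G_def F_def sum_divide_distrib sum_distrib_right exp_of_real[symmetric])
    then show ?thesis
      by (simp add: a_def zn sum_subtractf mult.assoc del: of_real_mult)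
  qed
  have G0: "0 \<le> G n" for n
    unfolding G_def using f(2)[of "s n"] s[of n] by simp
  have zunit: "norm (z j) = 1" for j by (simp add: z_def)
  note bound = Fourier_coefficient_bound[OF J(1) zunit a G G0 zunit[of j1]]
  have single: "(\<Sum>j | j \<in> J \<and> z j = z i. c j * z j) = c i * z i" if i: "i \<in> T" for i
  proof -
    have "(\<Sum>j | j \<in> J \<and> z j = z i. c j * z j) = (\<Sum>j\<in>{i}. c j * z j)"
    proof (rule sum.mono_neutral_right)
      show "finite {j. j \<in> J \<and> z j = z i}" using J by simp
      show "{i} \<subseteq> {j. j \<in> J \<and> z j = z i}" using i by (auto simp: T_def)
      show "\<forall>j\<in>{j. j \<in> J \<and> z j = z i} - {i}. c j * z j = 0"
      proof
        fix j assume j: "j \<in> {j. j \<in> J \<and> z j = z i} - {i}"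
        then have "Im (\<mu> j) = Im (\<mu> i)" using i by (intro z_inj) (auto simp: T_def)
        then have "j \<notin> T" using unique[of j i] i j by auto
        then show "c j * z j = 0" by (simp add: c_def)
      qed
    qed
    then show ?thesis by simp
  qed
  have cj1: "c j1 \<noteq> 0" using j1 by (auto simp: c_def T_def)
  have "0 < norm (c j1 * z j1)" using cj1 by (simp add: z_def)
  also have "\<dots> \<le> Re (\<Sum>j | j \<in> J \<and> z j = 1. c j * z j)"
    using bound(2) single[OF j1(1)] by simp
  finally have pos: "0 < Re (\<Sum>j | j \<in> J \<and> z j = 1. c j * z j)" .
  have "\<exists>j\<in>J. z j = 1 \<and> c j \<noteq> 0"
  proof (rule ccontr)
    assume "\<not> (\<exists>j\<in>J. z j = 1 \<and> c j \<noteq> 0)"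
    then have "(\<Sum>j | j \<in> J \<and> z j = 1. c j * z j) = 0" by (intro sum.neutral) auto
    with pos show False by (simp only: zero_complex.simps less_irrefl)
  qed
  then obtain j where j: "j \<in> J" "z j = 1" "c j \<noteq> 0" by blast
  then have jT: "j \<in> T" by (auto simp: c_def split: if_splits)
  have lam: "\<mu> j = of_real \<rho>" using z_one[OF j(1,2)] jT by (simp add: T_def complex_eq_iff)
  have "degree (P j) = d" using deg[OF jT] j(3) jT by (auto simp: c_def intro: le_antisym le_degree)
  then have lc: "lead_coeff (P j) = c j" using jT by (simp add: c_def)
  have "(\<Sum>i | i \<in> J \<and> z i = 1. c i * z i) = c j" using single[OF jT] j(2) by simp
  with bound(1) pos have "c j \<in> \<real>" "0 < Re (c j)" by (simp_all only:)
  with lc lam j(1) show ?thesis unfolding \<rho>_def by auto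
qed

text \<open>If the last nonzero number \<open>a d\<close> is positive, all derivatives of the polynomial
\<open>\<Sum>\<^sub>s a s * t\<^sup>s / s!\<close> have positive leading coefficients or vanish.\<close>

lemma eventually_flow_nonneg:
  fixes a :: "nat \<Rightarrow> real"
  assumes d: "0 < a d" "\<And>r. d < r \<Longrightarrow> a r = 0" and "d < N"
  shows "\<forall>\<^sub>F t in at_top. (\<forall>r. 0 \<le> (\<Sum>s<N. t ^ s / fact s * a (r + s))) \<and> 0 < (\<Sum>s<N. t ^ s / fact s * a s)"
proof -
  define p where "p = (\<lambda>r. \<Sum>s<N. monom (a (r + s) / fact s) s)"
  have poly: "poly (p r) t = (\<Sum>s<N. t ^ s / fact s * a (r + s))" for r t
    by (simp add: p_def poly_sum poly_monom mult_ac)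
  have coeff: "coeff (p r) s = (if s < N then a (r + s) / fact s else 0)" for r s
    by (simp add: p_def coeff_sum)
  have ev: "\<forall>\<^sub>F t in at_top. 0 < poly (p r) t" if r: "r \<le> d" for r
  proof -
    have c: "0 < coeff (p r) (d - r)" using r d(1) \<open>d < N\<close> by (simp add: coeff)
    have "degree (p r) \<le> d - r" using d(2) by (intro degree_le) (auto simp: coeff)
    moreover have "d - r \<le> degree (p r)" using c by (intro le_degree) auto
    ultimately have "0 < lead_coeff (p r)" using c by simp
    then obtain n where "\<forall>x\<ge>n. lead_coeff (p r) \<le> poly (p r) x" using poly_pinfty_gt_lc by blast
    with \<open>0 < lead_coeff (p r)\<close> show ?thesis
      unfolding eventually_at_top_linorder by (intro exI[of _ n]) (auto intro: less_le_trans)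
  qed
  have "\<forall>\<^sub>F t in at_top. \<forall>r\<in>{..d}. 0 < poly (p r) t"
    using ev by (intro eventually_ball_finite) auto
  then show ?thesis
  proof eventually_elim
    case (elim t)
    have "0 \<le> poly (p r) t" for r
    proof (cases "r \<le> d")
      case True
      then show ?thesis using elim by (simp add: less_imp_le)
    next
      case False
      then have "poly (p r) t = 0" unfolding poly using d(2) by (intro sum.neutral) auto
      then show ?thesis by simp
    qed
    moreover have "0 < poly (p 0) t" using elim by simp
    ultimately show ?case unfolding poly by simp
  qed
qed

section \<open>The matrix exponential\<close>

lemma matpow_Suc_right: "matpow M (Suc r) = matpow M r ** M"
  for M :: "'a::comm_semiring_1^'n^'n"
  by (induction r) (simp_all add: matrix_mul_assoc)

lemma matpow_scaleR: "matpow (t *\<^sub>R M) r = t ^ r *\<^sub>R matpow M r" for M :: "real^'n^'n"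
  by (induction r)
     (simp_all add: vec_eq_iff matrix_matrix_mult_def sum_distrib_left mult_ac)

lemma matpow_entry_bound:
  fixes M :: "real^'n^'n"
  shows "\<bar>matpow M r $ i $ j\<bar> \<le> (\<Sum>a\<in>UNIV. \<Sum>b\<in>UNIV. \<bar>M $ a $ b\<bar>) ^ r"
proof (induction r arbitrary: i)
  case 0
  show ?case by (simp add: mat_def)
next
  case (Suc r)
  let ?K = "\<Sum>a\<in>UNIV. \<Sum>b\<in>UNIV. \<bar>M $ a $ b\<bar>"
  have "\<bar>matpow M (Suc r) $ i $ j\<bar> \<le> (\<Sum>a\<in>UNIV. \<bar>M $ i $ a\<bar> * \<bar>matpow M r $ a $ j\<bar>)"
    by (simp add: matrix_matrix_mult_def sum_abs flip: abs_mult)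
  also have "\<dots> \<le> (\<Sum>a\<in>UNIV. \<bar>M $ i $ a\<bar> * ?K ^ r)"
    by (intro sum_mono mult_left_mono Suc.IH) simp
  also have "\<dots> = (\<Sum>a\<in>UNIV. \<bar>M $ i $ a\<bar>) * ?K ^ r"
    by (simp add: sum_distrib_right)
  also have "\<dots> \<le> ?K * ?K ^ r"
    by (intro mult_right_mono member_le_sum[where f = "\<lambda>i. \<Sum>a\<in>UNIV. \<bar>M $ i $ a\<bar>"]
        zero_le_power sum_nonneg) auto
  finally show ?case by simp
qed

text \<open>The exponential series is treated entrywise: each entry of \<open>mexp (t *\<^sub>R M)\<close> is an everywhere
convergent power series in \<open>t\<close>, so the results on differentiating power series apply.\<close>

lemma summable_matpow_entry: "summable (\<lambda>r. matpow M r $ i $ j / fact r * t ^ r)" for M :: "real^'n^'n"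
proof (rule summable_comparison_test)
  let ?K = "\<Sum>a\<in>UNIV. \<Sum>b\<in>UNIV. \<bar>M $ a $ b\<bar>"
  show "summable (\<lambda>r. (?K * \<bar>t\<bar>) ^ r /\<^sub>R fact r)" by (rule summable_exp_generic)
  have "norm (matpow M r $ i $ j / fact r * t ^ r) \<le> (?K * \<bar>t\<bar>) ^ r /\<^sub>R fact r" for r
  proof -
    have "\<bar>matpow M r $ i $ j\<bar> * \<bar>t\<bar> ^ r \<le> ?K ^ r * \<bar>t\<bar> ^ r"
      by (intro mult_right_mono matpow_entry_bound) simp
    then have "\<bar>matpow M r $ i $ j\<bar> * \<bar>t\<bar> ^ r / fact r \<le> ?K ^ r * \<bar>t\<bar> ^ r / fact r"
      by (rule divide_right_mono) simp
    then show ?thesis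
      by (simp add: abs_mult power_abs power_mult_distrib divide_inverse mult_ac)
  qed
  then show "\<exists>N. \<forall>r\<ge>N. norm (matpow M r $ i $ j / fact r * t ^ r) \<le> (?K * \<bar>t\<bar>) ^ r /\<^sub>R fact r" by blast
qed

lemma mexp_entry: "mexp (t *\<^sub>R M) $ i $ j = (\<Sum>r. matpow M r $ i $ j / fact r * t ^ r)"
proof -
  have "(\<lambda>r. matpow (t *\<^sub>R M) r /\<^sub>R fact r) sums (\<chi> i j. \<Sum>r. matpow M r $ i $ j / fact r * t ^ r)"
    unfolding sums_def
  proof (intro vec_tendstoI)
    fix a b
    have "(\<lambda>r. matpow M r $ a $ b / fact r * t ^ r) sums (\<Sum>r. matpow M r $ a $ b / fact r * t ^ r)"
      using summable_matpow_entry by (rule summable_sums)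
    then show "(\<lambda>n. (\<Sum>r<n. matpow (t *\<^sub>R M) r /\<^sub>R fact r) $ a $ b)
        \<longlonglongrightarrow> (\<chi> i j. \<Sum>r. matpow M r $ i $ j / fact r * t ^ r) $ a $ b"
      unfolding sums_def by (simp add: matpow_scaleR divide_inverse mult_ac)
  qed
  then show ?thesis unfolding mexp_def by (simp add: sums_unique[symmetric])
qed

lemma mexp_zero [simp]: "mexp 0 = (mat 1 :: real^'n^'n)"
proof -
  have "mexp (0 *\<^sub>R M) $ i $ j = mat 1 $ i $ j" for i j and M :: "real^'n^'n"
    unfolding mexp_entry using powser_zero[of "\<lambda>r. matpow M r $ i $ j / fact r"] by simp
  then show ?thesis by (simp add: vec_eq_iff)
qed

lemma mexp_entry_derivative:
  fixes M :: "real^'n^'n"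
  shows "((\<lambda>t. mexp (t *\<^sub>R M) $ i $ j) has_field_derivative (M ** mexp (t *\<^sub>R M)) $ i $ j) (at t)"
    and "((\<lambda>t. mexp (t *\<^sub>R M) $ i $ j) has_field_derivative (mexp (t *\<^sub>R M) ** M) $ i $ j) (at t)"
proof -
  let ?c = "\<lambda>i j r. matpow M r $ i $ j / fact r"
  have D: "((\<lambda>t. mexp (t *\<^sub>R M) $ i $ j) has_field_derivative (\<Sum>r. diffs (?c i j) r * t ^ r)) (at t)"
    unfolding mexp_entry
    by (rule termdiffs_strong_converges_everywhere[OF summable_matpow_entry])
  have diffs: "diffs (?c i j) r = matpow M (Suc r) $ i $ j / fact r" for r
    unfolding diffs_def fact_Suc by (simp del: of_nat_Suc matpow.simps)
  have "(\<Sum>r. diffs (?c i j) r * t ^ r) = (\<Sum>r. \<Sum>a\<in>UNIV. M $ i $ a * (?c a j r * t ^ r))"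
    unfolding diffs
    by (simp add: matrix_matrix_mult_def sum_divide_distrib sum_distrib_right mult.assoc)
  also have "\<dots> = (\<Sum>a\<in>UNIV. \<Sum>r. M $ i $ a * (?c a j r * t ^ r))"
    by (intro suminf_sum summable_mult summable_matpow_entry)
  also have "\<dots> = (M ** mexp (t *\<^sub>R M)) $ i $ j"
    by (simp only: matrix_matrix_mult_def mexp_entry vec_lambda_beta suminf_mult[OF summable_matpow_entry])
  finally show "((\<lambda>t. mexp (t *\<^sub>R M) $ i $ j) has_field_derivative (M ** mexp (t *\<^sub>R M)) $ i $ j) (at t)"
    using D by simp
  have "(\<Sum>r. diffs (?c i j) r * t ^ r) = (\<Sum>r. \<Sum>a\<in>UNIV. M $ a $ j * (?c i a r * t ^ r))"
    unfolding diffs matpow_Suc_right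
    by (simp add: matrix_matrix_mult_def sum_divide_distrib sum_distrib_left sum_distrib_right mult_ac)
  also have "\<dots> = (\<Sum>a\<in>UNIV. \<Sum>r. M $ a $ j * (?c i a r * t ^ r))"
    by (intro suminf_sum summable_mult summable_matpow_entry)
  also have "\<dots> = (mexp (t *\<^sub>R M) ** M) $ i $ j"
    by (simp only: matrix_matrix_mult_def mexp_entry vec_lambda_beta suminf_mult[OF summable_matpow_entry])
      (simp only: mult.commute)
  finally show "((\<lambda>t. mexp (t *\<^sub>R M) $ i $ j) has_field_derivative (mexp (t *\<^sub>R M) ** M) $ i $ j) (at t)"
    using D by simp
qed

lemma mexp_commute: "M ** mexp (t *\<^sub>R M) = mexp (t *\<^sub>R M) ** M" for M :: "real^'n^'n"
  unfolding vec_eq_iff using DERIV_unique[OF mexp_entry_derivative] by blast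

lemma has_vector_derivative_vecI:
  fixes f :: "real \<Rightarrow> ('a::real_normed_vector)^'n"
  assumes "\<And>i. ((\<lambda>t. f t $ i) has_vector_derivative D $ i) (at t within S)"
  shows "(f has_vector_derivative D) (at t within S)"
  using assms unfolding has_vector_derivative_def has_derivative_within
  by (auto intro!: vec_tendstoI bounded_linear_scaleR_left)

lemma mexp_has_vector_derivative:
  "((\<lambda>t. mexp (t *\<^sub>R M)) has_vector_derivative M ** mexp (t *\<^sub>R M)) (at t within S)"
  for M :: "real^'n^'n"
  by (intro has_vector_derivative_vecI, rule has_vector_derivative_at_within)
     (use mexp_entry_derivative(1) in \<open>simp add: has_real_derivative_iff_has_vector_derivative\<close>)

lemma bounded_bilinear_matrix_vector:
  "bounded_bilinear ((*v) :: real^'n^'m \<Rightarrow> real^'n \<Rightarrow> real^'m)"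
  unfolding bilinear_conv_bounded_bilinear[symmetric] bilinear_def
  by (auto intro!: linearI simp: matrix_vector_mult_add_rdistrib
      matrix_vector_right_distrib vec.scale scaleR_matrix_vector_assoc
      vec_eq_iff matrix_vector_mult_def sum_distrib_left sum.distrib algebra_simps)

lemmas matrix_vector_derivative = bounded_bilinear.has_vector_derivative[OF bounded_bilinear_matrix_vector]

lemma mexp_vec_derivative:
  "((\<lambda>t. mexp (t *\<^sub>R M) *v b) has_vector_derivative M *v (mexp (t *\<^sub>R M) *v b)) (at t within S)"
  for M :: "real^'n^'n"
  using matrix_vector_derivative[OF mexp_has_vector_derivative[of M t S] has_vector_derivative_const[of b]]
  by (simp add: matrix_vector_mul_assoc)

lemma continuous_on_mexp [continuous_intros]: "continuous_on S (\<lambda>t. mexp (t *\<^sub>R M))"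
  for M :: "real^'n^'n"
  by (rule continuous_on_vector_derivative) (rule mexp_has_vector_derivative)

lemma mexp_reverse_derivative:
  "((\<lambda>s. mexp ((t - s) *\<^sub>R M)) has_vector_derivative - (M ** mexp ((t - s) *\<^sub>R M))) (at s within S)"
  for M :: "real^'n^'n"
proof -
  have "((\<lambda>s. t - s) has_vector_derivative - 1) (at s within S)"
    by (auto intro!: derivative_eq_intros)
  from vector_diff_chain_within[OF this mexp_has_vector_derivative]
  show ?thesis by (simp add: o_def)
qed

text \<open>The product of the flow for time \<open>r\<close> and the flow for the remaining time has derivative zero
in \<open>r\<close>.\<close>

lemma mexp_add: "mexp ((s + t) *\<^sub>R M) *v b = mexp (s *\<^sub>R M) *v (mexp (t *\<^sub>R M) *v b)"
  for M :: "real^'n^'n"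
proof -
  define F where "F = (\<lambda>r. mexp (((s + t) - r) *\<^sub>R M) *v (mexp (r *\<^sub>R M) *v b))"
  have "(F has_vector_derivative 0) (at r)" for r
  proof -
    have "(F has_vector_derivative mexp (((s + t) - r) *\<^sub>R M) *v (M *v (mexp (r *\<^sub>R M) *v b)) +
        - (M ** mexp (((s + t) - r) *\<^sub>R M)) *v (mexp (r *\<^sub>R M) *v b)) (at r)"
      unfolding F_def by (intro matrix_vector_derivative mexp_reverse_derivative mexp_vec_derivative)
    moreover have "mexp (((s + t) - r) *\<^sub>R M) *v (M *v (mexp (r *\<^sub>R M) *v b)) +
        - (M ** mexp (((s + t) - r) *\<^sub>R M)) *v (mexp (r *\<^sub>R M) *v b) = 0"
      unfolding bounded_bilinear.minus_left[OF bounded_bilinear_matrix_vector] mexp_commute[of M "s + t - r"]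
      by (simp add: matrix_vector_mul_assoc matrix_mul_assoc)
    ultimately show ?thesis by simp
  qed
  then have "F 0 = F t"
    by (metis UNIV_I convex_UNIV has_vector_derivative_zero_constant has_vector_derivative_at_within)
  then show ?thesis by (simp add: F_def)
qed

section \<open>Variation of constants for integrable inputs\<close>

lemma bilinear_matrix_vector: "bilinear ((*v) :: real^'n^'m \<Rightarrow> real^'n \<Rightarrow> real^'m)"
  using bounded_bilinear_matrix_vector by (simp add: bilinear_conv_bounded_bilinear)

lemma absolutely_integrable_matrix_vector:
  fixes G :: "real \<Rightarrow> real^'n^'m" and h :: "real \<Rightarrow> real^'n"
  assumes "continuous_on {a..b} G" "h absolutely_integrable_on {a..b}"
  shows "(\<lambda>s. G s *v h s) absolutely_integrable_on {a..b}"
proof (rule absolutely_integrable_bounded_measurable_product[OF bilinear_matrix_vector])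
  show "G \<in> borel_measurable (lebesgue_on {a..b})"
    using assms(1) by (intro continuous_imp_measurable_on_sets_lebesgue) auto
  show "bounded (G ` {a..b})"
    using assms(1) by (intro compact_imp_bounded compact_continuous_image) auto
qed (use assms in auto)

lemma has_integral_norm_le:
  fixes f :: "real \<Rightarrow> 'a::euclidean_space"
  assumes "(f has_integral i) {a..b}" "(g has_integral j) {a..b}"
    and "\<And>s. s \<in> {a..b} \<Longrightarrow> norm (f s) \<le> g s"
  shows "norm i \<le> j"
  using integral_norm_bound_integral[of f "{a..b}" g] assms by (auto simp: has_integral_iff)

text \<open>The indefinite integral of \<open>h\<close> need not be differentiable everywhere, so the usual product rule
does not apply. Instead, the difference of the two sides is shown to have derivative zero,
because its increments over \<open>{a..b}\<close> are bounded by \<open>b - a\<close> times the increment of the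
continuous function \<open>\<Psi>\<close>.\<close>

lemma absolutely_continuous_product_rule:
  fixes G G' :: "real \<Rightarrow> real^'n^'m" and h :: "real \<Rightarrow> real^'n"
  assumes h: "h absolutely_integrable_on {0..T}" and "0 \<le> T"
    and G: "\<And>t. (G has_vector_derivative G' t) (at t within {0..T})"
    and G': "continuous_on {0..T} G'"
  shows "((\<lambda>s. G' s *v integral {0..s} h + G s *v h s) has_integral (G T *v integral {0..T} h)) {0..T}"
proof -
  interpret mv: bounded_bilinear "(*v) :: real^'n^'m \<Rightarrow> real^'n \<Rightarrow> real^'m"
    by (rule bounded_bilinear_matrix_vector)
  define H where "H = (\<lambda>t. integral {0..t} h)"
  define f where "f = (\<lambda>s. G' s *v H s + G s *v h s)"
  define \<Psi> where "\<Psi> = (\<lambda>t. integral {0..t} (\<lambda>s. norm (h s)))"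
  define \<Phi> where "\<Phi> = (\<lambda>t. integral {0..t} f - G t *v H t)"
  have hint: "h integrable_on {0..T}" and nint: "(\<lambda>s. norm (h s)) integrable_on {0..T}"
    using h by (auto simp: absolutely_integrable_on_def)
  have contH: "continuous_on {0..T} H" and cont\<Psi>: "continuous_on {0..T} \<Psi>"
    unfolding H_def \<Psi>_def by (intro indefinite_integral_continuous_1 hint nint)+
  have contG: "continuous_on {0..T} G"
    by (rule continuous_on_vector_derivative) (rule G)
  have f: "f absolutely_integrable_on {0..T}"
    unfolding f_def
    by (rule set_integral_add(1)[OF
        absolutely_integrable_continuous_real[OF mv.continuous_on[OF G' contH]]
        absolutely_integrable_matrix_vector[OF contG h]])
  then have fint: "f integrable_on {0..T}" by (auto simp: absolutely_integrable_on_def)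
  obtain M where M: "\<And>s. s \<in> {0..T} \<Longrightarrow> norm (G' s) \<le> M" "0 < M"
  proof -
    have "bounded (G' ` {0..T})" using G' by (intro compact_imp_bounded compact_continuous_image) auto
    then obtain b where "0 < b" "\<forall>x\<in>{0..T}. norm (G' x) \<le> b" by (auto simp: bounded_pos)
    then show ?thesis by (intro that[of b]) auto
  qed
  obtain K where K: "0 < K" "\<And>(X :: real^'n^'m) v. norm (X *v v) \<le> norm X * norm v * K"
    using mv.pos_bounded by blast
  \<comment> \<open>The increment of \<open>\<Phi>\<close> is of second order: it is bounded by the product of the increments
    of two continuous functions.\<close>
  have incr: "norm (\<Phi> b - \<Phi> a) \<le> 2 * K * M * (b - a) * (\<Psi> b - \<Psi> a)"
    if ab: "0 \<le> a" "a \<le> b" "b \<le> T" for a b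
  proof -
    have sub: "{a..b} \<subseteq> {0..T}" using ab by auto
    have split: "integral {0..b} g = integral {0..a} g + integral {a..b} g" if "g integrable_on {0..T}"
      for g :: "real \<Rightarrow> 'z::euclidean_space"
      using Henstock_Kurzweil_Integration.integral_combine[of 0 a b g] ab
        integrable_subinterval_real[OF that, of 0 b] by auto
    have Hdiff: "H b - H a = integral {a..b} h" and \<Psi>diff: "\<Psi> b - \<Psi> a = integral {a..b} (\<lambda>s. norm (h s))"
      unfolding H_def \<Psi>_def using split[OF hint] split[OF nint] by auto
    have Gint: "(G' has_integral (G s - G a)) {a..s}" if "a \<le> s" "s \<le> b" for s
      using that ab by (intro fundamental_theorem_of_calculus)
        (auto intro: has_vector_derivative_within_subset[OF G])
    have Gbound: "norm (G s - G a) \<le> M * (b - a)" if "s \<in> {a..b}" for s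
    proof -
      have "norm (G s - G a) \<le> M * (s - a)"
        using has_integral_bound_real[OF _ finite.emptyI Gint[of s], of M] that M ab by auto
      also have "\<dots> \<le> M * (b - a)" using that M(2) by (intro mult_left_mono) auto
      finally show ?thesis .
    qed
    have Hbound: "norm (H s - H b) \<le> \<Psi> b - \<Psi> a" if "s \<in> {a..b}" for s
    proof -
      have hs: "h integrable_on {s..b}" "(\<lambda>s. norm (h s)) integrable_on {s..b}"
        "(\<lambda>s. norm (h s)) integrable_on {a..b}"
        using that ab by (auto intro: integrable_subinterval_real[OF hint] integrable_subinterval_real[OF nint])
      have "H b - H s = integral {s..b} h"
        using Henstock_Kurzweil_Integration.integral_combine[of 0 s b h] that ab
          integrable_subinterval_real[OF hint, of 0 b] unfolding H_def by (auto simp: algebra_simps)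
      then have "norm (H s - H b) \<le> integral {s..b} (\<lambda>s. norm (h s))"
        using integral_norm_bound_integral[OF hs(1,2)] by (metis norm_minus_commute order_refl)
      also have "\<dots> \<le> integral {a..b} (\<lambda>s. norm (h s))"
        using hs that by (intro integral_subset_le) auto
      finally show ?thesis unfolding \<Psi>diff .
    qed
    have i1: "(f has_integral (integral {0..b} f - integral {0..a} f)) {a..b}"
      using split[OF fint] integrable_subinterval_real[OF fint sub] by (simp add: has_integral_iff)
    have i2: "((\<lambda>s. G' s *v H b) has_integral ((G b - G a) *v H b)) {a..b}"
      using has_integral_linear[OF Gint mv.bounded_linear_left[of "H b"]] ab by (simp add: o_def)
    have i3: "((\<lambda>s. G a *v h s) has_integral (G a *v (H b - H a))) {a..b}"
      unfolding Hdiff using has_integral_linear[OF integrable_integral[OF integrable_subinterval_real[OF hint sub]]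
          mv.bounded_linear_right[of "G a"]] by (simp add: o_def)
    have "((\<lambda>s. G' s *v (H s - H b) + (G s - G a) *v h s) has_integral (\<Phi> b - \<Phi> a)) {a..b}"
      using has_integral_diff[OF has_integral_diff[OF i1 i2] i3]
      by (rule has_integral_eq_rhs[OF has_integral_eq, rotated])
         (auto simp: f_def \<Phi>_def mv.diff_left mv.diff_right algebra_simps)
    moreover have "((\<lambda>s. K * M * (\<Psi> b - \<Psi> a) + K * M * (b - a) * norm (h s)) has_integral
        ((b - a) *\<^sub>R (K * M * (\<Psi> b - \<Psi> a)) + K * M * (b - a) * (\<Psi> b - \<Psi> a))) {a..b}"
    proof (rule has_integral_add)
      show "((\<lambda>s. K * M * (\<Psi> b - \<Psi> a)) has_integral (b - a) *\<^sub>R (K * M * (\<Psi> b - \<Psi> a))) {a..b}"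
        using has_integral_const_real[of "K * M * (\<Psi> b - \<Psi> a)" a b] ab by simp
      show "((\<lambda>s. K * M * (b - a) * norm (h s)) has_integral K * M * (b - a) * (\<Psi> b - \<Psi> a)) {a..b}"
        unfolding \<Psi>diff
        by (intro has_integral_mult_right integrable_integral integrable_subinterval_real[OF nint sub])
    qed
    ultimately have "norm (\<Phi> b - \<Phi> a) \<le> (b - a) *\<^sub>R (K * M * (\<Psi> b - \<Psi> a)) + K * M * (b - a) * (\<Psi> b - \<Psi> a)"
    proof (rule has_integral_norm_le)
      fix s assume s: "s \<in> {a..b}"
      have "norm (G' s *v (H s - H b)) \<le> M * (\<Psi> b - \<Psi> a) * K"
        using K M(1)[of s] M(2) Hbound[OF s] s sub
        by (intro order_trans[OF K(2)] mult_right_mono mult_mono) auto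
      moreover have "norm ((G s - G a) *v h s) \<le> M * (b - a) * norm (h s) * K"
        using K Gbound[OF s] by (intro order_trans[OF K(2)] mult_right_mono) auto
      ultimately show "norm (G' s *v (H s - H b) + (G s - G a) *v h s)
          \<le> K * M * (\<Psi> b - \<Psi> a) + K * M * (b - a) * norm (h s)"
        using norm_triangle_ineq[of "G' s *v (H s - H b)" "(G s - G a) *v h s"]
        by (simp add: mult_ac)
    qed
    then show ?thesis by (simp add: algebra_simps)
  qed
  have "(\<Phi> has_vector_derivative 0) (at t within {0..T})" if t: "t \<in> {0..T}" for t
    unfolding has_vector_derivative_def has_derivative_within
  proof (rule conjI[OF _ Lim_null_comparison])
    show "bounded_linear (\<lambda>x. x *\<^sub>R (0 :: real^'m))" by simp
    have "norm (\<Phi> y - \<Phi> t) \<le> 2 * K * M * \<bar>y - t\<bar> * \<bar>\<Psi> y - \<Psi> t\<bar>" if "y \<in> {0..T}" for y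
    proof (cases "y \<le> t")
      case True
      have "norm (\<Phi> y - \<Phi> t) \<le> 2 * K * M * (t - y) * (\<Psi> t - \<Psi> y)"
        using incr[of y t] t that True by (simp add: norm_minus_commute)
      also have "t - y = \<bar>y - t\<bar>" using True by simp
      also have "2 * K * M * \<bar>y - t\<bar> * (\<Psi> t - \<Psi> y) \<le> 2 * K * M * \<bar>y - t\<bar> * \<bar>\<Psi> y - \<Psi> t\<bar>"
        using K M(2) by (intro mult_left_mono) auto
      finally show ?thesis .
    next
      case False
      have "norm (\<Phi> y - \<Phi> t) \<le> 2 * K * M * (y - t) * (\<Psi> y - \<Psi> t)"
        using incr[of t y] t that False by simp
      also have "y - t = \<bar>y - t\<bar>" using False by simp
      also have "2 * K * M * \<bar>y - t\<bar> * (\<Psi> y - \<Psi> t) \<le> 2 * K * M * \<bar>y - t\<bar> * \<bar>\<Psi> y - \<Psi> t\<bar>"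
        using K M(2) by (intro mult_left_mono) auto
      finally show ?thesis .
    qed
    then have "norm ((1 / norm (y - t)) *\<^sub>R (\<Phi> y - (\<Phi> t + (y - t) *\<^sub>R 0))) \<le> 2 * K * M * \<bar>\<Psi> y - \<Psi> t\<bar>"
      if "y \<in> {0..T}" "y \<noteq> t" for y
      using that by (simp add: divide_le_eq mult_ac)
    then show "\<forall>\<^sub>F y in at t within {0..T}.
        norm ((1 / norm (y - t)) *\<^sub>R (\<Phi> y - (\<Phi> t + (y - t) *\<^sub>R 0))) \<le> 2 * K * M * \<bar>\<Psi> y - \<Psi> t\<bar>"
      by (auto simp: eventually_at_filter)
    have "(\<Psi> \<longlongrightarrow> \<Psi> t) (at t within {0..T})" using cont\<Psi> t by (auto simp: continuous_on_def)
    then have "((\<lambda>y. 2 * K * M * \<bar>\<Psi> y - \<Psi> t\<bar>) \<longlongrightarrow> 2 * K * M * \<bar>\<Psi> t - \<Psi> t\<bar>) (at t within {0..T})"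
      by (intro tendsto_intros)
    then show "((\<lambda>y. 2 * K * M * \<bar>\<Psi> y - \<Psi> t\<bar>) \<longlongrightarrow> 0) (at t within {0..T})" by simp
  qed
  then obtain c where c: "\<And>t. t \<in> {0..T} \<Longrightarrow> \<Phi> t = c"
    using has_vector_derivative_zero_constant[of "{0..T}" \<Phi>] by auto
  have "\<Phi> T = \<Phi> 0" using c[of 0] c[of T] \<open>0 \<le> T\<close> by simp
  moreover have "\<Phi> 0 = 0" by (simp add: \<Phi>_def H_def)
  ultimately have "integral {0..T} f = G T *v H T" by (simp add: \<Phi>_def)
  with fint show ?thesis by (simp add: has_integral_iff f_def H_def)
qed

lemma continuous_on_matrix_mult_left:
  fixes M :: "real^'n^'m" and G :: "'a::topological_space \<Rightarrow> real^'k^'n"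
  shows "continuous_on S G \<Longrightarrow> continuous_on S (\<lambda>t. M ** G t)"
  unfolding matrix_matrix_mult_def by (intro continuous_intros)

text \<open>The product rule is applied to \<open>e\<^sup>(\<^sup>T\<^sup>-\<^sup>s\<^sup>)\<^sup>A\<close> and to \<open>x s - x 0\<close>, the indefinite integral of
\<open>A x + w\<close>; the terms with \<open>A x\<close> cancel.\<close>

lemma variation_of_constants:
  fixes A :: "real^'n^'n" and x w :: "real \<Rightarrow> real^'n"
  assumes w: "w absolutely_integrable_on {0..T}" and "0 \<le> T"
    and sol: "\<And>t. t \<in> {0..T} \<Longrightarrow> ((\<lambda>s. A *v x s + w s) has_integral (x t - x 0)) {0..t}"
  shows "((\<lambda>s. mexp ((T - s) *\<^sub>R A) *v w s) has_integral (x T - mexp (T *\<^sub>R A) *v x 0)) {0..T}"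
proof -
  define h where "h = (\<lambda>s. A *v x s + w s)"
  define G where "G = (\<lambda>s. mexp ((T - s) *\<^sub>R A))"
  have H: "integral {0..t} h = x t - x 0" if "t \<in> {0..T}" for t
    using sol[OF that] unfolding h_def by (rule integral_unique)
  have contx: "continuous_on {0..T} x"
  proof -
    have "h integrable_on {0..T}" using sol[of T] \<open>0 \<le> T\<close> by (auto simp: h_def)
    then have "continuous_on {0..T} (\<lambda>t. integral {0..t} h + x 0)"
      by (intro continuous_intros indefinite_integral_continuous_1)
    then show ?thesis by (rule continuous_on_eq) (simp add: H)
  qed
  have h: "h absolutely_integrable_on {0..T}"
    unfolding h_def
    by (intro set_integral_add(1) w absolutely_integrable_matrix_vector[OF continuous_on_const]
        absolutely_integrable_continuous_real contx)
  have G': "(G has_vector_derivative - (A ** G t)) (at t within S)" for t S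
    unfolding G_def by (rule mexp_reverse_derivative)
  have contG': "continuous_on {0..T} (\<lambda>t. - (A ** G t))"
    unfolding G_def
    by (intro continuous_intros continuous_on_matrix_mult_left
        continuous_on_compose2[OF continuous_on_mexp[of UNIV A]]) auto
  have "((\<lambda>s. - (A ** G s) *v integral {0..s} h + G s *v h s) has_integral (x T - x 0)) {0..T}"
    using absolutely_continuous_product_rule[OF h \<open>0 \<le> T\<close> G' contG'] H[of T] \<open>0 \<le> T\<close>
    by (simp add: G_def)
  moreover have "((\<lambda>s. - (A ** G s) *v x 0) has_integral (G T *v x 0 - G 0 *v x 0)) {0..T}"
    using \<open>0 \<le> T\<close> matrix_vector_derivative[OF G' has_vector_derivative_const]
    by (intro fundamental_theorem_of_calculus) auto
  ultimately have "((\<lambda>s. - (A ** G s) *v integral {0..s} h + G s *v h s + - (A ** G s) *v x 0)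
      has_integral (x T - x 0 + (G T *v x 0 - G 0 *v x 0))) {0..T}"
    by (rule has_integral_add)
  then show ?thesis
  proof (rule has_integral_eq_rhs[OF has_integral_eq, rotated])
    show "x T - mexp (T *\<^sub>R A) *v x 0 = x T - x 0 + (G T *v x 0 - G 0 *v x 0)" by (simp add: G_def)
    fix s assume s: "s \<in> {0..T}"
    have com: "A ** G s = G s ** A" unfolding G_def by (rule mexp_commute)
    have "- (A ** G s) *v (x s - x 0) + G s *v h s + - (A ** G s) *v x 0 = G s *v w s"
      unfolding bounded_bilinear.minus_left[OF bounded_bilinear_matrix_vector] com h_def
      by (simp add: matrix_vector_right_distrib matrix_vector_mult_diff_distrib
          matrix_vector_mul_assoc[symmetric])
    then show "- (A ** G s) *v integral {0..s} h + G s *v h s + - (A ** G s) *v x 0 = mexp ((T - s) *\<^sub>R A) *v w s"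
      by (simp add: H[OF s] G_def)
  qed
qed

lemma linear_ode_solution:
  fixes A :: "real^'n^'n" and w :: "real \<Rightarrow> real^'n" and x0 :: "real^'n"
  assumes w: "w absolutely_integrable_on {0..T}" and t: "t \<in> {0..T}"
  defines "x \<equiv> \<lambda>t. mexp (t *\<^sub>R A) *v (x0 + integral {0..t} (\<lambda>s. mexp (- s *\<^sub>R A) *v w s))"
  shows "((\<lambda>s. A *v x s + w s) has_integral (x t - x0)) {0..t}"
proof -
  define h where "h = (\<lambda>s. mexp (- s *\<^sub>R A) *v w s)"
  have x_h: "x = (\<lambda>t. mexp (t *\<^sub>R A) *v (x0 + integral {0..t} h))"
    by (simp add: x_def h_def)
  have "w absolutely_integrable_on {0..t}"
    using w t by (intro absolutely_integrable_on_subinterval[OF w]) auto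
  then have h: "h absolutely_integrable_on {0..t}"
    unfolding h_def
    by (intro absolutely_integrable_matrix_vector)
       (intro continuous_intros continuous_on_compose2[OF continuous_on_mexp[of UNIV A]], auto)
  have cont: "continuous_on {0..t} (\<lambda>t. A ** mexp (t *\<^sub>R A))"
    by (intro continuous_on_matrix_mult_left continuous_on_mexp)
  have "((\<lambda>s. (A ** mexp (s *\<^sub>R A)) *v integral {0..s} h + mexp (s *\<^sub>R A) *v h s) has_integral
      mexp (t *\<^sub>R A) *v integral {0..t} h) {0..t}"
    using t by (intro absolutely_continuous_product_rule h mexp_has_vector_derivative cont) auto
  moreover have "((\<lambda>s. A *v (mexp (s *\<^sub>R A) *v x0)) has_integral
      (mexp (t *\<^sub>R A) *v x0 - mexp (0 *\<^sub>R A) *v x0)) {0..t}"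
    using t by (intro fundamental_theorem_of_calculus mexp_vec_derivative) auto
  ultimately have "((\<lambda>s. (A ** mexp (s *\<^sub>R A)) *v integral {0..s} h + mexp (s *\<^sub>R A) *v h s +
      A *v (mexp (s *\<^sub>R A) *v x0)) has_integral
      (mexp (t *\<^sub>R A) *v integral {0..t} h + (mexp (t *\<^sub>R A) *v x0 - mexp (0 *\<^sub>R A) *v x0))) {0..t}"
    by (rule has_integral_add)
  moreover have "mexp (s *\<^sub>R A) *v h s = w s" for s
    unfolding h_def mexp_add[symmetric] by (simp add: mexp_add[symmetric])
  ultimately show ?thesis
    by (simp add: x_h matrix_vector_right_distrib matrix_vector_mul_assoc algebra_simps)
qed

definition drive :: "('q \<Rightarrow> 'p::finite \<Rightarrow> real^'n) \<Rightarrow> (real \<Rightarrow> real^'p) \<Rightarrow> 'q \<Rightarrow> real \<Rightarrow> real^'n" where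
  "drive B u i s = (\<Sum>\<sigma>\<in>UNIV. (u s $ \<sigma>) *\<^sub>R B i \<sigma>)"

lemma drive_absolutely_integrable:
  fixes B :: "'q \<Rightarrow> 'p::finite \<Rightarrow> real^'n"
  assumes "positive_input T u"
  shows "drive B u i absolutely_integrable_on {0..T}"
proof -
  have "linear (\<lambda>v :: real^'p. \<Sum>\<sigma>\<in>UNIV. (v $ \<sigma>) *\<^sub>R B i \<sigma>)"
    by (rule linearI) (simp_all add: scaleR_left_distrib sum.distrib scaleR_sum_right)
  then have "bounded_linear (\<lambda>v :: real^'p. \<Sum>\<sigma>\<in>UNIV. (v $ \<sigma>) *\<^sub>R B i \<sigma>)"
    by (simp add: linear_conv_bounded_linear)
  from absolutely_integrable_linear[OF _ this] assms show ?thesis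
    by (auto simp: positive_input_def o_def drive_def[abs_def])
qed

lemma array_solution_final_state:
  assumes "array_solution A B T u x" "positive_input T u" "0 \<le> T"
  shows "((\<lambda>s. mexp ((T - s) *\<^sub>R A) *v drive B u i s) has_integral
    (x i T - mexp (T *\<^sub>R A) *v x i 0)) {0..T}"
  using assms by (intro variation_of_constants drive_absolutely_integrable)
    (auto simp: array_solution_def drive_def)

lemma array_solution_exists:
  fixes A :: "real^'n^'n" and B :: "'q \<Rightarrow> 'p::finite \<Rightarrow> real^'n"
  assumes "positive_input T u"
  obtains x where "array_solution A B T u x" "\<And>i. x i 0 = x0 i"
proof -
  define x where "x = (\<lambda>i t. mexp (t *\<^sub>R A) *v (x0 i + integral {0..t} (\<lambda>s. mexp (- s *\<^sub>R A) *v drive B u i s)))"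
  have x0: "x i 0 = x0 i" for i by (simp add: x_def)
  have "array_solution A B T u x"
    unfolding array_solution_def
  proof (intro allI ballI)
    fix i t assume t: "t \<in> {0..T}"
    show "((\<lambda>s. A *v x i s + (\<Sum>\<sigma>\<in>UNIV. (u s $ \<sigma>) *\<^sub>R B i \<sigma>)) has_integral (x i t - x i 0)) {0..t}"
      using linear_ode_solution[OF drive_absolutely_integrable[OF assms] t, of A "x0 i" B i]
      unfolding x0 by (simp add: x_def drive_def)
  qed
  with x0 show ?thesis by (rule that[rotated])
qed

section \<open>The positively reachable cone\<close>

text \<open>Block \<open>i\<close> of a stacked vector. The stacked system consists of uncoupled copies of \<open>A\<close>, so all
its objects are computed block by block.\<close>

definition block :: "real^('q::finite \<times> 'n::finite) \<Rightarrow> 'q \<Rightarrow> real^'n" where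
  "block z i = (\<chi> a. z $ (i, a))"

lemma block_add: "block (y + z) i = block y i + block z i"
  and block_scaleR: "block (c *\<^sub>R z) i = c *\<^sub>R block z i"
  by (simp_all add: block_def vec_eq_iff)

lemma inner_block: "y \<bullet> z = (\<Sum>i\<in>UNIV. block y i \<bullet> block z i)"
  for y z :: "real^('q::finite \<times> 'n::finite)"
  by (simp add: inner_vec_def block_def sum.cartesian_product UNIV_Times_UNIV[symmetric] case_prod_beta
      del: UNIV_Times_UNIV)

lemma stacked_A_entry: "stacked_A A $ (i, a) $ (j, b) = (if i = j then A $ a $ b else 0)"
  by (simp add: stacked_A_def kron_def mat_def)

lemma matpow_stacked:
  "matpow (stacked_A A) r $ (i, a) $ (j, b) = (if i = j then matpow A r $ a $ b else 0)"
proof (induction r arbitrary: i a)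
  case 0
  show ?case by (simp add: mat_def)
next
  case (Suc r)
  have "matpow (stacked_A A) (Suc r) $ (i, a) $ (j, b) =
      (\<Sum>(i', c)\<in>UNIV \<times> UNIV. (if i = i' then 1 else 0) * A $ a $ c * (if i' = j then matpow A r $ c $ b else 0))"
    unfolding matpow.simps matrix_matrix_mult_def UNIV_Times_UNIV
    by (auto simp: Suc.IH stacked_A_entry intro!: sum.cong)
  also have "\<dots> = (\<Sum>i'\<in>UNIV. \<Sum>c\<in>UNIV. (if i = i' then 1 else 0) * A $ a $ c * (if i' = j then matpow A r $ c $ b else 0))"
    by (rule sum.cartesian_product[symmetric])
  also have "\<dots> = (\<Sum>c\<in>UNIV. \<Sum>i'\<in>UNIV. if i = i' then A $ a $ c * (if i' = j then matpow A r $ c $ b else 0) else 0)"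
    by (subst sum.swap) (intro sum.cong refl, simp)
  also have "\<dots> = (if i = j then matpow A (Suc r) $ a $ b else 0)"
    by (simp add: matrix_matrix_mult_def)
  finally show ?case .
qed

lemma mexp_stacked:
  "mexp (s *\<^sub>R stacked_A A) $ (i, a) $ (j, b) = (if i = j then mexp (s *\<^sub>R A) $ a $ b else 0)"
  by (simp add: mexp_entry matpow_stacked)

lemma block_mexp_stacked:
  "block (mexp (s *\<^sub>R stacked_A A) *v z) i = mexp (s *\<^sub>R A) *v block z i"
  for z :: "real^('q::finite \<times> 'n::finite)"
proof -
  have "(mexp (s *\<^sub>R stacked_A A) *v z) $ (i, a) = (\<Sum>b\<in>UNIV. mexp (s *\<^sub>R A) $ a $ b * z $ (i, b))" for a
  proof -
    have "(mexp (s *\<^sub>R stacked_A A) *v z) $ (i, a) =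
        (\<Sum>(j, b)\<in>UNIV \<times> UNIV. if i = j then mexp (s *\<^sub>R A) $ a $ b * z $ (j, b) else 0)"
      unfolding matrix_vector_mult_def UNIV_Times_UNIV
      by (auto simp: mexp_stacked intro!: sum.cong)
    also have "\<dots> = (\<Sum>j\<in>UNIV. \<Sum>b\<in>UNIV. if i = j then mexp (s *\<^sub>R A) $ a $ b * z $ (j, b) else 0)"
      by (rule sum.cartesian_product[symmetric])
    also have "\<dots> = (\<Sum>b\<in>UNIV. mexp (s *\<^sub>R A) $ a $ b * z $ (i, b))"
      by (subst sum.swap) simp
    finally show ?thesis .
  qed
  then show ?thesis by (simp add: block_def vec_eq_iff matrix_vector_mult_def)
qed

lemma block_stacked_B: "block (stacked_B B *v u t) i = drive B u i t"
  by (simp add: block_def stacked_B_def drive_def vec_eq_iff matrix_vector_mult_def mult.commute)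

lemma has_integral_vec_iff:
  fixes f :: "'a::euclidean_space \<Rightarrow> real^'n"
  shows "(f has_integral y) S \<longleftrightarrow> (\<forall>i. ((\<lambda>x. f x $ i) has_integral y $ i) S)"
  by (subst has_integral_componentwise_iff) (auto simp: Basis_vec_def inner_axis)

lemma has_integral_block_iff:
  fixes f :: "'a::euclidean_space \<Rightarrow> real^('q::finite \<times> 'n::finite)"
  shows "(f has_integral y) S \<longleftrightarrow> (\<forall>i. ((\<lambda>x. block (f x) i) has_integral block y i) S)"
proof -
  have "((\<lambda>x. block (f x) i) has_integral block y i) S \<longleftrightarrow>
      (\<forall>a. ((\<lambda>x. f x $ (i, a)) has_integral y $ (i, a)) S)" for i
    by (subst has_integral_vec_iff) (simp add: block_def)
  then show ?thesis by (simp add: has_integral_vec_iff[of f])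
qed

text \<open>Reachability at a fixed final time is kept apart, because controllability asks for one time that
serves all blocks and, in the end, all differences.\<close>

definition reach :: "real^'n^'n \<Rightarrow> ('q::finite \<Rightarrow> 'p::finite \<Rightarrow> real^'n) \<Rightarrow> real \<Rightarrow> (real^('q \<times> 'n)) set" where
  "reach A B T = {\<xi>. \<exists>u. positive_input T u \<and>
     (\<forall>i. ((\<lambda>t. mexp ((T - t) *\<^sub>R A) *v drive B u i t) has_integral block \<xi> i) {0..T})}"

lemma positively_reachable_eq: "positively_reachable A B = (\<Union>T\<in>{0..}. reach A B T)"
  unfolding positively_reachable_def reach_def has_integral_block_iff block_mexp_stacked block_stacked_B
  by auto

lemma reach_zero:
  fixes B :: "'q::finite \<Rightarrow> 'p::finite \<Rightarrow> real^'n"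
  shows "0 \<in> reach A B T"
proof -
  have "positive_input T (\<lambda>t. 0)" by (simp add: positive_input_def)
  moreover have "block 0 i = 0" for i :: 'q by (simp add: block_def vec_eq_iff)
  ultimately show ?thesis
    unfolding reach_def by (auto simp: drive_def intro!: exI[of _ "\<lambda>t. 0"])
qed

lemma reach_add:
  assumes "\<xi> \<in> reach A B T" "\<zeta> \<in> reach A B T"
  shows "\<xi> + \<zeta> \<in> reach A B T"
proof -
  obtain u v where u: "positive_input T u" "\<And>i. ((\<lambda>t. mexp ((T - t) *\<^sub>R A) *v drive B u i t) has_integral block \<xi> i) {0..T}"
    and v: "positive_input T v" "\<And>i. ((\<lambda>t. mexp ((T - t) *\<^sub>R A) *v drive B v i t) has_integral block \<zeta> i) {0..T}"
    using assms unfolding reach_def by blast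
  have "positive_input T (\<lambda>t. u t + v t)"
    using u(1) v(1) by (auto simp: positive_input_def intro: set_integral_add(1))
  moreover have "((\<lambda>t. mexp ((T - t) *\<^sub>R A) *v drive B (\<lambda>t. u t + v t) i t) has_integral block (\<xi> + \<zeta>) i) {0..T}" for i
    using has_integral_add[OF u(2) v(2), of i]
    by (simp add: block_add drive_def scaleR_left_distrib sum.distrib matrix_vector_right_distrib)
  ultimately show ?thesis unfolding reach_def by blast
qed

lemma reach_scaleR:
  assumes "\<xi> \<in> reach A B T" "0 \<le> c"
  shows "c *\<^sub>R \<xi> \<in> reach A B T"
proof -
  obtain u where u: "positive_input T u" "\<And>i. ((\<lambda>t. mexp ((T - t) *\<^sub>R A) *v drive B u i t) has_integral block \<xi> i) {0..T}"
    using assms unfolding reach_def by blast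
  have "positive_input T (\<lambda>t. c *\<^sub>R u t)"
    using u(1) assms(2) by (auto simp: positive_input_def)
  moreover have "((\<lambda>t. mexp ((T - t) *\<^sub>R A) *v drive B (\<lambda>t. c *\<^sub>R u t) i t) has_integral block (c *\<^sub>R \<xi>) i) {0..T}" for i
  proof -
    have "drive B (\<lambda>t. c *\<^sub>R u t) i t = c *\<^sub>R drive B u i t" for t
      by (simp add: drive_def scaleR_sum_right)
    then show ?thesis
      using has_integral_cmul[OF u(2), of c i]
      by (simp add: block_scaleR bounded_bilinear.scaleR_right[OF bounded_bilinear_matrix_vector])
  qed
  ultimately show ?thesis unfolding reach_def by blast
qed

text \<open>An input on a shorter interval is delayed: before it starts, the zero input keeps the state at
zero.\<close>

lemma reach_mono:
  assumes "S \<le> T" "0 \<le> S"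
  shows "reach A B S \<subseteq> reach A B T"
proof
  fix \<xi> assume "\<xi> \<in> reach A B S"
  then obtain u where u: "positive_input S u" "\<And>i. ((\<lambda>t. mexp ((S - t) *\<^sub>R A) *v drive B u i t) has_integral block \<xi> i) {0..S}"
    unfolding reach_def by blast
  define d where "d = T - S"
  define v where "v = (\<lambda>t. if t \<in> {d..T} then u (t - d) else 0)"
  have Sd: "S + d = T" by (simp add: d_def)
  have sub: "{d..T} \<subseteq> {0..T}" using assms by (auto simp: d_def)
  have shift: "((\<lambda>t. if t \<in> {d..T} then f (t - d) else 0) has_integral I) {0..T}"
    if "(f has_integral I) {0..S}" for f :: "real \<Rightarrow> 'z::euclidean_space" and I
    using has_integral_shift_real_ivl[OF that, of "- d"] has_integral_restrict[OF sub, of "\<lambda>t. f (t - d)" I]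
    by (simp add: Sd)
  have "v integrable_on {0..T}" "(\<lambda>t. norm (v t)) integrable_on {0..T}"
  proof -
    have "(u has_integral integral {0..S} u) {0..S}"
      "((\<lambda>t. norm (u t)) has_integral integral {0..S} (\<lambda>t. norm (u t))) {0..S}"
      using u(1) by (auto simp: positive_input_def absolutely_integrable_on_def)
    from this[THEN shift] show "v integrable_on {0..T}" "(\<lambda>t. norm (v t)) integrable_on {0..T}"
      by (auto simp: v_def integrable_on_def if_distrib[of norm] cong: if_cong)
  qed
  then have "positive_input T v"
    using u(1) by (auto simp: positive_input_def absolutely_integrable_on_def v_def d_def)
  moreover have "((\<lambda>t. mexp ((T - t) *\<^sub>R A) *v drive B v i t) has_integral block \<xi> i) {0..T}" for i
    using shift[OF u(2), of i]
    by (rule has_integral_eq[rotated]) (auto simp: v_def drive_def d_def)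
  ultimately show "\<xi> \<in> reach A B T" unfolding reach_def by blast
qed

lemma convex_positively_reachable:
  fixes B :: "'q::finite \<Rightarrow> 'p::finite \<Rightarrow> real^'n"
  shows "convex (positively_reachable A B)"
proof (rule convexI)
  fix \<xi> \<zeta> :: "real^('q \<times> 'n)" and a b :: real
  assume "\<xi> \<in> positively_reachable A B" "\<zeta> \<in> positively_reachable A B" and ab: "0 \<le> a" "0 \<le> b"
  then obtain S T where "0 \<le> S" "\<xi> \<in> reach A B S" "0 \<le> T" "\<zeta> \<in> reach A B T"
    by (auto simp: positively_reachable_eq)
  then have "\<xi> \<in> reach A B (max S T)" "\<zeta> \<in> reach A B (max S T)"
    using reach_mono[of S "max S T" A B] reach_mono[of T "max S T" A B] by auto
  then have "a *\<^sub>R \<xi> + b *\<^sub>R \<zeta> \<in> reach A B (max S T)"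
    using ab by (intro reach_add reach_scaleR)
  then show "a *\<^sub>R \<xi> + b *\<^sub>R \<zeta> \<in> positively_reachable A B"
    using \<open>0 \<le> S\<close> by (auto simp: positively_reachable_eq intro!: bexI[of _ "max S T"])
qed

text \<open>The stacked vector \<open>(e\<^sub>k - e\<^sub>l) \<otimes> v\<close>.\<close>

definition diff_vec :: "'q::finite \<Rightarrow> 'q \<Rightarrow> real^'n \<Rightarrow> real^('q \<times> 'n)" where
  "diff_vec k l v = (\<chi> x. ((if fst x = k then 1 else 0) - (if fst x = l then 1 else 0)) * v $ snd x)"

lemma block_diff_vec:
  "block (diff_vec k l v) i = ((if i = k then 1 else 0) - (if i = l then 1 else 0)) *\<^sub>R v"
  by (simp add: block_def diff_vec_def vec_eq_iff)

lemma difference_range_eq: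
  "(difference_range k l :: (real^('q::finite \<times> 'n::finite)) set) = range (diff_vec k l)"
proof -
  let ?K = "kron (columnvector (axis k 1 - axis l 1) :: real^1^'q) (mat 1 :: real^'n^'n)"
  have eq: "?K *v y = diff_vec k l (\<chi> a. y $ (1, a))" for y :: "real^(1 \<times> 'n)"
  proof -
    have "(?K *v y) $ (i, a) = ((if i = k then 1 else 0) - (if i = l then 1 else 0)) * y $ (1, a)" for i a
    proof -
      have "(?K *v y) $ (i, a) = (\<Sum>(j, b)\<in>UNIV \<times> UNIV.
          ((if i = k then 1 else 0) - (if i = l then 1 else 0)) * (if a = b then y $ (j, b) else 0))"
        unfolding matrix_vector_mult_def UNIV_Times_UNIV
        by (auto simp: kron_def mat_def columnvector_def axis_def intro!: sum.cong)
      also have "\<dots> = (\<Sum>j\<in>UNIV. \<Sum>b\<in>UNIV.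
          ((if i = k then 1 else 0) - (if i = l then 1 else 0)) * (if a = b then y $ (j, b) else 0))"
        by (rule sum.cartesian_product[symmetric])
      also have "\<dots> = ((if i = k then 1 else 0) - (if i = l then 1 else 0)) * y $ (1, a)"
        by (simp add: sum_distrib_left[symmetric] UNIV_1)
      finally show ?thesis .
    qed
    then show ?thesis by (simp add: vec_eq_iff diff_vec_def)
  qed
  have "diff_vec k l v \<in> range ((*v) ?K)" for v :: "real^'n"
  proof -
    have "diff_vec k l v = ?K *v (\<chi> x. v $ snd x)" by (simp add: eq)
    then show ?thesis by blast
  qed
  then show ?thesis unfolding difference_range_def by (auto simp: eq)
qed

definition dual_cone :: "real^'n^'n \<Rightarrow> ('q::finite \<Rightarrow> 'p \<Rightarrow> real^'n) \<Rightarrow> ('q \<Rightarrow> real^'n) set" where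
  "dual_cone A B = {\<eta>. \<forall>\<sigma>. \<forall>t\<ge>0. 0 \<le> (\<Sum>i\<in>UNIV. \<eta> i \<bullet> (mexp (t *\<^sub>R A) *v B i \<sigma>))}"

lemma reach_pairing:
  fixes \<eta> :: "'q::finite \<Rightarrow> real^'n" and B :: "'q \<Rightarrow> 'p::finite \<Rightarrow> real^'n"
  assumes "\<And>i. ((\<lambda>t. mexp ((T - t) *\<^sub>R A) *v drive B u i t) has_integral \<xi> i) {0..T}"
  shows "((\<lambda>t. \<Sum>\<sigma>\<in>UNIV. u t $ \<sigma> * (\<Sum>i\<in>UNIV. \<eta> i \<bullet> (mexp ((T - t) *\<^sub>R A) *v B i \<sigma>)))
    has_integral (\<Sum>i\<in>UNIV. \<eta> i \<bullet> \<xi> i)) {0..T}"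
proof -
  have "((\<lambda>t. \<Sum>i\<in>UNIV. \<eta> i \<bullet> (mexp ((T - t) *\<^sub>R A) *v drive B u i t)) has_integral (\<Sum>i\<in>UNIV. \<eta> i \<bullet> \<xi> i)) {0..T}"
    using has_integral_linear[OF assms bounded_linear_inner_right]
    by (intro has_integral_sum) (auto simp: o_def)
  moreover have "(\<Sum>i\<in>UNIV. \<eta> i \<bullet> (mexp ((T - t) *\<^sub>R A) *v drive B u i t)) =
      (\<Sum>\<sigma>\<in>UNIV. u t $ \<sigma> * (\<Sum>i\<in>UNIV. \<eta> i \<bullet> (mexp ((T - t) *\<^sub>R A) *v B i \<sigma>)))" for t
  proof -
    have "mexp ((T - t) *\<^sub>R A) *v drive B u i t = (\<Sum>\<sigma>\<in>UNIV. u t $ \<sigma> *\<^sub>R (mexp ((T - t) *\<^sub>R A) *v B i \<sigma>))" for i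
      unfolding drive_def
      by (simp add: bounded_bilinear.sum_right[OF bounded_bilinear_matrix_vector]
          bounded_bilinear.scaleR_right[OF bounded_bilinear_matrix_vector])
    then have "(\<Sum>i\<in>UNIV. \<eta> i \<bullet> (mexp ((T - t) *\<^sub>R A) *v drive B u i t)) =
        (\<Sum>i\<in>UNIV. \<Sum>\<sigma>\<in>UNIV. u t $ \<sigma> * (\<eta> i \<bullet> (mexp ((T - t) *\<^sub>R A) *v B i \<sigma>)))"
      by (simp add: inner_sum_right)
    also have "\<dots> = (\<Sum>\<sigma>\<in>UNIV. u t $ \<sigma> * (\<Sum>i\<in>UNIV. \<eta> i \<bullet> (mexp ((T - t) *\<^sub>R A) *v B i \<sigma>)))"
      by (subst sum.swap) (simp add: sum_distrib_left)
    finally show ?thesis .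
  qed
  ultimately show ?thesis by simp
qed

lemma dual_cone_reach_nonneg:
  assumes "\<eta> \<in> dual_cone A B" "positive_input T u"
    and "\<And>i. ((\<lambda>t. mexp ((T - t) *\<^sub>R A) *v drive B u i t) has_integral \<xi> i) {0..T}"
  shows "0 \<le> (\<Sum>i\<in>UNIV. \<eta> i \<bullet> \<xi> i)"
  using reach_pairing[OF assms(3), of \<eta>]
proof (rule has_integral_nonneg)
  show "0 \<le> (\<Sum>\<sigma>\<in>UNIV. u t $ \<sigma> * (\<Sum>i\<in>UNIV. \<eta> i \<bullet> (mexp ((T - t) *\<^sub>R A) *v B i \<sigma>)))" if "t \<in> {0..T}" for t
  proof (rule sum_nonneg)
    fix \<sigma>
    have "0 \<le> u t $ \<sigma>" using assms(2) that by (auto simp: positive_input_def)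
    moreover have "0 \<le> (\<Sum>i\<in>UNIV. \<eta> i \<bullet> (mexp ((T - t) *\<^sub>R A) *v B i \<sigma>))"
      using assms(1) that by (simp add: dual_cone_def)
    ultimately show "0 \<le> u t $ \<sigma> * (\<Sum>i\<in>UNIV. \<eta> i \<bullet> (mexp ((T - t) *\<^sub>R A) *v B i \<sigma>))"
      by (rule mult_nonneg_nonneg)
  qed
qed

lemma inner_transpose: "(transpose M *v y) \<bullet> v = y \<bullet> (M *v v)" for M :: "real^'n^'m"
  by (simp add: dot_lmul_matrix)

lemma dual_cone_flow:
  assumes "\<eta> \<in> dual_cone A B" "0 \<le> s"
  shows "(\<lambda>i. transpose (mexp (s *\<^sub>R A)) *v \<eta> i) \<in> dual_cone A B"
  using assms
  by (simp add: dual_cone_def inner_transpose mexp_add[symmetric] del: transpose_matrix_vector)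

text \<open>Starting from \<open>x\<^sub>l = z\<close> and all other states zero, relative actuation forces the input to add
\<open>e\<^sup>T\<^sup>A z / 2\<close> to \<open>x\<^sub>k\<close> and to subtract it from \<open>x\<^sub>l\<close>. Pairing with the dual cone gives
\<open>(\<eta>\<^sub>k - \<eta>\<^sub>l) \<bullet> e\<^sup>T\<^sup>A z \<ge> 0\<close> with a time \<open>T\<close> that depends on \<open>z\<close>. As the dual cone is invariant under the
adjoint flow, one time serves for all \<open>z = \<plusminus>b\<close> with basis vectors \<open>b\<close>, and then
\<open>\<eta>\<^sub>k - \<eta>\<^sub>l\<close> is orthogonal to the range of an invertible matrix.\<close>

lemma controllable_imp_dual:
  fixes A :: "real^'n^'n" and B :: "'q::finite \<Rightarrow> 'p::finite \<Rightarrow> real^'n"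
  assumes ctrl: "positively_controllable A B k l" and rel: "relative_actuation B" and "k \<noteq> l"
    and \<eta>: "\<eta> \<in> dual_cone A B"
  shows "\<eta> k = \<eta> l"
proof -
  have one: "\<exists>T>0. \<forall>\<zeta>\<in>dual_cone A B. 0 \<le> (\<zeta> k - \<zeta> l) \<bullet> (mexp (T *\<^sub>R A) *v z)" for z
  proof -
    define x0 where "x0 = (\<lambda>i. if i = l then z else 0)"
    obtain T u x where T: "0 < T" and u: "positive_input T u" and x: "array_solution A B T u x"
      and init: "\<And>i. x i 0 = x0 i" and meet: "x k T = x l T"
      and rest: "\<And>i. i \<noteq> k \<Longrightarrow> i \<noteq> l \<Longrightarrow> x i T = mexp (T *\<^sub>R A) *v x0 i"
      using ctrl unfolding positively_controllable_def by metis
    define \<xi> where "\<xi> = (\<lambda>i. x i T - mexp (T *\<^sub>R A) *v x0 i)"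
    have \<xi>: "((\<lambda>s. mexp ((T - s) *\<^sub>R A) *v drive B u i s) has_integral \<xi> i) {0..T}" for i
      using array_solution_final_state[OF x u] T by (simp add: \<xi>_def init less_imp_le)
    have zero: "\<xi> i = 0" if "i \<noteq> k" "i \<noteq> l" for i using rest[OF that] by (simp add: \<xi>_def)
    have split: "(\<Sum>i\<in>UNIV. f i) = f k + f l" if "\<And>i. i \<noteq> k \<Longrightarrow> i \<noteq> l \<Longrightarrow> f i = 0"
      for f :: "'q \<Rightarrow> 'z::ab_group_add"
    proof -
      have "(\<Sum>i\<in>UNIV. f i) = (\<Sum>i\<in>{k, l}. f i)"
        using that by (intro sum.mono_neutral_right) auto
      then show ?thesis using \<open>k \<noteq> l\<close> by simp
    qed
    \<comment> \<open>Relative actuation leaves the sum of all states to the free motion.\<close>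
    have "((\<lambda>s. \<Sum>i\<in>UNIV. mexp ((T - s) *\<^sub>R A) *v drive B u i s) has_integral (\<Sum>i\<in>UNIV. \<xi> i)) {0..T}"
      by (intro has_integral_sum \<xi>) auto
    moreover have "(\<Sum>i\<in>UNIV. mexp ((T - s) *\<^sub>R A) *v drive B u i s) = 0" for s
    proof -
      have "(\<Sum>i\<in>UNIV. drive B u i s) = (\<Sum>\<sigma>\<in>UNIV. u s $ \<sigma> *\<^sub>R (\<Sum>i\<in>UNIV. B i \<sigma>))"
        unfolding drive_def by (subst sum.swap) (simp add: scaleR_sum_right)
      also have "\<dots> = 0" using rel by (simp add: relative_actuation_def)
      finally show ?thesis
        by (simp add: bounded_bilinear.sum_right[OF bounded_bilinear_matrix_vector, symmetric])
    qed
    ultimately have "(\<Sum>i\<in>UNIV. \<xi> i) = 0" by (simp add: has_integral_unique[OF _ has_integral_0])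
    then have opp: "\<xi> k + \<xi> l = 0" using split[of \<xi>] zero by simp
    have diff: "\<xi> k - \<xi> l = mexp (T *\<^sub>R A) *v z"
      using meet \<open>k \<noteq> l\<close> by (simp add: \<xi>_def x0_def)
    have half: "\<xi> k = (1 / 2) *\<^sub>R (mexp (T *\<^sub>R A) *v z)"
    proof -
      have "\<xi> k = (1 / 2) *\<^sub>R ((\<xi> k + \<xi> l) + (\<xi> k - \<xi> l))" by (simp flip: scaleR_2)
      then show ?thesis using opp diff by simp
    qed
    have "\<xi> l = - \<xi> k" using opp by (metis add.commute add_eq_0_iff)
    have "0 \<le> (\<zeta> k - \<zeta> l) \<bullet> (mexp (T *\<^sub>R A) *v z)" if \<zeta>: "\<zeta> \<in> dual_cone A B" for \<zeta>
    proof -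
      have "0 \<le> (\<Sum>i\<in>UNIV. \<zeta> i \<bullet> \<xi> i)" by (rule dual_cone_reach_nonneg[OF \<zeta> u \<xi>])
      also have "\<dots> = \<zeta> k \<bullet> \<xi> k + \<zeta> l \<bullet> \<xi> l" by (rule split) (simp add: zero)
      also have "\<dots> = (\<zeta> k - \<zeta> l) \<bullet> \<xi> k" by (simp add: \<open>\<xi> l = - \<xi> k\<close> inner_diff_left)
      finally show ?thesis by (simp add: half)
    qed
    with T show ?thesis by blast
  qed
  then obtain \<tau> where \<tau>: "\<And>z. 0 < \<tau> z"
    "\<And>z \<zeta>. \<zeta> \<in> dual_cone A B \<Longrightarrow> 0 \<le> (\<zeta> k - \<zeta> l) \<bullet> (mexp (\<tau> z *\<^sub>R A) *v z)"
    by metis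
  \<comment> \<open>The dual cone is invariant under the adjoint flow, so the time may be increased.\<close>
  have later: "0 \<le> (\<eta> k - \<eta> l) \<bullet> (mexp (T *\<^sub>R A) *v z)" if "\<tau> z \<le> T" for z T
  proof -
    define s where "s = T - \<tau> z"
    have "0 \<le> (transpose (mexp (s *\<^sub>R A)) *v \<eta> k - transpose (mexp (s *\<^sub>R A)) *v \<eta> l) \<bullet> (mexp (\<tau> z *\<^sub>R A) *v z)"
      using \<tau>(2)[OF dual_cone_flow[OF \<eta>, of s], of z] that by (simp add: s_def)
    also have "\<dots> = (\<eta> k - \<eta> l) \<bullet> (mexp (s *\<^sub>R A) *v (mexp (\<tau> z *\<^sub>R A) *v z))"
      by (simp add: inner_diff_left inner_transpose del: transpose_matrix_vector)
    also have "\<dots> = (\<eta> k - \<eta> l) \<bullet> (mexp (T *\<^sub>R A) *v z)"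
      by (simp add: mexp_add[symmetric] s_def)
    finally show ?thesis .
  qed
  define S where "S = (Basis :: (real^'n) set) \<union> uminus ` Basis"
  define T where "T = Max (\<tau> ` S)"
  have S: "\<tau> z \<le> T" if "z \<in> S" for z using that by (auto simp: T_def S_def)
  have basis: "(\<eta> k - \<eta> l) \<bullet> (mexp (T *\<^sub>R A) *v b) = 0" if b: "b \<in> Basis" for b
  proof -
    have "0 \<le> (\<eta> k - \<eta> l) \<bullet> (mexp (T *\<^sub>R A) *v b)" "0 \<le> (\<eta> k - \<eta> l) \<bullet> (mexp (T *\<^sub>R A) *v (- b))"
      using b by (auto intro!: later S simp: S_def)
    then show ?thesis by (simp add: bounded_bilinear.minus_right[OF bounded_bilinear_matrix_vector])
  qed
  have all: "(\<eta> k - \<eta> l) \<bullet> (mexp (T *\<^sub>R A) *v v) = 0" for v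
  proof -
    have "(\<eta> k - \<eta> l) \<bullet> (mexp (T *\<^sub>R A) *v (\<Sum>b\<in>Basis. (v \<bullet> b) *\<^sub>R b)) = 0"
      by (simp add: bounded_bilinear.sum_right[OF bounded_bilinear_matrix_vector] inner_sum_right
          bounded_bilinear.scaleR_right[OF bounded_bilinear_matrix_vector] basis)
    then show ?thesis by (simp add: euclidean_representation)
  qed
  have "(\<eta> k - \<eta> l) \<bullet> (\<eta> k - \<eta> l) = 0"
    using all[of "mexp (- T *\<^sub>R A) *v (\<eta> k - \<eta> l)"] mexp_add[of T "- T" A "\<eta> k - \<eta> l"] by simp
  then show ?thesis by simp
qed

text \<open>If the response to the input \<open>\<sigma>\<close> were negative at time \<open>t0\<close>, an input in direction \<open>\<sigma>\<close> that acts
only about \<open>t0\<close> before the final time would reach a state with a negative value.\<close>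

lemma reachable_dual_imp_dual_cone:
  fixes A :: "real^'n^'n" and B :: "'q::finite \<Rightarrow> 'p::finite \<Rightarrow> real^'n"
  assumes nonneg: "\<And>\<xi>. \<xi> \<in> positively_reachable A B \<Longrightarrow> 0 \<le> a \<bullet> \<xi>"
  shows "block a \<in> dual_cone A B"
  unfolding dual_cone_def
proof (intro CollectI allI impI)
  fix \<sigma> and t0 :: real assume t0: "0 \<le> t0"
  define f where "f = (\<lambda>t. \<Sum>i\<in>UNIV. block a i \<bullet> (mexp (t *\<^sub>R A) *v B i \<sigma>))"
  have cont: "continuous_on UNIV f"
    unfolding f_def
    by (intro continuous_intros bounded_bilinear.continuous_on[OF bounded_bilinear_matrix_vector] continuous_on_mexp)
  have "0 \<le> f t0"
  proof (rule ccontr)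
    assume "\<not> 0 \<le> f t0"
    define m where "m = f t0 / 2"
    have m: "m < 0" "f t0 < m" using \<open>\<not> 0 \<le> f t0\<close> by (auto simp: m_def)
    have "\<exists>\<delta>>0. \<forall>t. \<bar>t - t0\<bar> < \<delta> \<longrightarrow> f t < m"
    proof -
      have "isCont f t0" using cont by (simp add: continuous_on_eq_continuous_at)
      then have "\<forall>\<^sub>F t in at t0. f t < m" using m(2) by (intro order_tendstoD(2)[of f "f t0"]) (auto simp: isCont_def)
      then show ?thesis using m(2) unfolding eventually_at dist_real_def by (metis UNIV_I)
    qed
    then obtain \<delta> where \<delta>: "0 < \<delta>" "\<And>t. \<bar>t - t0\<bar> < \<delta> \<Longrightarrow> f t < m" by blast
    define e where "e = \<delta> / 2"
    define T where "T = t0 + e"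
    \<comment> \<open>A constant input on a short initial interval makes the reached state see only the values
      of \<open>f\<close> near \<open>t0\<close>.\<close>
    define u :: "real \<Rightarrow> real^'p" where "u = (\<lambda>t. if t \<in> {0..e} then axis \<sigma> 1 else 0)"
    have e: "0 < e" "{0..e} \<subseteq> {0..T}" "0 \<le> T" using \<delta>(1) t0 by (auto simp: e_def T_def)
    have ri: "((\<lambda>t. if t \<in> {0..e} then g t else 0) has_integral integral {0..e} g) {0..T}"
      if "g integrable_on {0..e}" for g :: "real \<Rightarrow> 'z::euclidean_space"
      unfolding has_integral_restrict[OF e(2)] by (rule integrable_integral[OF that])
    have "positive_input T u"
    proof -
      have "u integrable_on {0..T}"
        using ri[of "\<lambda>t. axis \<sigma> 1 :: real^'p"] by (auto simp: u_def)
      moreover have "(\<lambda>t. norm (u t)) integrable_on {0..T}"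
      proof -
        have "(\<lambda>t. norm (u t)) = (\<lambda>t. if t \<in> {0..e} then 1 else 0)"
          by (auto simp: u_def)
        then show ?thesis using ri[of "\<lambda>t. 1 :: real"] by auto
      qed
      ultimately show ?thesis
        by (auto simp: positive_input_def absolutely_integrable_on_def u_def axis_def)
    qed
    define J where "J = (\<lambda>i. integral {0..e} (\<lambda>t. mexp ((T - t) *\<^sub>R A) *v B i \<sigma>))"
    define \<xi> :: "real^('q \<times> 'n)" where "\<xi> = (\<chi> x. J (fst x) $ snd x)"
    have b\<xi>: "block \<xi> i = J i" for i by (simp add: block_def \<xi>_def)
    have drive_u: "drive B u i t = (if t \<in> {0..e} then B i \<sigma> else 0)" for i t
      by (simp add: drive_def u_def axis_def if_distrib[of "\<lambda>c. c *\<^sub>R _"] cong: if_cong)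
    have int: "((\<lambda>t. mexp ((T - t) *\<^sub>R A) *v drive B u i t) has_integral block \<xi> i) {0..T}" for i
    proof -
      have "(\<lambda>t. mexp ((T - t) *\<^sub>R A) *v B i \<sigma>) integrable_on {0..e}"
        by (intro integrable_continuous_interval bounded_bilinear.continuous_on[OF bounded_bilinear_matrix_vector]
            continuous_intros continuous_on_compose2[OF continuous_on_mexp[of UNIV A]]) auto
      from ri[OF this] show ?thesis
        unfolding b\<xi> J_def by (rule has_integral_eq[rotated]) (auto simp: drive_u)
    qed
    then have "\<xi> \<in> positively_reachable A B"
      using \<open>positive_input T u\<close> e(3) by (auto simp: positively_reachable_eq reach_def)
    then have "0 \<le> a \<bullet> \<xi>" by (rule nonneg)
    have "((\<lambda>t. if t \<in> {0..e} then f (T - t) else 0) has_integral (a \<bullet> \<xi>)) {0..T}"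
      using reach_pairing[OF int, of "block a"] unfolding inner_block
      by (rule has_integral_eq[rotated])
         (auto simp: u_def f_def axis_def if_distrib[of "\<lambda>c. c * _"] cong: if_cong)
    then have "((\<lambda>t. f (T - t)) has_integral (a \<bullet> \<xi>)) {0..e}"
      unfolding has_integral_restrict[OF e(2)] .
    moreover have "((\<lambda>t. m) has_integral (e *\<^sub>R m)) {0..e}"
      using has_integral_const_real[of m 0 e] e(1) by simp
    ultimately have "a \<bullet> \<xi> \<le> e *\<^sub>R m"
      by (rule has_integral_le) (use \<delta> in \<open>auto intro!: less_imp_le[OF \<delta>(2)] simp: T_def e_def\<close>)
    also have "\<dots> < 0" using e(1) m(1) by (simp add: mult_pos_neg)
    finally show False using \<open>0 \<le> a \<bullet> \<xi>\<close> by simp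
  qed
  then show "0 \<le> (\<Sum>i\<in>UNIV. block a i \<bullet> (mexp (t0 *\<^sub>R A) *v B i \<sigma>))" by (simp add: f_def)
qed

lemma dual_imp_difference_range_in_closure:
  fixes A :: "real^'n^'n" and B :: "'q::finite \<Rightarrow> 'p::finite \<Rightarrow> real^'n"
  assumes "k \<noteq> l" and dual: "\<And>\<eta>. \<eta> \<in> dual_cone A B \<Longrightarrow> \<eta> k = \<eta> l"
  shows "difference_range k l \<subseteq> closure (positively_reachable A B)"
proof
  fix \<xi> :: "real^('q \<times> 'n)" assume "\<xi> \<in> difference_range k l"
  then obtain v where v: "\<xi> = diff_vec k l v" by (auto simp: difference_range_eq)
  let ?R = "positively_reachable A B"
  show "\<xi> \<in> closure ?R"
  proof (rule ccontr)
    assume "\<xi> \<notin> closure ?R"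
    then obtain a b where ab: "a \<bullet> \<xi> < b" "\<And>x. x \<in> closure ?R \<Longrightarrow> b < a \<bullet> x"
      using separating_hyperplane_closed_point[of "closure ?R" \<xi>] convex_positively_reachable[of A B]
      by (auto simp: convex_closure)
    have R: "b < a \<bullet> x" if "x \<in> ?R" for x using that ab(2) closure_subset by blast
    have "0 \<in> ?R" using reach_zero[of A B 0] by (auto simp: positively_reachable_eq)
    then have "b < 0" using R[of 0] by simp
    have nonneg: "0 \<le> a \<bullet> x" if x: "x \<in> ?R" for x
    proof (rule ccontr)
      assume "\<not> 0 \<le> a \<bullet> x"
      then have neg: "a \<bullet> x < 0" by simp
      obtain T where "0 \<le> T" "x \<in> reach A B T" using x by (auto simp: positively_reachable_eq)
      then have "(b / (a \<bullet> x)) *\<^sub>R x \<in> ?R"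
        using reach_scaleR[of x A B T "b / (a \<bullet> x)"] neg \<open>b < 0\<close>
        by (auto simp: positively_reachable_eq divide_nonpos_neg intro!: bexI[of _ T])
      from R[OF this] neg show False by simp
    qed
    have "block a k = block a l"
      by (rule dual) (rule reachable_dual_imp_dual_cone[OF nonneg])
    moreover have "a \<bullet> \<xi> = (block a k - block a l) \<bullet> v"
      unfolding v inner_block block_diff_vec
      by (simp add: left_diff_distrib sum_subtractf if_distrib[of "\<lambda>c. c * _"] inner_diff_left cong: if_cong)
    ultimately have "a \<bullet> \<xi> = 0" by simp
    with ab(1) \<open>b < 0\<close> show False by simp
  qed
qed

text \<open>The reachable sets grow with time and are cones. Hence one final time \<open>T\<close> suffices for \<open>\<plusminus>b\<close> for
all basis vectors \<open>b\<close>, and therefore for all differences.\<close>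

lemma difference_range_reachable_imp_controllable:
  fixes A :: "real^'n^'n" and B :: "'q::finite \<Rightarrow> 'p::finite \<Rightarrow> real^'n"
  assumes "k \<noteq> l" and D: "difference_range k l \<subseteq> positively_reachable A B"
  shows "positively_controllable A B k l"
proof -
  have "\<exists>T\<ge>0. diff_vec k l v \<in> reach A B T" for v :: "real^'n"
    using D by (auto simp: difference_range_eq positively_reachable_eq)
  then obtain \<tau> where \<tau>: "\<And>v :: real^'n. 0 \<le> \<tau> v" "\<And>v. diff_vec k l v \<in> reach A B (\<tau> v)"
    by metis
  define S where "S = (Basis :: (real^'n) set) \<union> uminus ` Basis"
  \<comment> \<open>The summand \<open>1\<close> makes the final time positive.\<close>
  define T where "T = Max (\<tau> ` S) + 1"
  have TS: "\<tau> z \<le> T" if "z \<in> S" for z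
  proof -
    have "\<tau> z \<le> Max (\<tau> ` S)" using that by (intro Max_ge) (auto simp: S_def)
    then show ?thesis by (simp add: T_def)
  qed
  have S: "diff_vec k l z \<in> reach A B T" if "z \<in> S" for z
    using \<tau>(2)[of z] reach_mono[OF TS[OF that] \<tau>(1), of A B] by blast
  have T: "0 < T"
  proof -
    obtain b :: "real^'n" where "b \<in> Basis" using nonempty_Basis by blast
    then have "\<tau> b \<le> Max (\<tau> ` S)" by (intro Max_ge) (auto simp: S_def)
    then show ?thesis using \<tau>(1)[of b] by (simp add: T_def)
  qed
  have dv_scale: "diff_vec k l (c *\<^sub>R v) = c *\<^sub>R diff_vec k l v" for c and v :: "real^'n"
    by (simp add: diff_vec_def vec_eq_iff)
  have dv_add: "diff_vec k l (v + w) = diff_vec k l v + diff_vec k l w" for v w :: "real^'n"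
    by (simp add: diff_vec_def vec_eq_iff algebra_simps)
  have dv_zero: "diff_vec k l (0 :: real^'n) = 0" by (simp add: diff_vec_def vec_eq_iff)
  have part: "diff_vec k l ((v \<bullet> b) *\<^sub>R b) \<in> reach A B T" if "b \<in> Basis" for v b :: "real^'n"
  proof (cases "0 \<le> v \<bullet> b")
    case True
    then show ?thesis using that by (auto simp: dv_scale S_def intro!: reach_scaleR S)
  next
    case False
    have "(v \<bullet> b) *\<^sub>R b = (- (v \<bullet> b)) *\<^sub>R (- b)" by simp
    moreover have "(- (v \<bullet> b)) *\<^sub>R diff_vec k l (- b) \<in> reach A B T"
      using that False by (intro reach_scaleR S) (auto simp: S_def)
    ultimately show ?thesis by (simp only: dv_scale)
  qed
  have all: "diff_vec k l v \<in> reach A B T" for v :: "real^'n"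
  proof -
    have "diff_vec k l (\<Sum>b\<in>F. (v \<bullet> b) *\<^sub>R b) \<in> reach A B T" if "finite F" "F \<subseteq> Basis" for F
      using that by induction (auto simp: dv_zero dv_add intro!: reach_add part reach_zero)
    from this[of Basis] show ?thesis by (simp add: euclidean_representation)
  qed
  show ?thesis
    unfolding positively_controllable_def
  proof (intro allI)
    fix x0 :: "'q \<Rightarrow> real^'n"
    \<comment> \<open>Half of the final distance is removed on each side.\<close>
    define z where "z = - (1 / 2) *\<^sub>R (mexp (T *\<^sub>R A) *v (x0 k - x0 l))"
    obtain u where u: "positive_input T u"
      and int: "\<And>i. ((\<lambda>t. mexp ((T - t) *\<^sub>R A) *v drive B u i t) has_integral block (diff_vec k l z) i) {0..T}"
      using all[of z] unfolding reach_def by blast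
    obtain x where x: "array_solution A B T u x" "\<And>i. x i 0 = x0 i"
      using array_solution_exists[OF u, of A B x0] by blast
    have final: "x i T = mexp (T *\<^sub>R A) *v x0 i + block (diff_vec k l z) i" for i
      using has_integral_unique[OF int array_solution_final_state[OF x(1) u]] T
      by (simp add: x(2) algebra_simps)
    have "x k T = x l T"
      using \<open>k \<noteq> l\<close>
      by (simp add: final block_diff_vec z_def matrix_vector_mult_diff_distrib algebra_simps flip: scaleR_add_left)
    moreover have "\<forall>i. i \<noteq> k \<and> i \<noteq> l \<longrightarrow> x i T = mexp (T *\<^sub>R A) *v x0 i"
      by (simp add: final block_diff_vec)
    ultimately show "\<exists>\<tau>>0. \<exists>u x. positive_input \<tau> u \<and> array_solution A B \<tau> u x \<and> (\<forall>i. x i 0 = x0 i) \<and>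
        x k \<tau> = x l \<tau> \<and> (\<forall>i. i \<noteq> k \<and> i \<noteq> l \<longrightarrow> x i \<tau> = mexp (\<tau> *\<^sub>R A) *v x0 i)"
      using T u x by blast
  qed
qed

theorem positively_controllable_iff_dual:
  fixes A :: "real^'n^'n" and B :: "'q::finite \<Rightarrow> 'p::finite \<Rightarrow> real^'n"
  assumes "relative_actuation B" "k \<noteq> l"
    and "difference_range k l \<subseteq> closure (positively_reachable A B) \<longrightarrow>
      difference_range k l \<subseteq> positively_reachable A B"
  shows "positively_controllable A B k l \<longleftrightarrow> (\<forall>\<eta>\<in>dual_cone A B. \<eta> k = \<eta> l)"
  using controllable_imp_dual[OF _ assms(1,2)] difference_range_reachable_imp_controllable[OF assms(2)]
    dual_imp_difference_range_in_closure[OF assms(2)] assms(3) by blast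

section \<open>Generalized eigenspaces\<close>

text \<open>The operator \<open>M - z\<close>, kept as a function so that its powers are iterates.\<close>

definition eig_shift :: "'a::field^'n^'n \<Rightarrow> 'a \<Rightarrow> 'a^'n \<Rightarrow> 'a^'n" where
  "eig_shift M z v = M *v v - z *s v"

lemma eig_shift_matrix: "(M - mat z) *v v = eig_shift M z v"
proof -
  have "mat z *v v = z *s v"
    by (simp add: vec_eq_iff matrix_vector_mult_def mat_def if_distrib[of "\<lambda>c. c * _"] cong: if_cong)
  then show ?thesis by (simp add: eig_shift_def matrix_vector_mult_diff_rdistrib)
qed

lemma matpow_eig_shift: "matpow (M - mat z) r *v v = (eig_shift M z ^^ r) v"
  by (induction r) (simp_all add: matrix_vector_mul_assoc[symmetric] eig_shift_matrix)

lemma eig_shift_pow_add: "(eig_shift M z ^^ r) (v + w) = (eig_shift M z ^^ r) v + (eig_shift M z ^^ r) w"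
  by (induction r) (simp_all add: eig_shift_def matrix_vector_right_distrib vector_add_ldistrib)

lemma eig_shift_pow_scale: "(eig_shift M z ^^ r) (c *s v) = c *s (eig_shift M z ^^ r) v"
  by (induction r)
     (simp_all add: eig_shift_def vec.scale vector_sub_rdistrib vector_ssub_ldistrib vector_smult_assoc mult.commute)

lemma eig_shift_pow_zero [simp]: "(eig_shift M z ^^ r) 0 = 0"
  using eig_shift_pow_scale[of r M z 0 0] by simp

lemma eig_shift_pow_diff: "(eig_shift M z ^^ r) (v - w) = (eig_shift M z ^^ r) v - (eig_shift M z ^^ r) w"
  using eig_shift_pow_add[of r M z v "- w"] eig_shift_pow_scale[of r M z "- 1" w] by simp

lemma eig_shift_pow_sum: "(eig_shift M z ^^ r) (\<Sum>i\<in>S. f i) = (\<Sum>i\<in>S. (eig_shift M z ^^ r) (f i))"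
  by (induction S rule: infinite_finite_induct) (simp_all add: eig_shift_pow_add)

lemma eig_shift_commute: "eig_shift M a (eig_shift M b v) = eig_shift M b (eig_shift M a v)"
  by (simp add: eig_shift_def matrix_vector_mult_diff_distrib vec.scale vector_ssub_ldistrib
      vector_smult_assoc mult.commute algebra_simps)

lemma eig_shift_pow_commute: "(eig_shift M a ^^ r) ((eig_shift M b ^^ s) v) = (eig_shift M b ^^ s) ((eig_shift M a ^^ r) v)"
proof -
  have one: "eig_shift M a ((eig_shift M b ^^ s) v) = (eig_shift M b ^^ s) (eig_shift M a v)" for v
    by (induction s) (simp_all add: eig_shift_commute[of M a b])
  show ?thesis by (induction r) (simp_all add: one)
qed

definition gen_eigenspace :: "'a::field^'n^'n \<Rightarrow> 'a \<Rightarrow> ('a^'n) set" where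
  "gen_eigenspace M z = {v. \<exists>d. (eig_shift M z ^^ d) v = 0}"

lemma eig_shift_pow_mono:
  assumes "(eig_shift M z ^^ d) v = 0" "d \<le> e"
  shows "(eig_shift M z ^^ e) v = 0"
proof -
  have "(eig_shift M z ^^ ((e - d) + d)) v = 0"
    unfolding funpow_add using assms(1) by simp
  then show ?thesis using assms(2) by simp
qed

lemma gen_eigenspace_add:
  assumes "v \<in> gen_eigenspace M z" "w \<in> gen_eigenspace M z"
  shows "v + w \<in> gen_eigenspace M z"
proof -
  obtain d e where "(eig_shift M z ^^ d) v = 0" "(eig_shift M z ^^ e) w = 0"
    using assms by (auto simp: gen_eigenspace_def)
  then have "(eig_shift M z ^^ (max d e)) (v + w) = 0"
    using eig_shift_pow_mono[of d M z v "max d e"] eig_shift_pow_mono[of e M z w "max d e"]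
    by (simp add: eig_shift_pow_add)
  then show ?thesis by (auto simp: gen_eigenspace_def)
qed

lemma gen_eigenspace_scale: "v \<in> gen_eigenspace M z \<Longrightarrow> c *s v \<in> gen_eigenspace M z"
  by (auto simp: gen_eigenspace_def eig_shift_pow_scale)

lemma gen_eigenspace_zero: "0 \<in> gen_eigenspace M z"
  by (auto simp: gen_eigenspace_def)

lemma gen_eigenspace_shift: "v \<in> gen_eigenspace M z \<Longrightarrow> (eig_shift M a ^^ r) v \<in> gen_eigenspace M z"
  by (auto simp: gen_eigenspace_def eig_shift_pow_commute[of _ _ z r a]) (metis eig_shift_pow_zero)

text \<open>If \<open>(M - b)\<^sup>e v = 0\<close> with \<open>e\<close> minimal, then \<open>(M - b)\<^sup>e\<^sup>-\<^sup>1 v\<close> would be an eigenvector for \<open>b\<close>, on which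
\<open>M - a\<close> acts as the nonzero scalar \<open>b - a\<close>.\<close>

lemma gen_eigenspace_inter:
  assumes "a \<noteq> b" "(eig_shift M a ^^ d) v = 0" "(eig_shift M b ^^ e) v = 0"
  shows "v = 0"
  using assms(2,3)
proof (induction e arbitrary: v)
  case (Suc e)
  have "(eig_shift M a ^^ d) (eig_shift M b v) = 0"
    using eig_shift_pow_commute[of d M a 1 b v] Suc.prems(1) by (simp add: eig_shift_def)
  moreover have "(eig_shift M b ^^ e) (eig_shift M b v) = 0"
    using Suc.prems(2) by (simp add: funpow_swap1)
  ultimately have b: "eig_shift M b v = 0" by (rule Suc.IH)
  then have "eig_shift M a v = (b - a) *s v" by (simp add: eig_shift_def vector_sub_rdistrib)
  then have "(eig_shift M a ^^ r) v = (b - a) ^ r *s v" for r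
    by (induction r) (simp_all add: eig_shift_pow_scale[of 1, simplified] vector_smult_assoc mult.commute
        vector_sub_rdistrib left_diff_distrib)
  then show ?case using Suc.prems(1) \<open>a \<noteq> b\<close> by (simp add: vector_mul_eq_0)
qed simp

text \<open>A power of \<open>M - a\<close> kills the summand at \<open>a\<close> and is injective on the other generalized eigenspaces.\<close>

lemma gen_eigenspace_independent:
  assumes "finite Z" "\<And>z. z \<in> Z \<Longrightarrow> w z \<in> gen_eigenspace M z" "(\<Sum>z\<in>Z. w z) = 0"
  shows "\<forall>z\<in>Z. w z = 0"
  using assms
proof (induction Z arbitrary: w rule: finite_induct)
  case (insert a Z)
  obtain d where d: "(eig_shift M a ^^ d) (w a) = 0"
    using insert.prems(1)[of a] by (auto simp: gen_eigenspace_def)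
  have "(\<Sum>z\<in>Z. (eig_shift M a ^^ d) (w z)) = (eig_shift M a ^^ d) (\<Sum>z\<in>insert a Z. w z)"
    using insert.hyps d by (simp add: eig_shift_pow_add eig_shift_pow_sum)
  then have "(\<Sum>z\<in>Z. (eig_shift M a ^^ d) (w z)) = 0" using insert.prems(2) by simp
  then have kill: "\<forall>z\<in>Z. (eig_shift M a ^^ d) (w z) = 0"
    using insert.IH[of "\<lambda>z. (eig_shift M a ^^ d) (w z)"] insert.prems(1) gen_eigenspace_shift by blast
  have "w z = 0" if z: "z \<in> Z" for z
  proof -
    obtain e where "(eig_shift M z ^^ e) (w z) = 0"
      using insert.prems(1)[of z] z by (auto simp: gen_eigenspace_def)
    moreover have "a \<noteq> z" using insert.hyps z by auto
    ultimately show ?thesis using gen_eigenspace_inter[of a z d M "w z" e] kill z by auto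
  qed
  with insert.prems(2) insert.hyps show ?case by auto
qed simp

lemma poly_det: "poly (det M) z = det (\<chi> i j. poly (M $ i $ j) z)"
  for M :: "'a::comm_ring_1 poly^'n^'n"
  by (simp add: det_def poly_sum poly_prod)

lemma charpoly_root_iff: "poly (charpoly M) z = 0 \<longleftrightarrow> is_eigenvalue M z" for M :: "'a::field^'n^'n"
proof -
  have "poly (charpoly M) z = det (mat z - M)"
    unfolding charpoly_def poly_det
    by (rule arg_cong[of _ _ det]) (simp add: vec_eq_iff mat_def)
  also have "det (mat z - M) = 0 \<longleftrightarrow> \<not> invertible (mat z - M)" by (simp add: invertible_det_nz)
  also have "\<dots> \<longleftrightarrow> (\<exists>v. (mat z - M) *v v = 0 \<and> v \<noteq> 0)"
    using matrix_left_invertible_ker[of "mat z - M"] by (auto simp: invertible_left_inverse)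
  also have "\<dots> \<longleftrightarrow> is_eigenvalue M z"
  proof -
    have "(mat z - M) *v v = - eig_shift M z v" for v
      unfolding eig_shift_matrix[symmetric] by (metis matrix_vector_mult_diff_rdistrib minus_diff_eq)
    then show ?thesis by (simp add: is_eigenvalue_def eig_shift_def) metis
  qed
  finally show ?thesis .
qed

text \<open>Only the identity permutation contributes to the top degree: any other one meets an
off-diagonal entry, which is constant.\<close>

lemma coeff_charpoly: "coeff (charpoly M) CARD('n) = 1" for M :: "'a::idom^'n^'n"
proof -
  let ?P = "{p. p permutes (UNIV :: 'n set)}"
  let ?X = "\<lambda>i j. (if i = j then [:0, 1:] else 0) - [:M $ i $ j:]"
  have "coeff (of_int (sign p) * (\<Prod>i\<in>UNIV. ?X i (p i))) CARD('n) = (if p = id then 1 else 0)" if p: "p \<in> ?P" for p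
  proof (cases "p = id")
    case True
    have X: "?X i i = [:- (M $ i $ i), 1:]" for i by simp
    have "degree (\<Prod>i\<in>UNIV. ?X i i) = CARD('n)"
      unfolding X by (subst degree_prod_sum_eq) auto
    moreover have "lead_coeff (\<Prod>i\<in>UNIV. ?X i i) = 1"
      unfolding X by (simp only: lead_coeff_prod) simp
    ultimately show ?thesis using True by (simp add: sign_id)
  next
    case False
    then obtain i0 where i0: "p i0 \<noteq> i0" by (auto simp: fun_eq_iff)
    have "degree (of_int (sign p) * (\<Prod>i\<in>UNIV. ?X i (p i))) \<le> degree (\<Prod>i\<in>UNIV. ?X i (p i))"
      by (rule order_trans[OF degree_mult_le]) simp
    also have "\<dots> \<le> (\<Sum>i\<in>UNIV. degree (?X i (p i)))"
      using degree_prod_sum_le[of UNIV "\<lambda>i. ?X i (p i)"] by (simp add: o_def)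
    also have "\<dots> \<le> (\<Sum>i\<in>UNIV. if i = i0 then 0 else 1)"
      using i0 by (intro sum_mono) auto
    also have "\<dots> < CARD('n)"
    proof -
      have "(\<Sum>i\<in>UNIV. if i = i0 then 0 else (1::nat)) = card (UNIV - {i0})"
        by (simp add: sum.If_cases Diff_eq Compl_eq)
      also have "\<dots> < CARD('n)" by (intro psubset_card_mono) auto
      finally show ?thesis .
    qed
    finally show ?thesis using False by (simp add: coeff_eq_0)
  qed
  then have "coeff (charpoly M) CARD('n) = (\<Sum>p\<in>?P. if p = id then 1 else 0)"
    unfolding charpoly_def det_def by (simp add: coeff_sum)
  also have "\<dots> = 1" by (subst sum.delta) (auto simp: permutes_id finite_permutations)
  finally show ?thesis .
qed

lemma sum_alg_multiplicity:
  fixes M :: "complex^'n^'n" and m :: nat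
  assumes "bij_betw \<mu> {..<m} {z. is_eigenvalue M z}"
  shows "CARD('n) \<le> (\<Sum>\<kappa><m. alg_multiplicity M (\<mu> \<kappa>))"
proof -
  let ?p = "charpoly M"
  have nz: "?p \<noteq> 0" using coeff_charpoly[of M] by auto
  have "CARD('n) \<le> degree ?p" by (rule le_degree) (simp add: coeff_charpoly)
  also have "degree ?p = (\<Sum>z | poly ?p z = 0. order z ?p)"
    by (subst complex_poly_decompose[symmetric])
       (simp add: nz degree_prod_sum_eq degree_power_eq)
  also have "\<dots> = (\<Sum>\<kappa><m. order (\<mu> \<kappa>) ?p)"
    using sum.reindex_bij_betw[OF assms, of "\<lambda>z. order z ?p"] by (simp add: charpoly_root_iff)
  finally show ?thesis by (simp add: alg_multiplicity_def)
qed

lemma gen_eigenspace_matrix_independent: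
  assumes "gen_eigenspace_matrix M z d V"
  shows "inj_on V {..<d}" "vec.independent (V ` {..<d})"
proof -
  have dim: "vec.dim (V ` {..<d}) = d" using assms by (simp add: gen_eigenspace_matrix_def)
  have "d \<le> card (V ` {..<d})" using vec.dim_le_card'[of "V ` {..<d}"] dim by simp
  then have card: "card (V ` {..<d}) = card {..<d}" using card_image_le[of "{..<d}" V] by simp
  then show "inj_on V {..<d}" by (rule eq_card_imp_inj_on[rotated]) simp
  show "vec.independent (V ` {..<d})"
    by (rule vec.card_le_dim_spanning[of "V ` {..<d}" "V ` {..<d}"]) (use dim card in \<open>auto intro: vec.span_base\<close>)
qed

lemma gen_eigenspace_matrix_coeff_0:
  assumes "gen_eigenspace_matrix M z d V" "(\<Sum>j<d. c j *s V j) = 0" "j < d"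
  shows "c j = 0"
proof -
  note inj = gen_eigenspace_matrix_independent(1)[OF assms(1)]
  have "(\<Sum>v\<in>V ` {..<d}. c (inv_into {..<d} V v) *s v) = (\<Sum>j<d. c j *s V j)"
    using inj by (subst sum.reindex) (auto intro!: sum.cong)
  then have "c (inv_into {..<d} V (V j)) = 0"
    using gen_eigenspace_matrix_independent(2)[OF assms(1)] assms(2,3)
    unfolding vec.independent_explicit by auto
  then show ?thesis using inj assms(3) by simp
qed

lemma gen_eigenspace_matrix_range:
  assumes "gen_eigenspace_matrix M z d V"
  shows "(eig_shift M z ^^ d) v = 0 \<longleftrightarrow> (\<exists>c. v = (\<Sum>j<d. c j *s V j))"
proof -
  have "{(\<Sum>j<d. c j *s V j) | c. True} = {v. (eig_shift M z ^^ d) v = 0}"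
    using assms by (simp add: gen_eigenspace_matrix_def matpow_eig_shift)
  then show ?thesis by auto
qed

text \<open>The bases of the generalized eigenspaces are together linearly independent, and their number,
the sum of the algebraic multiplicities, is at least the dimension.\<close>

lemma gen_eigenspace_decomposition:
  fixes M :: "complex^'n^'n" and m :: nat
  assumes \<mu>: "bij_betw \<mu> {..<m} {z. is_eigenvalue M z}"
    and N: "\<forall>\<kappa><m. N \<kappa> = alg_multiplicity M (\<mu> \<kappa>)"
    and U: "\<forall>\<kappa><m. gen_eigenspace_matrix M (\<mu> \<kappa>) (N \<kappa>) (U \<kappa>)"
  obtains w where "\<And>\<kappa>. \<kappa> < m \<Longrightarrow> (eig_shift M (\<mu> \<kappa>) ^^ N \<kappa>) (w \<kappa>) = 0" "v = (\<Sum>\<kappa><m. w \<kappa>)"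
proof -
  \<comment> \<open>The basis vectors of all generalized eigenspaces, indexed by pairs.\<close>
  define C where "C = (SIGMA \<kappa>:{..<m}. {..<N \<kappa>})"
  define b where "b = (\<lambda>(\<kappa>, j). U \<kappa> j)"
  have sumC: "(\<Sum>c\<in>C. a c *s b c) = (\<Sum>\<kappa><m. \<Sum>j<N \<kappa>. a (\<kappa>, j) *s U \<kappa> j)" for a
    unfolding C_def b_def using sum.Sigma[of "{..<m}" "\<lambda>\<kappa>. {..<N \<kappa>}" "\<lambda>\<kappa> j. a (\<kappa>, j) *s U \<kappa> j"]
    by (simp add: case_prod_beta)
  have inE: "(eig_shift M (\<mu> \<kappa>) ^^ N \<kappa>) (\<Sum>j<N \<kappa>. a (\<kappa>, j) *s U \<kappa> j) = 0" if "\<kappa> < m" for \<kappa> a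
  proof -
    have "gen_eigenspace_matrix M (\<mu> \<kappa>) (N \<kappa>) (U \<kappa>)" using U that by simp
    from gen_eigenspace_matrix_range[OF this] show ?thesis by auto
  qed
  have zero: "a c = 0" if s: "(\<Sum>c\<in>C. a c *s b c) = 0" and c: "c \<in> C" for a c
  proof -
    define w where "w = (\<lambda>\<kappa>. \<Sum>j<N \<kappa>. a (\<kappa>, j) *s U \<kappa> j)"
    have inj: "inj_on \<mu> {..<m}" using \<mu> by (rule bij_betw_imp_inj_on)
    have "(\<Sum>z\<in>\<mu> ` {..<m}. w (inv_into {..<m} \<mu> z)) = (\<Sum>\<kappa><m. w \<kappa>)"
      using inj by (subst sum.reindex) (auto intro!: sum.cong)
    also have "\<dots> = 0" using s by (simp add: sumC w_def)
    finally have "\<forall>z\<in>\<mu> ` {..<m}. w (inv_into {..<m} \<mu> z) = 0"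
    proof (rule gen_eigenspace_independent[where M = M, rotated 2])
      fix z assume "z \<in> \<mu> ` {..<m}"
      then obtain \<kappa> where "\<kappa> < m" "z = \<mu> \<kappa>" by auto
      then show "w (inv_into {..<m} \<mu> z) \<in> gen_eigenspace M z"
        using inE[of \<kappa> a] inj unfolding w_def gen_eigenspace_def by auto
    qed simp
    then have w0: "w \<kappa> = 0" if "\<kappa> < m" for \<kappa> using that inj by auto
    obtain \<kappa> j where c': "c = (\<kappa>, j)" "\<kappa> < m" "j < N \<kappa>" using c by (auto simp: C_def)
    then show ?thesis
      using gen_eigenspace_matrix_coeff_0[of M "\<mu> \<kappa>" "N \<kappa>" "U \<kappa>" "\<lambda>j. a (\<kappa>, j)" j] U w0[of \<kappa>]
      by (simp add: w_def)
  qed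
  have finC: "finite C" by (simp add: C_def)
  have injb: "inj_on b C"
  proof (rule inj_onI, rule ccontr)
    fix x y assume xy: "x \<in> C" "y \<in> C" "b x = b y" "x \<noteq> y"
    have "(\<Sum>c\<in>C. ((if c = x then 1 else 0) - (if c = y then 1 else 0)) *s b c) = b x - b y"
      using finC xy by (simp add: vector_sub_rdistrib sum_subtractf if_distrib[of "\<lambda>c. c *s _"] cong: if_cong)
    then have "(if x = x then 1 else 0) - (if x = y then 1 else (0::complex)) = 0"
      using zero[of "\<lambda>c. (if c = x then 1 else 0) - (if c = y then 1 else 0)" x] xy by simp
    with xy(4) show False by simp
  qed
  have indep: "vec.independent (b ` C)"
    unfolding vec.independent_explicit
  proof (intro conjI allI impI ballI)
    show "finite (b ` C)" using finC by simp
    fix a v assume "(\<Sum>v\<in>b ` C. a v *s v) = 0" "v \<in> b ` C"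
    then show "a v = 0" using zero[of "\<lambda>c. a (b c)"] injb by (auto simp: sum.reindex o_def)
  qed
  have "card (b ` C) = (\<Sum>\<kappa><m. N \<kappa>)" using injb by (simp add: card_image C_def)
  then have card: "CARD('n) \<le> card (b ` C)" using sum_alg_multiplicity[OF \<mu>] N by simp
  have "v \<in> vec.span (b ` C)"
    using vec.card_ge_dim_independent[OF subset_UNIV indep, unfolded vec_dim_card] card by auto
  then obtain a where "v = (\<Sum>x\<in>b ` C. a x *s x)"
    using finC by (auto simp: vec.span_finite)
  also have "\<dots> = (\<Sum>c\<in>C. a (b c) *s b c)" using injb by (simp add: sum.reindex)
  also have "\<dots> = (\<Sum>\<kappa><m. \<Sum>j<N \<kappa>. a (b (\<kappa>, j)) *s U \<kappa> j)" by (rule sumC)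
  finally show ?thesis
    by (intro that[of "\<lambda>\<kappa>. \<Sum>j<N \<kappa>. a (b (\<kappa>, j)) *s U \<kappa> j"]) (use inE[of _ "\<lambda>c. a (b c)"] in auto)
qed

text \<open>Only finite sets \<open>Z\<close> are of interest: for an infinite \<open>Z\<close> the sum is zero by convention.\<close>

definition gen_eigenspace_sum :: "'a::field^'n^'n \<Rightarrow> 'a set \<Rightarrow> ('a^'n) set" where
  "gen_eigenspace_sum M Z = {\<Sum>z\<in>Z. w z | w. \<forall>z\<in>Z. w z \<in> gen_eigenspace M z}"

lemma gen_eigenspace_sum_add:
  assumes "v \<in> gen_eigenspace_sum M Z" "w \<in> gen_eigenspace_sum M Z"
  shows "v + w \<in> gen_eigenspace_sum M Z"
proof -
  obtain f g where "v = (\<Sum>z\<in>Z. f z)" "\<forall>z\<in>Z. f z \<in> gen_eigenspace M z"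
    "w = (\<Sum>z\<in>Z. g z)" "\<forall>z\<in>Z. g z \<in> gen_eigenspace M z"
    using assms by (auto simp: gen_eigenspace_sum_def)
  then show ?thesis unfolding gen_eigenspace_sum_def
    by (auto intro!: exI[of _ "\<lambda>z. f z + g z"] gen_eigenspace_add simp: sum.distrib)
qed

lemma gen_eigenspace_sum_scale:
  assumes "v \<in> gen_eigenspace_sum M Z"
  shows "c *s v \<in> gen_eigenspace_sum M Z"
proof -
  obtain f where "v = (\<Sum>z\<in>Z. f z)" "\<forall>z\<in>Z. f z \<in> gen_eigenspace M z"
    using assms by (auto simp: gen_eigenspace_sum_def)
  then show ?thesis unfolding gen_eigenspace_sum_def
    by (auto intro!: exI[of _ "\<lambda>z. c *s f z"] gen_eigenspace_scale simp: vec.scale_sum_right)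
qed

lemma gen_eigenspace_sum_diff:
  assumes "v \<in> gen_eigenspace_sum M Z" "w \<in> gen_eigenspace_sum M Z"
  shows "v - w \<in> gen_eigenspace_sum M Z"
  using gen_eigenspace_sum_add[OF assms(1) gen_eigenspace_sum_scale[OF assms(2), of "- 1"]] by simp

lemma gen_eigenspace_sum_zero: "0 \<in> gen_eigenspace_sum M Z"
  unfolding gen_eigenspace_sum_def by (auto intro!: exI[of _ "\<lambda>_. 0"] gen_eigenspace_zero)

lemma gen_eigenspace_sum_member:
  assumes "finite Z" "a \<in> Z" "v \<in> gen_eigenspace M a"
  shows "v \<in> gen_eigenspace_sum M Z"
proof -
  have "v = (\<Sum>z\<in>Z. if z = a then v else 0)" using assms by simp
  then show ?thesis unfolding gen_eigenspace_sum_def using assms(3) gen_eigenspace_zero by fastforce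
qed

lemma gen_eigenspace_sum_mono:
  assumes "finite Z'" "Z \<subseteq> Z'"
  shows "gen_eigenspace_sum M Z \<subseteq> gen_eigenspace_sum M Z'"
proof
  fix v assume "v \<in> gen_eigenspace_sum M Z"
  then obtain f where f: "v = (\<Sum>z\<in>Z. f z)" "\<forall>z\<in>Z. f z \<in> gen_eigenspace M z"
    by (auto simp: gen_eigenspace_sum_def)
  have "v = (\<Sum>z\<in>Z'. if z \<in> Z then f z else 0)"
    using assms f(1) by (simp add: sum.If_cases Int_absorb1)
  then show "v \<in> gen_eigenspace_sum M Z'"
    unfolding gen_eigenspace_sum_def using f(2) gen_eigenspace_zero
    by (auto intro!: exI[of _ "\<lambda>z. if z \<in> Z then f z else 0"])
qed

lemma gen_eigenspace_sum_disjoint: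
  assumes "finite Z" "a \<notin> Z" "v \<in> gen_eigenspace M a" "v \<in> gen_eigenspace_sum M Z"
  shows "v = 0"
proof -
  obtain f where f: "v = (\<Sum>z\<in>Z. f z)" "\<forall>z\<in>Z. f z \<in> gen_eigenspace M z"
    using assms(4) by (auto simp: gen_eigenspace_sum_def)
  define g where "g = (\<lambda>z. if z = a then (- 1) *s v else f z)"
  have gZ: "(\<Sum>z\<in>Z. g z) = (\<Sum>z\<in>Z. f z)"
    using assms(2) by (intro sum.cong) (auto simp: g_def)
  have "(\<Sum>z\<in>insert a Z. g z) = 0"
    using assms(1,2) by (simp add: gZ f(1)[symmetric]) (simp add: g_def)
  moreover have "g z \<in> gen_eigenspace M z" if "z \<in> insert a Z" for z
    using that f(2) gen_eigenspace_scale[OF assms(3), of "- 1"] by (auto simp: g_def)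
  ultimately have "\<forall>z\<in>insert a Z. g z = 0"
    using assms(1) by (intro gen_eigenspace_independent) auto
  then show ?thesis by (simp add: g_def)
qed

section \<open>Generalized eigenvectors along the flow\<close>

text \<open>The number \<open>w\<^sup>* b\<close>, conjugate linear in the complex vector.\<close>

definition cdot :: "complex^'n \<Rightarrow> real^'n \<Rightarrow> complex" where
  "cdot w b = (\<Sum>a\<in>UNIV. cnj (w $ a) * complex_of_real (b $ a))"

definition adjoint_matrix :: "real^'n^'n \<Rightarrow> complex^'n^'n" where
  "adjoint_matrix A = conj_transpose (complex_matrix A)"

lemma cdot_add_left: "cdot (v + w) b = cdot v b + cdot w b"
  by (simp add: cdot_def algebra_simps sum.distrib)

lemma cdot_scale_left: "cdot (c *s w) b = cnj c * cdot w b"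
  by (simp add: cdot_def algebra_simps sum_distrib_left)

lemma cdot_zero_left [simp]: "cdot 0 b = 0"
  by (simp add: cdot_def)

lemma cdot_sum_left: "cdot (\<Sum>i\<in>S. f i) b = (\<Sum>i\<in>S. cdot (f i) b)"
  by (induction S rule: infinite_finite_induct) (simp_all add: cdot_add_left)

lemma cdot_add_right: "cdot w (b + c) = cdot w b + cdot w c"
  by (simp add: cdot_def algebra_simps sum.distrib)

lemma cdot_scaleR_right: "cdot w (c *\<^sub>R b) = of_real c * cdot w b"
  by (simp add: cdot_def algebra_simps sum_distrib_left)

lemma cdot_sum_right: "cdot w (\<Sum>i\<in>S. f i) = (\<Sum>i\<in>S. cdot w (f i))"
  by (induction S rule: infinite_finite_induct) (simp_all add: cdot_add_right, simp_all add: cdot_def)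

lemma bounded_linear_cdot: "bounded_linear (cdot w)"
proof (rule linear_conv_bounded_linear[THEN iffD1], rule linearI)
  show "cdot w (c *\<^sub>R b) = c *\<^sub>R cdot w b" for c b
    unfolding cdot_scaleR_right by (simp add: scaleR_conv_of_real)
qed (rule cdot_add_right)

lemma cdot_adjoint: "cdot (adjoint_matrix A *v w) b = cdot w (A *v b)"
proof -
  have "cdot (adjoint_matrix A *v w) b =
      (\<Sum>a\<in>UNIV. \<Sum>c\<in>UNIV. cnj (w $ c) * (of_real (A $ c $ a) * of_real (b $ a)))"
    by (simp add: cdot_def adjoint_matrix_def conj_transpose_def complex_matrix_def
        matrix_vector_mult_def sum_distrib_left mult_ac)
  also have "\<dots> = cdot w (A *v b)"
    by (subst sum.swap) (simp add: cdot_def matrix_vector_mult_def sum_distrib_left)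
  finally show ?thesis .
qed

lemma cdot_eig_shift: "cdot (eig_shift (adjoint_matrix A) z w) b = cdot w (A *v b) - cnj z * cdot w b"
proof -
  have "eig_shift (adjoint_matrix A) z w = adjoint_matrix A *v w + (- z) *s w"
    by (simp add: eig_shift_def)
  then show ?thesis by (simp only: cdot_add_left cdot_scale_left cdot_adjoint) simp
qed

lemma Re_cdot: "Re (cdot w b) = (\<chi> a. Re (w $ a)) \<bullet> b"
  by (simp add: cdot_def inner_vec_def)

lemma cdot_of_real: "cdot (\<chi> a. complex_of_real (v $ a)) b = of_real (v \<bullet> b)"
  by (simp add: cdot_def inner_vec_def)

text \<open>Induction on the order of nilpotency: after division by the exponential factor, the derivative of
the left side is the same expression for \<open>(A\<^sup>* - z) w\<close> in place of \<open>w\<close>.\<close>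

lemma cdot_flow_mode:
  assumes "(eig_shift (adjoint_matrix A) z ^^ d) w = 0"
  shows "cdot w (mexp (t *\<^sub>R A) *v b) = exp (cnj z * of_real t) *
    (\<Sum>r<d. of_real (t ^ r / fact r) * cdot ((eig_shift (adjoint_matrix A) z ^^ r) w) b)"
  using assms
proof (induction d arbitrary: w t)
  case (Suc d)
  let ?S = "eig_shift (adjoint_matrix A) z"
  define g where "g = (\<lambda>s. exp (- cnj z * of_real s) * cdot w (mexp (s *\<^sub>R A) *v b))"
  define p where "p = (\<lambda>s::real. \<Sum>r<Suc d. of_real (s ^ r / fact r) * cdot ((?S ^^ r) w) b)"
  define p' where "p' = (\<lambda>s::real. \<Sum>r<d. of_real (s ^ r / fact r) * cdot ((?S ^^ r) (?S w)) b)"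
  have "(?S ^^ d) (?S w) = 0" using Suc.prems by (simp add: funpow_swap1)
  note IH = Suc.IH[OF this]
  have e: "((\<lambda>s. exp (- cnj z * of_real s)) has_vector_derivative (- cnj z * exp (- cnj z * of_real s))) (at s)" for s
    by (rule has_vector_derivative_real_field[where f = "\<lambda>x. exp (- cnj z * x)"])
       (auto intro!: derivative_eq_intros)
  have g': "(g has_vector_derivative p' s) (at s)" for s
  proof -
    have "((\<lambda>s. cdot w (mexp (s *\<^sub>R A) *v b)) has_vector_derivative cdot w (A *v (mexp (s *\<^sub>R A) *v b))) (at s)"
      by (rule bounded_linear.has_vector_derivative[OF bounded_linear_cdot mexp_vec_derivative])
    then have "(g has_vector_derivative (exp (- cnj z * of_real s) * cdot w (A *v (mexp (s *\<^sub>R A) *v b)) +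
        (- cnj z * exp (- cnj z * of_real s)) * cdot w (mexp (s *\<^sub>R A) *v b))) (at s)"
      unfolding g_def by (rule has_vector_derivative_mult[OF e])
    moreover have "exp (- cnj z * of_real s) * cdot w (A *v (mexp (s *\<^sub>R A) *v b)) +
        (- cnj z * exp (- cnj z * of_real s)) * cdot w (mexp (s *\<^sub>R A) *v b) =
        exp (- cnj z * of_real s) * cdot (?S w) (mexp (s *\<^sub>R A) *v b)"
      by (simp add: cdot_eig_shift algebra_simps)
    moreover have "\<dots> = p' s"
      unfolding IH p'_def by (simp add: mult.assoc[symmetric] exp_add[symmetric])
    ultimately show ?thesis by simp
  qed
  have p_eq: "p s = cdot w b + (\<Sum>r<d. of_real (s ^ Suc r / fact (Suc r)) * cdot ((?S ^^ r) (?S w)) b)" for s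
    unfolding p_def by (subst sum.lessThan_Suc_shift) (simp add: funpow_swap1)
  have p': "(p has_vector_derivative p' s) (at s)" for s
  proof -
    have "((\<lambda>s::real. complex_of_real (s ^ Suc r / fact (Suc r))) has_vector_derivative of_real (s ^ r / fact r)) (at s)" for r
    proof (rule has_vector_derivative_of_real)
      have "((\<lambda>s::real. s ^ Suc r / fact (Suc r)) has_real_derivative (of_nat (Suc r) * s ^ r / fact (Suc r))) (at s)"
        using DERIV_cdivide[OF DERIV_pow[of "Suc r" s], of "fact (Suc r)"] by (simp del: fact_Suc of_nat_Suc)
      moreover have "of_nat (Suc r) * s ^ r / fact (Suc r) = s ^ r / fact r"
        unfolding fact_Suc by (simp del: of_nat_Suc)
      ultimately show "((\<lambda>s::real. s ^ Suc r / fact (Suc r)) has_real_derivative (s ^ r / fact r)) (at s)" by simp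
    qed
    then have "((\<lambda>s. cdot w b + (\<Sum>r<d. of_real (s ^ Suc r / fact (Suc r)) * cdot ((?S ^^ r) (?S w)) b))
        has_vector_derivative 0 + (\<Sum>r<d. of_real (s ^ r / fact r) * cdot ((?S ^^ r) (?S w)) b)) (at s)"
      by (intro has_vector_derivative_add has_vector_derivative_const has_vector_derivative_sum
          has_vector_derivative_mult_left)
    then show ?thesis unfolding p_eq[abs_def] p'_def by simp
  qed
  have "((\<lambda>s. g s - p s) has_vector_derivative 0) (at s)" for s
    using has_vector_derivative_diff[OF g' p'] by simp
  then obtain c where "\<And>s. g s - p s = c"
    using has_vector_derivative_zero_constant[of UNIV "\<lambda>s. g s - p s"] by auto
  then have "g t - p t = g 0 - p 0" by simp
  moreover have "g 0 = p 0" unfolding p_eq by (simp add: g_def)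
  ultimately have "g t = p t" by simp
  have "cdot w (mexp (t *\<^sub>R A) *v b) = exp (cnj z * of_real t) * g t"
    by (simp add: g_def mult.assoc[symmetric] exp_add[symmetric])
  then show ?case unfolding \<open>g t = p t\<close> p_def .
qed simp

text \<open>The coefficient of \<open>t\<^sup>r / r!\<close> in the response of the family \<open>w\<close> to the input \<open>\<sigma>\<close>, once the
exponential factor is split off; see \<open>moment_flow_mode\<close>.\<close>

definition moment :: "complex^'n^'n \<Rightarrow> complex \<Rightarrow> ('q::finite \<Rightarrow> 'p \<Rightarrow> real^'n) \<Rightarrow> ('q \<Rightarrow> complex^'n) \<Rightarrow> 'p \<Rightarrow> nat \<Rightarrow> complex" where
  "moment M z B w \<sigma> r = (\<Sum>i\<in>UNIV. cdot ((eig_shift M z ^^ r) (w i)) (B i \<sigma>))"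

lemma moment_flow_mode:
  assumes "\<And>i. (eig_shift (adjoint_matrix A) z ^^ d) (w i) = 0"
  shows "(\<Sum>i\<in>UNIV. cdot (w i) (mexp (t *\<^sub>R A) *v B i \<sigma>)) = exp (cnj z * of_real t) *
    (\<Sum>r<d. of_real (t ^ r / fact r) * moment (adjoint_matrix A) z B w \<sigma> r)"
  unfolding cdot_flow_mode[OF assms] moment_def
  by (subst sum_distrib_left[symmetric], subst sum.swap) (simp add: sum_distrib_left)

lemma moment_scale: "moment M z B (\<lambda>i. c *s w i) \<sigma> r = cnj c * moment M z B w \<sigma> r"
  by (simp add: moment_def eig_shift_pow_scale cdot_scale_left sum_distrib_left)

lemma moment_sum: "moment M z B (\<lambda>i. \<Sum>s\<in>S. w s i) \<sigma> r = (\<Sum>s\<in>S. moment M z B (w s) \<sigma> r)"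
  unfolding moment_def eig_shift_pow_sum cdot_sum_left by (rule sum.swap)

lemma moment_shift: "moment M z B (\<lambda>i. (eig_shift M z ^^ s) (w i)) \<sigma> r = moment M z B w \<sigma> (r + s)"
  by (simp add: moment_def funpow_add)

lemma moment_zero:
  assumes "\<And>i. (eig_shift M z ^^ d) (w i) = 0" "d \<le> r"
  shows "moment M z B w \<sigma> r = 0"
  unfolding moment_def using eig_shift_pow_mono[OF assms(1) assms(2)] by simp

definition real_vec :: "complex^'n \<Rightarrow> bool" where
  "real_vec w \<longleftrightarrow> (\<forall>a. w $ a \<in> \<real>)"

lemma real_vec_eig_shift_pow:
  assumes "real_vec w" "z \<in> \<real>"
  shows "real_vec ((eig_shift (adjoint_matrix A) z ^^ r) w)"
  using assms
  by (induction r)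
     (auto simp: real_vec_def eig_shift_def adjoint_matrix_def conj_transpose_def complex_matrix_def
        matrix_vector_mult_def intro!: Reals_diff Reals_mult sum_in_Reals)

lemma cdot_real: "real_vec w \<Longrightarrow> cdot w b \<in> \<real>"
  unfolding cdot_def real_vec_def by (intro sum_in_Reals Reals_mult) (auto simp: Reals_cnj_iff)

definition complex_vec :: "real^'n \<Rightarrow> complex^'n" where
  "complex_vec x = (\<chi> a. complex_of_real (x $ a))"

definition Re_vec :: "complex^'n \<Rightarrow> real^'n" where
  "Re_vec v = (\<chi> a. Re (v $ a))"

definition cnj_vec :: "complex^'n \<Rightarrow> complex^'n" where
  "cnj_vec v = (\<chi> a. cnj (v $ a))"

lemma complex_vec_add: "complex_vec (x + y) = complex_vec x + complex_vec y"
  and complex_vec_diff: "complex_vec (x - y) = complex_vec x - complex_vec y"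
  and complex_vec_scaleR: "complex_vec (c *\<^sub>R x) = of_real c *s complex_vec x"
  and complex_vec_zero: "complex_vec 0 = 0"
  by (simp_all add: complex_vec_def vec_eq_iff)

lemma complex_vec_Re_vec: "real_vec v \<Longrightarrow> complex_vec (Re_vec v) = v"
  by (simp add: complex_vec_def Re_vec_def vec_eq_iff real_vec_def)

lemma adjoint_matrix_entry: "adjoint_matrix A $ i $ j = complex_of_real (A $ j $ i)"
  by (simp add: adjoint_matrix_def conj_transpose_def complex_matrix_def)

lemma eig_shift_pow_Re:
  assumes "z \<in> \<real>"
  shows "(eig_shift (adjoint_matrix A) z ^^ r) (complex_vec (Re_vec v)) =
    complex_vec (Re_vec ((eig_shift (adjoint_matrix A) z ^^ r) v))"
proof (induction r)
  case (Suc r)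
  have "Im z = 0" using assms by (simp add: complex_is_Real_iff)
  then have "eig_shift (adjoint_matrix A) z (complex_vec (Re_vec v)) =
      complex_vec (Re_vec (eig_shift (adjoint_matrix A) z v))" for v
    by (simp add: vec_eq_iff eig_shift_def complex_vec_def Re_vec_def matrix_vector_mult_def
        adjoint_matrix_entry complex_eq_iff)
  then show ?case by (simp add: Suc.IH)
qed simp

lemma eig_shift_pow_cnj:
  "(eig_shift (adjoint_matrix A) (cnj z) ^^ r) (cnj_vec v) = cnj_vec ((eig_shift (adjoint_matrix A) z ^^ r) v)"
proof (induction r)
  case (Suc r)
  have "eig_shift (adjoint_matrix A) (cnj z) (cnj_vec v) = cnj_vec (eig_shift (adjoint_matrix A) z v)" for v
    by (simp add: vec_eq_iff eig_shift_def cnj_vec_def matrix_vector_mult_def adjoint_matrix_entry)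
  then show ?case by (simp add: Suc.IH)
qed simp

lemma gen_eigenspace_cnj:
  assumes "v \<in> gen_eigenspace (adjoint_matrix A) z"
  shows "cnj_vec v \<in> gen_eigenspace (adjoint_matrix A) (cnj z)"
proof -
  obtain d where "(eig_shift (adjoint_matrix A) z ^^ d) v = 0" using assms by (auto simp: gen_eigenspace_def)
  then have "(eig_shift (adjoint_matrix A) (cnj z) ^^ d) (cnj_vec v) = 0"
    unfolding eig_shift_pow_cnj by (simp add: cnj_vec_def vec_eq_iff)
  then show ?thesis by (auto simp: gen_eigenspace_def)
qed

lemma moment_Re:
  fixes A :: "real^'n^'n" and B :: "'q::finite \<Rightarrow> 'p \<Rightarrow> real^'n"
  assumes "z \<in> \<real>"
  shows "moment (adjoint_matrix A) z B (\<lambda>i. complex_vec (Re_vec (w i))) \<sigma> r =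
    of_real (Re (moment (adjoint_matrix A) z B w \<sigma> r))"
proof -
  have "cdot (complex_vec (Re_vec v)) b = of_real (Re (cdot v b))" for v :: "complex^'n" and b
    unfolding complex_vec_def cdot_of_real by (simp add: Re_cdot Re_vec_def)
  then show ?thesis by (simp add: moment_def eig_shift_pow_Re[OF assms])
qed

text \<open>The family \<open>e\<^sup>t\<^sup>N w\<close> with \<open>N = M - z\<close>, for \<open>w\<close> annihilated by \<open>N\<^sup>d\<close>. Replacing \<open>w\<close> by it shifts the
polynomial of the response by the time \<open>t\<close>, so its moments are the derivatives at \<open>t\<close>.\<close>

definition flow_modes :: "complex^'n^'n \<Rightarrow> complex \<Rightarrow> nat \<Rightarrow> real \<Rightarrow> ('q \<Rightarrow> complex^'n) \<Rightarrow> 'q \<Rightarrow> complex^'n" where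
  "flow_modes M z d t w i = (\<Sum>s<d. of_real (t ^ s / fact s) *s (eig_shift M z ^^ s) (w i))"

lemma moment_flow_modes:
  "moment M z B (flow_modes M z d t w) \<sigma> r = (\<Sum>s<d. of_real (t ^ s / fact s) * moment M z B w \<sigma> (r + s))"
  unfolding flow_modes_def[abs_def] moment_sum moment_scale moment_shift by simp

lemma eig_shift_flow_modes:
  "(eig_shift M z ^^ r) (flow_modes M z d t w i) = flow_modes M z d t (\<lambda>i. (eig_shift M z ^^ r) (w i)) i"
  unfolding flow_modes_def eig_shift_pow_sum eig_shift_pow_scale
  by (intro sum.cong refl arg_cong[of _ _ "\<lambda>v. _ *s v"] eig_shift_pow_commute)

text \<open>The operator \<open>e\<^sup>t\<^sup>N\<close> is the identity plus a nilpotent operator.\<close>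

lemma flow_modes_injective:
  assumes "(eig_shift M z ^^ e) v = 0" "0 < d" "(\<Sum>s<d. of_real (t ^ s / fact s) *s (eig_shift M z ^^ s) v) = 0"
  shows "v = 0"
  using assms(1,3)
proof (induction e arbitrary: v)
  case (Suc e)
  let ?S = "eig_shift M z"
  have "(?S ^^ 1) (\<Sum>s<d. of_real (t ^ s / fact s) *s (?S ^^ s) v) = 0"
    unfolding Suc.prems(2) by (rule eig_shift_pow_zero)
  then have sum0: "(\<Sum>s<d. of_real (t ^ s / fact s) *s (?S ^^ s) (?S v)) = 0"
    unfolding eig_shift_pow_sum eig_shift_pow_scale by (simp add: funpow_swap1)
  have "(?S ^^ e) (?S v) = 0" using Suc.prems(1) by (simp add: funpow_swap1)
  from this sum0 have Sv: "?S v = 0" by (rule Suc.IH)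
  have pow: "(?S ^^ s) v = (if s = 0 then v else 0)" for s
  proof (cases s)
    case (Suc s')
    have "(?S ^^ Suc s') v = (?S ^^ s') (?S v)" by (simp add: funpow_swap1)
    then show ?thesis by (simp add: Suc Sv)
  qed simp
  have "(\<Sum>s<d. of_real (t ^ s / fact s) *s (?S ^^ s) v) = v"
    using \<open>0 < d\<close> unfolding pow by (simp add: if_distrib[of "\<lambda>v. _ *s v"] cong: if_cong)
  with Suc.prems(2) show ?case by simp
qed simp

lemma power_div_fact_le_exp:
  assumes "0 \<le> (x::real)"
  shows "x ^ r / fact r \<le> exp x"
proof -
  have "(\<Sum>n\<in>{r}. inverse (fact n) * x ^ n) \<le> (\<Sum>n. inverse (fact n) * x ^ n)"
    using assms summable_exp[of x] by (intro sum_le_suminf) auto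
  also have "\<dots> = exp x" by (simp add: exp_def)
  finally show ?thesis by (simp add: divide_inverse mult.commute)
qed

lemma Re_flow_mode:
  fixes A :: "real^'n^'n" and B :: "'q::finite \<Rightarrow> 'p \<Rightarrow> real^'n"
  assumes "\<And>i. (eig_shift (adjoint_matrix A) z ^^ d) (w i) = 0"
  shows "(\<Sum>i\<in>UNIV. Re_vec (w i) \<bullet> (mexp (t *\<^sub>R A) *v B i \<sigma>)) =
    Re (exp (cnj z * of_real t) * (\<Sum>r<d. of_real (t ^ r / fact r) * moment (adjoint_matrix A) z B w \<sigma> r))"
  unfolding moment_flow_mode[OF assms, symmetric] by (simp add: Re_cdot Re_vec_def)

lemma Re_flow_mode_real:
  fixes A :: "real^'n^'n" and B :: "'q::finite \<Rightarrow> 'p \<Rightarrow> real^'n"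
  assumes "\<And>i. (eig_shift (adjoint_matrix A) z ^^ d) (w i) = 0" "z \<in> \<real>"
  shows "(\<Sum>i\<in>UNIV. Re_vec (w i) \<bullet> (mexp (t *\<^sub>R A) *v B i \<sigma>)) =
    exp (Re z * t) * (\<Sum>r<d. t ^ r / fact r * Re (moment (adjoint_matrix A) z B w \<sigma> r))"
proof -
  have z: "z = of_real (Re z)" using assms(2) by (simp add: complex_is_Real_iff complex_eq_iff)
  have "exp (cnj z * of_real t) = of_real (exp (Re z * t))"
    by (subst z) (simp flip: exp_of_real)
  moreover have "Re (of_real c * x) = c * Re x" for c x by simp
  ultimately show ?thesis
    unfolding Re_flow_mode[OF assms(1), where t = t and B = B and \<sigma> = \<sigma>] by (simp only: Re_sum)
qed

text \<open>A power of \<open>t\<close> costs an arbitrarily small amount of exponential growth; there is nothing to pay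
when the family consists of eigenvectors.\<close>

lemma flow_mode_growth:
  fixes A :: "real^'n^'n" and B :: "'q::finite \<Rightarrow> 'p \<Rightarrow> real^'n"
  assumes "\<And>i. (eig_shift (adjoint_matrix A) z ^^ d) (w i) = 0" "Re z < a \<or> d \<le> 1 \<and> Re z \<le> a"
  shows "\<exists>C. \<forall>t\<ge>0. \<bar>\<Sum>i\<in>UNIV. Re_vec (w i) \<bullet> (mexp (t *\<^sub>R A) *v B i \<sigma>)\<bar> \<le> C * exp (a * t)"
proof -
  let ?m = "\<lambda>r. norm (moment (adjoint_matrix A) z B w \<sigma> r)"
  have bound: "\<bar>\<Sum>i\<in>UNIV. Re_vec (w i) \<bullet> (mexp (t *\<^sub>R A) *v B i \<sigma>)\<bar> \<le>
      exp (Re z * t) * (\<Sum>r<d. t ^ r / fact r * ?m r)" if "0 \<le> t" for t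
  proof -
    have "\<bar>\<Sum>i\<in>UNIV. Re_vec (w i) \<bullet> (mexp (t *\<^sub>R A) *v B i \<sigma>)\<bar> \<le>
        norm (exp (cnj z * of_real t) * (\<Sum>r<d. of_real (t ^ r / fact r) * moment (adjoint_matrix A) z B w \<sigma> r))"
      unfolding Re_flow_mode[OF assms(1), where t = t and B = B and \<sigma> = \<sigma>] by (rule abs_Re_le_cmod)
    also have "\<dots> = exp (Re z * t) * norm (\<Sum>r<d. of_real (t ^ r / fact r) * moment (adjoint_matrix A) z B w \<sigma> r)"
      by (simp add: norm_mult norm_exp_eq_Re)
    also have "\<dots> \<le> exp (Re z * t) * (\<Sum>r<d. norm (of_real (t ^ r / fact r) * moment (adjoint_matrix A) z B w \<sigma> r))"
      by (intro mult_left_mono norm_sum) simp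
    also have "\<dots> = exp (Re z * t) * (\<Sum>r<d. t ^ r / fact r * ?m r)"
      using that by (simp only: norm_mult norm_of_real) simp
    finally show ?thesis .
  qed
  show ?thesis
  proof (cases "Re z < a")
    case True
    define e where "e = a - Re z"
    have e: "0 < e" using True by (simp add: e_def)
    have "exp (Re z * t) * (\<Sum>r<d. t ^ r / fact r * ?m r) \<le> (\<Sum>r<d. ?m r / e ^ r) * exp (a * t)" if t: "0 \<le> t" for t
    proof -
      have "t ^ r / fact r * ?m r \<le> exp (e * t) * (?m r / e ^ r)" for r
      proof -
        have "(e * t) ^ r / fact r \<le> exp (e * t)" using e t by (intro power_div_fact_le_exp) simp
        then have "(e * t) ^ r / fact r * (?m r / e ^ r) \<le> exp (e * t) * (?m r / e ^ r)"
          using e by (intro mult_right_mono) auto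
        moreover have "(e * t) ^ r / fact r * (?m r / e ^ r) = t ^ r / fact r * ?m r"
          using e by (simp add: power_mult_distrib)
        ultimately show ?thesis by simp
      qed
      then have "exp (Re z * t) * (\<Sum>r<d. t ^ r / fact r * ?m r) \<le> exp (Re z * t) * (\<Sum>r<d. exp (e * t) * (?m r / e ^ r))"
        by (intro mult_left_mono sum_mono) auto
      also have "\<dots> = exp (Re z * t + e * t) * (\<Sum>r<d. ?m r / e ^ r)"
        by (simp add: exp_add sum_distrib_left mult.assoc)
      also have "Re z * t + e * t = a * t" by (simp add: e_def algebra_simps)
      finally show ?thesis by (simp add: mult.commute)
    qed
    then show ?thesis using bound by (intro exI[of _ "\<Sum>r<d. ?m r / e ^ r"]) (blast intro: order_trans)
  next
    case False
    then have d: "d \<le> 1" "Re z \<le> a" using assms(2) by auto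
    have "exp (Re z * t) * (\<Sum>r<d. t ^ r / fact r * ?m r) \<le> ?m 0 * exp (a * t)" if "0 \<le> t" for t
    proof -
      have "(\<Sum>r<d. t ^ r / fact r * ?m r) \<le> ?m 0"
        using d(1) by (cases d) auto
      then have "exp (Re z * t) * (\<Sum>r<d. t ^ r / fact r * ?m r) \<le> exp (Re z * t) * ?m 0"
        by (intro mult_left_mono) auto
      also have "\<dots> \<le> exp (a * t) * ?m 0"
        using d(2) that by (intro mult_right_mono) (auto intro: mult_right_mono)
      finally show ?thesis by (simp add: mult.commute)
    qed
    then show ?thesis using bound by (intro exI[of _ "?m 0"]) (blast intro: order_trans)
  qed
qed

section \<open>Incidence matrices as moments of generalized eigenvectors\<close>

text \<open>One eigenvalue \<open>z\<close> of \<open>A\<^sup>*\<close> with a basis \<open>V\<close> of its generalized eigenspace, in which \<open>A\<^sup>* - z\<close> has the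
conjugate transpose of the matrix \<open>L\<close>. Columns of incidence matrices become functionals on
families of generalized eigenvectors, and coordinates disappear from the later arguments.\<close>

locale eigenspace_coordinates =
  fixes A :: "real^'n^'n" and z :: complex and d :: nat and V :: "nat \<Rightarrow> complex^'n"
    and D L :: "nat \<Rightarrow> nat \<Rightarrow> complex"
  assumes V: "gen_eigenspace_matrix (adjoint_matrix A) z d V"
    and D: "restriction_matrix (adjoint_matrix A) d V D"
    and L: "L = nilpotent_part z D"
begin

abbreviation "T \<equiv> eig_shift (adjoint_matrix A) z"
abbreviation "mom \<equiv> moment (adjoint_matrix A) z"

lemma shift_column:
  assumes "j < d"
  shows "T (V j) = (\<Sum>i<d. cnj (L j i) *s V i)"
proof -
  have "(\<Sum>i<d. (if i = j then z else 0) *s V i) = z *s V j"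
    using assms by (simp add: if_distrib[of "\<lambda>c. c *s _"] cong: if_cong)
  moreover have "adjoint_matrix A *v V j = (\<Sum>i<d. cnj (D j i) *s V i)"
    using D assms by (simp add: restriction_matrix_def)
  ultimately show ?thesis
    by (simp add: eig_shift_def L nilpotent_part_def vector_sub_rdistrib sum_subtractf)
qed

text \<open>Since \<open>A\<^sup>* V = V D\<^sup>*\<close>, the powers of \<open>L\<close> on the coordinate side are powers of \<open>A\<^sup>* - z\<close> on the
basis vectors.\<close>

lemma inc_Q_eq:
  "inc_Q B d V L (\<sigma>, r) (i, j) = (if j < d then cdot ((T ^^ r) (V j)) (B i \<sigma>) else 0)"
proof -
  have "(sq_apply d L ^^ r) (adjoint_apply d V b) = (\<lambda>j. if j < d then cdot ((T ^^ r) (V j)) b else 0)" for b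
  proof (induction r)
    case 0
    show ?case by (auto simp: adjoint_apply_def cdot_def)
  next
    case (Suc r)
    have "(\<Sum>i<d. L j i * cdot ((T ^^ r) (V i)) b) = cdot ((T ^^ Suc r) (V j)) b" if "j < d" for j
    proof -
      have "(T ^^ Suc r) (V j) = (\<Sum>i<d. cnj (L j i) *s (T ^^ r) (V i))"
        by (simp add: funpow_swap1 shift_column[OF that] eig_shift_pow_sum eig_shift_pow_scale)
      then show ?thesis by (simp add: cdot_sum_left cdot_scale_left)
    qed
    then show ?case
      by (simp only: funpow.simps o_apply Suc.IH) (auto simp: sq_apply_def cong: sum.cong_simp)
  qed
  then show ?thesis by (simp add: inc_Q_def)
qed

definition combine :: "('q \<times> nat \<Rightarrow> complex) \<Rightarrow> 'q \<Rightarrow> complex^'n" where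
  "combine y i = (\<Sum>j<d. y (i, j) *s V j)"

lemma combine_in: "(T ^^ d) (combine y i) = 0"
  using gen_eigenspace_matrix_range[OF V] by (auto simp: combine_def)

lemma combine_eq_iff: "combine y k = combine y l \<longleftrightarrow> (\<forall>j<d. y (k, j) = y (l, j))"
proof
  assume "combine y k = combine y l"
  then have "(\<Sum>j<d. (y (k, j) - y (l, j)) *s V j) = 0"
    by (simp add: combine_def vector_sub_rdistrib sum_subtractf)
  then show "\<forall>j<d. y (k, j) = y (l, j)" using gen_eigenspace_matrix_coeff_0[OF V] by fastforce
qed (simp add: combine_def)

lemma pairing_inc_Q:
  "(\<Sum>x\<in>UNIV \<times> {..<d}. cnj (y x) * inc_Q B d V L (\<sigma>, r) x) = mom B (combine y) \<sigma> r"
proof -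
  have "(\<Sum>x\<in>UNIV \<times> {..<d}. cnj (y x) * inc_Q B d V L (\<sigma>, r) x) =
      (\<Sum>i\<in>UNIV. \<Sum>j<d. cnj (y (i, j)) * inc_Q B d V L (\<sigma>, r) (i, j))"
    by (simp add: sum.cartesian_product case_prod_beta)
  also have "\<dots> = (\<Sum>i\<in>UNIV. \<Sum>j<d. cnj (y (i, j)) * cdot ((T ^^ r) (V j)) (B i \<sigma>))"
    by (intro sum.cong) (auto simp: inc_Q_eq)
  also have "\<dots> = mom B (combine y) \<sigma> r"
    by (simp add: moment_def combine_def eig_shift_pow_sum eig_shift_pow_scale cdot_sum_left cdot_scale_left)
  finally show ?thesis .
qed

lemma combine_surj:
  assumes "\<And>i. (T ^^ d) (w i) = 0"
  obtains y where "w = combine y"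
proof -
  have "\<exists>c. w i = (\<Sum>j<d. c j *s V j)" for i
    using gen_eigenspace_matrix_range[OF V] assms by blast
  then obtain c where "\<And>i. w i = (\<Sum>j<d. c i j *s V j)" by metis
  then show ?thesis by (intro that[of "\<lambda>(i, j). c i j"]) (auto simp: combine_def)
qed

text \<open>Relative actuation makes the blocks of each column sum to zero, and orthogonality to
\<open>\<one> \<otimes> I\<^sub>d\<close> says just this.\<close>

lemma class_G_inc_Q:
  fixes B :: "'q::finite \<Rightarrow> 'p \<Rightarrow> real^'n"
  assumes "relative_actuation B"
  shows "class_G d C (inc_Q B d V L)"
  unfolding class_G_def
proof (intro ballI)
  fix v w :: "'q \<times> nat \<Rightarrow> complex"
  assume "v \<in> col_range C (inc_Q B d V L)" "w \<in> col_range {..<d} (kron_id (\<lambda>_ :: 'q. 1))"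
  then obtain \<alpha> \<beta> where v: "v = (\<lambda>x. \<Sum>c\<in>C. \<alpha> c * inc_Q B d V L c x)"
    and w: "w = (\<lambda>x. \<Sum>c<d. \<beta> c * kron_id (\<lambda>_. 1) c x)"
    by (auto simp: col_range_def)
  have sum0: "(\<Sum>i\<in>UNIV. inc_Q B d V L c (i, j)) = 0" for c j
  proof (cases c)
    case (Pair \<sigma> r)
    have "(\<Sum>i\<in>UNIV. cdot u (B i \<sigma>)) = 0" for u
      using assms by (simp add: relative_actuation_def cdot_sum_right[symmetric]) (simp add: cdot_def)
    then show ?thesis by (cases "j < d") (simp_all add: Pair inc_Q_eq)
  qed
  have w_eq: "w (i, j) = (\<Sum>c<d. \<beta> c * (if j = c then 1 else 0))" for i j
    by (simp add: w kron_id_def)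
  have "(\<Sum>i\<in>UNIV. \<Sum>j<d. cnj (w (i, j)) * v (i, j)) =
      (\<Sum>j<d. cnj (\<Sum>c<d. \<beta> c * (if j = c then 1 else 0)) * (\<Sum>i\<in>UNIV. v (i, j)))"
    unfolding w_eq by (subst sum.swap) (simp add: sum_distrib_left)
  moreover have "(\<Sum>i\<in>UNIV. v (i, j)) = 0" for j
    unfolding v by (subst sum.swap) (simp add: sum_distrib_left[symmetric] sum0)
  ultimately show "(\<Sum>i\<in>UNIV. \<Sum>j<d. cnj (w (i, j)) * v (i, j)) = 0" by simp
qed

lemma difference_columns:
  fixes v :: "'q \<times> nat \<Rightarrow> 'z::comm_ring_1"
  shows "v \<in> col_range {..<d} (kron_id (basis_difference k l)) \<longleftrightarrow>
    (\<exists>\<beta>. v = (\<lambda>(i, j). basis_difference k l i * (if j < d then \<beta> j else 0)))"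
proof -
  have "(\<lambda>x. \<Sum>c<d. \<beta> c * kron_id (basis_difference k l) c x) =
      (\<lambda>(i, j). basis_difference k l i * (if j < d then \<beta> j else 0))" for \<beta> :: "nat \<Rightarrow> 'z" and k l :: 'q
  proof
    fix x :: "'q \<times> nat"
    obtain i j where x: "x = (i, j)" by (cases x)
    have "(\<Sum>c<d. \<beta> c * kron_id (basis_difference k l) c x) =
        (\<Sum>c<d. if j = c then basis_difference k l i * \<beta> c else 0)"
      unfolding x kron_id_def by (intro sum.cong) (auto simp: mult.commute)
    then show "(\<Sum>c<d. \<beta> c * kron_id (basis_difference k l) c x) =
      (\<lambda>(i, j). basis_difference k l i * (if j < d then \<beta> j else 0)) x"
      by (simp add: x)
  qed
  then show ?thesis unfolding col_range_def by auto
qed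

lemma pairing_difference:
  fixes y :: "'q::finite \<times> nat \<Rightarrow> 'z::comm_ring_1"
  assumes "k \<noteq> l"
  shows "(\<Sum>x\<in>UNIV \<times> {..<d}. y x * (\<lambda>(i, j). basis_difference k l i * (if j < d then \<beta> j else 0)) x) =
    (\<Sum>j<d. (y (k, j) - y (l, j)) * \<beta> j)"
proof -
  have "(\<Sum>x\<in>UNIV \<times> {..<d}. y x * (\<lambda>(i, j). basis_difference k l i * (if j < d then \<beta> j else 0)) x) =
      (\<Sum>i\<in>UNIV. \<Sum>j<d. y (i, j) * (basis_difference k l i * \<beta> j))"
    by (simp add: sum.cartesian_product case_prod_beta) (intro sum.cong, auto)
  also have "\<dots> = (\<Sum>j<d. \<Sum>i\<in>UNIV. y (i, j) * (basis_difference k l i * \<beta> j))" by (rule sum.swap)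
  also have "\<dots> = (\<Sum>j<d. (y (k, j) - y (l, j)) * \<beta> j)"
    by (simp add: basis_difference_def algebra_simps sum_subtractf if_distrib[of "\<lambda>c. c * _"] if_distrib[of "\<lambda>c. _ * c"]
        cong: if_cong)
  finally show ?thesis .
qed

lemma ball_column_indices: "(\<forall>c\<in>I \<times> {..<d}. Q c) \<longleftrightarrow> (\<forall>\<sigma>\<in>I. \<forall>r<d. Q (\<sigma>, r))"
  by auto

lemma connected_pair_iff:
  fixes B :: "'q::finite \<Rightarrow> 'p \<Rightarrow> real^'n"
  assumes rel: "relative_actuation B" and "k \<noteq> l" and "finite I"
  shows "connected_pair d k l (I \<times> {..<d}) (inc_Q B d V L) \<longleftrightarrow>
    (\<forall>w. (\<forall>i. (T ^^ d) (w i) = 0) \<and> (\<forall>\<sigma>\<in>I. \<forall>r<d. mom B w \<sigma> r = 0) \<longrightarrow> w k = w l)"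
    (is "_ \<longleftrightarrow> ?R")
proof -
  let ?X = "UNIV \<times> {..<d} :: ('q \<times> nat) set"
  let ?D = "\<lambda>\<beta>. (\<lambda>(i, j). basis_difference k l i * (if j < d then \<beta> j else 0)) :: 'q \<times> nat \<Rightarrow> complex"
  have iff: "?D \<beta> \<in> col_range (I \<times> {..<d}) (inc_Q B d V L) \<longleftrightarrow>
      (\<forall>y. (\<forall>\<sigma>\<in>I. \<forall>r<d. mom B (combine y) \<sigma> r = 0) \<longrightarrow>
        (\<Sum>j<d. cnj (y (k, j) - y (l, j)) * \<beta> j) = 0)" for \<beta>
  proof -
    have key: "(\<Sum>x\<in>?X. cnj (y x) * ?D \<beta> x) = (\<Sum>j<d. cnj (y (k, j) - y (l, j)) * \<beta> j)" for y
      using pairing_difference[OF \<open>k \<noteq> l\<close>, of "\<lambda>x. cnj (y x)" \<beta>] by simp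
    have "?D \<beta> \<in> col_range (I \<times> {..<d}) (inc_Q B d V L) \<longleftrightarrow>
        (\<forall>y. (\<forall>c\<in>I \<times> {..<d}. (\<Sum>x\<in>?X. cnj (y x) * inc_Q B d V L c x) = 0) \<longrightarrow>
          (\<Sum>x\<in>?X. cnj (y x) * ?D \<beta> x) = 0)"
      using \<open>finite I\<close> by (intro col_range_iff) (auto simp: inc_Q_eq split: if_splits)
    then show ?thesis unfolding key ball_column_indices pairing_inc_Q .
  qed
  have "connected_pair d k l (I \<times> {..<d}) (inc_Q B d V L) \<longleftrightarrow>
      (\<forall>\<beta>. ?D \<beta> \<in> col_range (I \<times> {..<d}) (inc_Q B d V L))"
    using class_G_inc_Q[OF rel] by (auto simp: connected_pair_def subset_iff difference_columns)
  also have "\<dots> \<longleftrightarrow> (\<forall>y. (\<forall>\<sigma>\<in>I. \<forall>r<d. mom B (combine y) \<sigma> r = 0) \<longrightarrow>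
        (\<forall>\<beta>. (\<Sum>j<d. cnj (y (k, j) - y (l, j)) * \<beta> j) = 0))"
    unfolding iff by blast
  also have "\<dots> \<longleftrightarrow> (\<forall>y. (\<forall>\<sigma>\<in>I. \<forall>r<d. mom B (combine y) \<sigma> r = 0) \<longrightarrow>
        combine y k = combine y l)"
  proof -
    have "(\<forall>\<beta>. (\<Sum>j<d. cnj (a j) * \<beta> j) = 0) \<longleftrightarrow> (\<forall>j<d. a j = 0)" for a :: "nat \<Rightarrow> complex"
    proof
      assume all: "\<forall>\<beta>. (\<Sum>j<d. cnj (a j) * \<beta> j) = 0"
      show "\<forall>j<d. a j = 0"
      proof (intro allI impI)
        fix j0 assume "j0 < d"
        then show "a j0 = 0"
          using all[rule_format, of "\<lambda>j. if j = j0 then 1 else 0"]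
          by (simp add: if_distrib[of "\<lambda>c. _ * c"] cong: if_cong)
      qed
    qed simp
    then show ?thesis by (simp add: combine_eq_iff del: complex_cnj_diff)
  qed
  also have "\<dots> \<longleftrightarrow> ?R"
  proof (intro iffI allI impI)
    fix w :: "'q \<Rightarrow> complex^'n"
    assume *: "\<forall>y. (\<forall>\<sigma>\<in>I. \<forall>r<d. mom B (combine y) \<sigma> r = 0) \<longrightarrow> combine y k = combine y l"
      and w: "(\<forall>i. (T ^^ d) (w i) = 0) \<and> (\<forall>\<sigma>\<in>I. \<forall>r<d. mom B w \<sigma> r = 0)"
    obtain y where "w = combine y" using combine_surj[of w] w by blast
    with * w show "w k = w l" by simp
  next
    fix y :: "'q \<times> nat \<Rightarrow> complex"
    assume R: ?R and y: "\<forall>\<sigma>\<in>I. \<forall>r<d. mom B (combine y) \<sigma> r = 0"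
    show "combine y k = combine y l" using R[THEN spec, of "combine y"] combine_in[of y] y by simp
  qed
  finally show ?thesis .
qed

definition real_modes :: "('q \<Rightarrow> complex^'n) set" where
  "real_modes = {w. \<forall>i. real_vec (w i) \<and> (T ^^ d) (w i) = 0}"

context
  assumes z: "z \<in> \<real>"
begin

lemma real_V: "j < d \<Longrightarrow> real_vec (V j)"
  using V z by (auto simp: gen_eigenspace_matrix_def real_vec_def)

lemma inc_Q_real: "inc_Q B d V L c x \<in> \<real>"
  by (cases c, cases x) (auto simp: inc_Q_eq real_V z intro!: cdot_real real_vec_eig_shift_pow)

lemma real_modes_eq: "real_modes = range (\<lambda>y. combine (\<lambda>x. complex_of_real (y x)))"
proof (intro equalityI subsetI)
  fix w assume w: "w \<in> real_modes"
  then obtain y where y: "w = combine y" using combine_surj[of w] by (auto simp: real_modes_def)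
  have "w i = combine (\<lambda>x. complex_of_real (Re (y x))) i" for i
  proof -
    have "w i $ a = (\<Sum>j<d. complex_of_real (Re (y (i, j))) * V j $ a)" for a
    proof (rule complex_eqI)
      have V: "Im (V j $ a) = 0" if "j < d" for j
        using real_V[OF that] by (auto simp: real_vec_def complex_is_Real_iff)
      have wi: "w i $ a = (\<Sum>j<d. y (i, j) * V j $ a)" by (simp add: y combine_def)
      show "Re (w i $ a) = Re (\<Sum>j<d. complex_of_real (Re (y (i, j))) * V j $ a)"
        unfolding wi by (simp add: V)
      show "Im (w i $ a) = Im (\<Sum>j<d. complex_of_real (Re (y (i, j))) * V j $ a)"
        using w by (auto simp: V real_modes_def real_vec_def complex_is_Real_iff)
    qed
    then show ?thesis by (simp add: combine_def vec_eq_iff)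
  qed
  then show "w \<in> range (\<lambda>y. combine (\<lambda>x. complex_of_real (y x)))"
    by (intro range_eqI[of _ _ "\<lambda>x. Re (y x)"]) auto
next
  fix w assume "w \<in> range (\<lambda>y. combine (\<lambda>x. complex_of_real (y x)))"
  then obtain y where "w = combine (\<lambda>x. complex_of_real (y x))" by auto
  then show "w \<in> real_modes"
    using combine_in real_V
    by (auto simp: real_modes_def real_vec_def) (auto simp: combine_def intro!: sum_in_Reals Reals_mult)
qed

lemma pairing_Re_inc_Q:
  "pair_on (UNIV \<times> {..<d}) y (\<lambda>x. Re (inc_Q B d V L (\<sigma>, r) x)) =
    Re (mom B (combine (\<lambda>x. complex_of_real (y x))) \<sigma> r)"
  unfolding pairing_inc_Q[symmetric] by (simp add: pair_on_def)

lemma strongly_connected_pair_iff: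
  fixes B :: "'q::finite \<Rightarrow> 'p \<Rightarrow> real^'n"
  assumes rel: "relative_actuation B" and "k \<noteq> l" and "finite I"
  shows "strongly_connected_pair d k l (I \<times> {..<d}) (inc_Q B d V L) \<longleftrightarrow>
    (\<forall>w\<in>real_modes. (\<forall>\<sigma>\<in>I. \<forall>r<d. 0 \<le> Re (mom B w \<sigma> r)) \<longrightarrow> w k = w l)"
proof -
  let ?X = "UNIV \<times> {..<d} :: ('q \<times> nat) set"
  let ?G = "\<lambda>c x. Re (inc_Q B d V L c x)"
  let ?D = "\<lambda>\<beta>. (\<lambda>(i, j). basis_difference k l i * (if j < d then \<beta> j else 0)) :: 'q \<times> nat \<Rightarrow> real"
  have iff: "?D \<beta> \<in> col_cone (I \<times> {..<d}) ?G \<longleftrightarrow>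
      (\<forall>y. (\<forall>\<sigma>\<in>I. \<forall>r<d. 0 \<le> Re (mom B (combine (\<lambda>x. complex_of_real (y x))) \<sigma> r)) \<longrightarrow>
        0 \<le> (\<Sum>j<d. (y (k, j) - y (l, j)) * \<beta> j))" for \<beta>
  proof -
    have key: "pair_on ?X y (?D \<beta>) = (\<Sum>j<d. (y (k, j) - y (l, j)) * \<beta> j)" for y
      unfolding pair_on_def by (rule pairing_difference[OF \<open>k \<noteq> l\<close>])
    have "?D \<beta> \<in> col_cone (I \<times> {..<d}) ?G \<longleftrightarrow>
        (\<forall>y. (\<forall>c\<in>I \<times> {..<d}. 0 \<le> pair_on ?X y (?G c)) \<longrightarrow> 0 \<le> pair_on ?X y (?D \<beta>))"
      using \<open>finite I\<close> by (intro col_cone_iff) (auto simp: inc_Q_eq split: if_splits)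
    then show ?thesis unfolding key ball_column_indices pairing_Re_inc_Q .
  qed
  have "strongly_connected_pair d k l (I \<times> {..<d}) (inc_Q B d V L) \<longleftrightarrow>
      (\<forall>\<beta>. ?D \<beta> \<in> col_cone (I \<times> {..<d}) ?G)"
    using class_G_inc_Q[OF rel] inc_Q_real
    by (auto simp: strongly_connected_pair_def subset_iff difference_columns)
  also have "\<dots> \<longleftrightarrow> (\<forall>y. (\<forall>\<sigma>\<in>I. \<forall>r<d. 0 \<le> Re (mom B (combine (\<lambda>x. complex_of_real (y x))) \<sigma> r)) \<longrightarrow>
        (\<forall>\<beta>. 0 \<le> (\<Sum>j<d. (y (k, j) - y (l, j)) * \<beta> j)))"
    unfolding iff by blast
  also have "\<dots> \<longleftrightarrow> (\<forall>y. (\<forall>\<sigma>\<in>I. \<forall>r<d. 0 \<le> Re (mom B (combine (\<lambda>x. complex_of_real (y x))) \<sigma> r)) \<longrightarrow>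
        combine (\<lambda>x. complex_of_real (y x)) k = combine (\<lambda>x. complex_of_real (y x)) l)"
  proof -
    have "(\<forall>\<beta>. 0 \<le> (\<Sum>j<d. a j * \<beta> j)) \<longleftrightarrow> (\<forall>j<d. a j = 0)" for a :: "nat \<Rightarrow> real"
    proof
      assume all: "\<forall>\<beta>. 0 \<le> (\<Sum>j<d. a j * \<beta> j)"
      show "\<forall>j<d. a j = 0"
      proof (intro allI impI)
        fix j0 assume "j0 < d"
        then have "0 \<le> a j0 * - a j0"
          using all[rule_format, of "\<lambda>j. if j = j0 then - a j0 else 0"]
          by (simp add: if_distrib[of "\<lambda>c. _ * c"] cong: if_cong)
        then show "a j0 = 0" by (auto simp: mult_le_0_iff)
      qed
    qed simp
    then show ?thesis by (simp add: combine_eq_iff)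
  qed
  finally show ?thesis unfolding real_modes_eq by simp
qed

lemma removed_indices_iff:
  fixes B :: "'q::finite \<Rightarrow> 'p \<Rightarrow> real^'n"
  assumes "finite I"
  shows "\<sigma> \<in> removed_indices B d V L I \<longleftrightarrow> \<sigma> \<in> I \<and> (\<exists>r<d. \<exists>w\<in>real_modes.
    (\<forall>\<sigma>'\<in>I. \<forall>r'<d. 0 \<le> Re (mom B w \<sigma>' r')) \<and>
    0 < Re (mom B w \<sigma> r))"
proof -
  let ?X = "UNIV \<times> {..<d} :: ('q \<times> nat) set"
  have "(\<lambda>x. Re (inc_Q B d V L (\<sigma>, r) x)) \<notin> largest_subspace (col_cone (I \<times> {..<d}) (\<lambda>c x. Re (inc_Q B d V L c x))) \<longleftrightarrow>
    (\<exists>w\<in>real_modes. (\<forall>\<sigma>'\<in>I. \<forall>r'<d. 0 \<le> Re (mom B w \<sigma>' r')) \<and>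
      0 < Re (mom B w \<sigma> r))" if "\<sigma> \<in> I" "r < d" for r
  proof -
    have "finite (I \<times> {..<d})" "finite ?X" "(\<sigma>, r) \<in> I \<times> {..<d}" using that \<open>finite I\<close> by auto
    moreover have "Re (inc_Q B d V L c x) = 0" if "x \<notin> ?X" for c and x :: "'q \<times> nat"
      using that by (cases c, cases x) (auto simp: inc_Q_eq)
    ultimately show ?thesis
      using not_in_largest_subspace_iff[of "I \<times> {..<d}" ?X "\<lambda>c x. Re (inc_Q B d V L c x)" "(\<sigma>, r)"]
      unfolding real_modes_eq ball_column_indices pairing_Re_inc_Q by simp
  qed
  then show ?thesis unfolding removed_indices_def by auto
qed

end

end

section \<open>The spectral criterion\<close>

text \<open>The spectral data of the array. Real parts of the eigenvalues descend, and a real eigenvalue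
precedes the nonreal ones with the same real part; the inductions below run along this order.\<close>

locale array_spectrum =
  fixes A :: "real^'n^'n" and B :: "'q::finite \<Rightarrow> 'p::finite \<Rightarrow> real^'n"
    and m :: nat and \<mu> :: "nat \<Rightarrow> complex" and N :: "nat \<Rightarrow> nat"
    and U :: "nat \<Rightarrow> nat \<Rightarrow> complex^'n" and D \<Lambda> :: "nat \<Rightarrow> nat \<Rightarrow> nat \<Rightarrow> complex"
  assumes eigenvalues: "ordered_eigenvalues (adjoint_matrix A) m \<mu>"
    and multiplicities: "\<forall>\<kappa><m. N \<kappa> = alg_multiplicity (adjoint_matrix A) (\<mu> \<kappa>)"
    and bases: "\<forall>\<kappa><m. gen_eigenspace_matrix (adjoint_matrix A) (\<mu> \<kappa>) (N \<kappa>) (U \<kappa>)"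
    and restrictions: "\<forall>\<kappa><m. restriction_matrix (adjoint_matrix A) (N \<kappa>) (U \<kappa>) (D \<kappa>)"
    and nilpotents: "\<forall>\<kappa><m. \<Lambda> \<kappa> = nilpotent_part (\<mu> \<kappa>) (D \<kappa>)"
begin

abbreviation "I \<equiv> index_set B \<mu> N U \<Lambda>"
abbreviation "S \<kappa> \<equiv> eig_shift (adjoint_matrix A) (\<mu> \<kappa>)"
abbreviation "mom \<kappa> \<equiv> moment (adjoint_matrix A) (\<mu> \<kappa>) B"
abbreviation "M \<equiv> adjoint_matrix A"

text \<open>Families of generalized eigenvectors at \<open>\<mu> \<kappa>\<close>, one vector for each system.\<close>

definition modes :: "nat \<Rightarrow> ('q \<Rightarrow> complex^'n) set" where
  "modes \<kappa> = {w. \<forall>i. (S \<kappa> ^^ N \<kappa>) (w i) = 0}"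

definition real_modes :: "nat \<Rightarrow> ('q \<Rightarrow> complex^'n) set" where
  "real_modes \<kappa> = {w \<in> modes \<kappa>. \<forall>i. real_vec (w i)}"

definition response :: "('q \<Rightarrow> real^'n) \<Rightarrow> 'p \<Rightarrow> real \<Rightarrow> real" where
  "response \<eta> \<sigma> t = (\<Sum>i\<in>UNIV. \<eta> i \<bullet> (mexp (t *\<^sub>R A) *v B i \<sigma>))"

lemma dual_cone_response: "\<eta> \<in> dual_cone A B \<longleftrightarrow> (\<forall>\<sigma>. \<forall>t\<ge>0. 0 \<le> response \<eta> \<sigma> t)"
  by (simp add: dual_cone_def response_def)

lemma coordinates: "\<kappa> < m \<Longrightarrow> eigenspace_coordinates A (\<mu> \<kappa>) (N \<kappa>) (U \<kappa>) (D \<kappa>) (\<Lambda> \<kappa>)"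
  using bases restrictions nilpotents by unfold_locales auto

lemma real_modes_eq: "\<kappa> < m \<Longrightarrow> eigenspace_coordinates.real_modes A (\<mu> \<kappa>) (N \<kappa>) = real_modes \<kappa>"
  using eigenspace_coordinates.real_modes_def[OF coordinates] by (auto simp: real_modes_def modes_def)

lemma inj_\<mu>: "inj_on \<mu> {..<m}"
  using eigenvalues by (auto simp: ordered_eigenvalues_def bij_betw_def)

lemma Re_\<mu>_antimono: "\<kappa> \<le> \<nu> \<Longrightarrow> \<nu> < m \<Longrightarrow> Re (\<mu> \<nu>) \<le> Re (\<mu> \<kappa>)"
  using eigenvalues unfolding ordered_eigenvalues_def by (metis le_less order_refl)

lemma Re_\<mu>_strict:
  assumes "\<nu> < \<kappa>" "\<kappa> < m" "\<mu> \<nu> \<in> \<real>" "\<mu> \<kappa> \<in> \<real>"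
  shows "Re (\<mu> \<kappa>) < Re (\<mu> \<nu>)"
proof -
  have "\<mu> \<kappa> \<noteq> \<mu> \<nu>" using inj_\<mu> assms by (auto dest: inj_onD)
  then have "Re (\<mu> \<kappa>) \<noteq> Re (\<mu> \<nu>)" using assms by (auto simp: complex_is_Real_iff complex_eq_iff)
  then show ?thesis using Re_\<mu>_antimono[of \<nu> \<kappa>] assms by simp
qed

text \<open>By Farkas' lemma, an index is removed at a real eigenvalue exactly when some family witnesses it.\<close>

lemma index_set_Suc_iff:
  assumes "\<kappa> < m"
  shows "\<sigma> \<in> I (Suc \<kappa>) \<longleftrightarrow> \<sigma> \<in> I \<kappa> \<and> (\<mu> \<kappa> \<in> \<real> \<longrightarrow> \<not> (\<exists>r<N \<kappa>. \<exists>w\<in>real_modes \<kappa>.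
    (\<forall>\<sigma>'\<in>I \<kappa>. \<forall>r'<N \<kappa>. 0 \<le> Re (mom \<kappa> w \<sigma>' r')) \<and> 0 < Re (mom \<kappa> w \<sigma> r)))"
proof (cases "\<mu> \<kappa> \<in> \<real>")
  case True
  show ?thesis
    using eigenspace_coordinates.removed_indices_iff[OF coordinates[OF assms] True, of "I \<kappa>" \<sigma> B] True
    by (simp add: real_modes_eq[OF assms]) blast
qed simp

lemma flow_modes_real_modes:
  assumes "\<kappa> < m" "w \<in> real_modes \<kappa>" "\<mu> \<kappa> \<in> \<real>"
  shows "flow_modes M (\<mu> \<kappa>) (N \<kappa>) t w \<in> real_modes \<kappa>"
proof -
  have "(S \<kappa> ^^ N \<kappa>) (flow_modes M (\<mu> \<kappa>) (N \<kappa>) t w i) = 0" for i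
    using assms(2) unfolding eig_shift_flow_modes by (simp add: real_modes_def modes_def flow_modes_def)
  moreover have "real_vec (flow_modes M (\<mu> \<kappa>) (N \<kappa>) t w i)" for i
  proof -
    have "real_vec ((S \<kappa> ^^ s) (w i))" for s
      using assms by (intro real_vec_eig_shift_pow) (auto simp: real_modes_def)
    then show ?thesis
      unfolding real_vec_def flow_modes_def
      by (auto intro!: sum_in_Reals Reals_mult simp del: of_real_divide of_real_power)
  qed
  ultimately show ?thesis by (simp add: real_modes_def modes_def)
qed

text \<open>Induction over the eigenvalues in the given order, for the components \<open>W \<kappa>\<close> of \<open>\<eta>\<close>. For
\<open>\<sigma> \<in> I \<kappa>\<close> the polynomials \<open>P \<sigma> \<nu>\<close> with \<open>\<nu> < \<kappa>\<close> vanish, so a nonzero \<open>P \<sigma> \<kappa>\<close> belongs to an exponent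
of largest real part.

If \<open>\<mu> \<kappa>\<close> is nonreal, a nonzero \<open>P \<sigma> \<kappa>\<close> would require a nonzero polynomial at a real eigenvalue of
the same real part; but that one comes earlier. If \<open>\<mu> \<kappa>\<close> is real, \<open>P \<sigma> \<kappa>\<close> is zero or has a positive leading
coefficient. Moving far along the flow makes all moments nonnegative, and positive at
\<open>r = 0\<close> wherever \<open>P \<sigma> \<kappa>\<close> is not zero; so such \<open>\<sigma>\<close> are removed.

The condition at a real eigenvalue concerns real families, so it is applied to the real part of the
component. Equality of real parts is enough in the end, because \<open>\<eta>\<close> is real.\<close>

lemma criterion_imp_dual:
  assumes real: "\<And>\<kappa> w. \<kappa> < m \<Longrightarrow> \<mu> \<kappa> \<in> \<real> \<Longrightarrow> w \<in> real_modes \<kappa> \<Longrightarrow>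
      (\<forall>\<sigma>\<in>I \<kappa>. \<forall>r<N \<kappa>. 0 \<le> Re (mom \<kappa> w \<sigma> r)) \<Longrightarrow> w k = w l"
    and nonreal: "\<And>\<kappa> w. \<kappa> < m \<Longrightarrow> \<mu> \<kappa> \<notin> \<real> \<Longrightarrow> w \<in> modes \<kappa> \<Longrightarrow>
      (\<forall>\<sigma>\<in>I \<kappa>. \<forall>r<N \<kappa>. mom \<kappa> w \<sigma> r = 0) \<Longrightarrow> w k = w l"
    and \<eta>: "\<eta> \<in> dual_cone A B"
  shows "\<eta> k = \<eta> l"
proof -
  have "\<exists>w. (\<forall>\<kappa><m. (S \<kappa> ^^ N \<kappa>) (w \<kappa>) = 0) \<and> complex_vec (\<eta> i) = (\<Sum>\<kappa><m. w \<kappa>)" for i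
    using gen_eigenspace_decomposition[OF _ multiplicities bases, of "complex_vec (\<eta> i)"] eigenvalues
    unfolding ordered_eigenvalues_def by metis
  then obtain W' where W': "\<And>i \<kappa>. \<kappa> < m \<Longrightarrow> (S \<kappa> ^^ N \<kappa>) (W' i \<kappa>) = 0"
    "\<And>i. complex_vec (\<eta> i) = (\<Sum>\<kappa><m. W' i \<kappa>)" by metis
  define W where "W = (\<lambda>\<kappa> i. W' i \<kappa>)"
  have W: "\<And>\<kappa> i. \<kappa> < m \<Longrightarrow> (S \<kappa> ^^ N \<kappa>) (W \<kappa> i) = 0" "\<And>i. complex_vec (\<eta> i) = (\<Sum>\<kappa><m. W \<kappa> i)"
    using W' by (auto simp: W_def)
  define P where "P = (\<lambda>\<sigma> \<kappa>. \<Sum>r<N \<kappa>. monom (mom \<kappa> (W \<kappa>) \<sigma> r / fact r) r)"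
  have coeffP: "coeff (P \<sigma> \<kappa>) r = (if r < N \<kappa> then mom \<kappa> (W \<kappa>) \<sigma> r / fact r else 0)" for \<sigma> \<kappa> r
    by (simp add: P_def coeff_sum)
  have expand: "complex_of_real (response \<eta> \<sigma> t) =
      (\<Sum>\<kappa><m. exp (cnj (\<mu> \<kappa>) * of_real t) * poly (P \<sigma> \<kappa>) (of_real t))" for \<sigma> t
  proof -
    have "complex_of_real (response \<eta> \<sigma> t) = (\<Sum>i\<in>UNIV. cdot (complex_vec (\<eta> i)) (mexp (t *\<^sub>R A) *v B i \<sigma>))"
      by (simp add: response_def complex_vec_def cdot_of_real)
    also have "\<dots> = (\<Sum>\<kappa><m. \<Sum>i\<in>UNIV. cdot (W \<kappa> i) (mexp (t *\<^sub>R A) *v B i \<sigma>))"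
      unfolding W(2) cdot_sum_left by (rule sum.swap)
    also have "\<dots> = (\<Sum>\<kappa><m. exp (cnj (\<mu> \<kappa>) * of_real t) * poly (P \<sigma> \<kappa>) (of_real t))"
    proof (intro sum.cong refl)
      fix \<kappa> assume "\<kappa> \<in> {..<m}"
      then have "(\<Sum>i\<in>UNIV. cdot (W \<kappa> i) (mexp (t *\<^sub>R A) *v B i \<sigma>)) = exp (cnj (\<mu> \<kappa>) * of_real t) *
          (\<Sum>r<N \<kappa>. of_real (t ^ r / fact r) * mom \<kappa> (W \<kappa>) \<sigma> r)"
        by (intro moment_flow_mode W(1)) simp
      also have "(\<Sum>r<N \<kappa>. of_real (t ^ r / fact r) * mom \<kappa> (W \<kappa>) \<sigma> r) = poly (P \<sigma> \<kappa>) (of_real t)"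
        by (simp add: P_def poly_sum poly_monom mult_ac)
      finally show "(\<Sum>i\<in>UNIV. cdot (W \<kappa> i) (mexp (t *\<^sub>R A) *v B i \<sigma>)) =
          exp (cnj (\<mu> \<kappa>) * of_real t) * poly (P \<sigma> \<kappa>) (of_real t)" .
    qed
    finally show ?thesis .
  qed
  have dominant: "\<exists>j<m. \<mu> j = of_real (Re (\<mu> \<kappa>)) \<and> lead_coeff (P \<sigma> j) \<in> \<real> \<and> 0 < Re (lead_coeff (P \<sigma> j))"
    if \<kappa>: "\<kappa> < m" and nz: "P \<sigma> \<kappa> \<noteq> 0" and lower: "\<forall>\<nu><\<kappa>. P \<sigma> \<nu> = 0" for \<sigma> \<kappa>
  proof -
    have "\<exists>j\<in>{..<m}. cnj (\<mu> j) = of_real (Re (cnj (\<mu> \<kappa>))) \<and> lead_coeff (P \<sigma> j) \<in> \<real> \<and> 0 < Re (lead_coeff (P \<sigma> j))"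
    proof (rule nonneg_exp_poly_dominant_real[where f = "response \<eta> \<sigma>"])
      show "inj_on (\<lambda>j. cnj (\<mu> j)) {..<m}" using inj_\<mu> by (auto simp: inj_on_def)
      show "0 \<le> response \<eta> \<sigma> t" if "0 \<le> t" for t using \<eta> that by (simp add: dual_cone_response)
      fix j assume "j \<in> {..<m}" "P \<sigma> j \<noteq> 0"
      then show "Re (cnj (\<mu> j)) \<le> Re (cnj (\<mu> \<kappa>))"
        using lower Re_\<mu>_antimono[of \<kappa> j] by (cases "j < \<kappa>") (auto simp: not_less)
    qed (use \<kappa> nz expand in auto)
    then show ?thesis by (auto simp: complex_eq_iff)
  qed
  have induct: "\<kappa> \<le> m \<Longrightarrow> (\<forall>\<sigma>\<in>I \<kappa>. \<forall>\<nu><\<kappa>. P \<sigma> \<nu> = 0) \<and> (\<forall>\<nu><\<kappa>. Re_vec (W \<nu> k) = Re_vec (W \<nu> l))" for \<kappa>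
  proof (induction \<kappa>)
    case (Suc \<kappa>)
    then have \<kappa>: "\<kappa> < m" and IH: "\<forall>\<sigma>\<in>I \<kappa>. \<forall>\<nu><\<kappa>. P \<sigma> \<nu> = 0" "\<forall>\<nu><\<kappa>. Re_vec (W \<nu> k) = Re_vec (W \<nu> l)"
      by auto
    have "(\<forall>\<sigma>\<in>I (Suc \<kappa>). P \<sigma> \<kappa> = 0) \<and> Re_vec (W \<kappa> k) = Re_vec (W \<kappa> l)"
    proof (cases "\<mu> \<kappa> \<in> \<real>")
      case False
      have P0: "P \<sigma> \<kappa> = 0" if \<sigma>: "\<sigma> \<in> I \<kappa>" for \<sigma>
      proof (rule ccontr)
        assume "P \<sigma> \<kappa> \<noteq> 0"
        then obtain j where j: "j < m" "\<mu> j = of_real (Re (\<mu> \<kappa>))" "0 < Re (lead_coeff (P \<sigma> j))"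
          using dominant[OF \<kappa>] IH(1) \<sigma> by blast
        then have "\<mu> j \<in> \<real>" by simp
        then have "j \<noteq> \<kappa>" using False by auto
        then have "j < \<kappa>"
          using eigenvalues j(1,2) \<kappa> unfolding ordered_eigenvalues_def by metis
        then have "P \<sigma> j = 0" using IH(1) \<sigma> by blast
        with j(3) show False by simp
      qed
      have "mom \<kappa> (W \<kappa>) \<sigma> r = 0" if "\<sigma> \<in> I \<kappa>" "r < N \<kappa>" for \<sigma> r
        using coeffP[of \<sigma> \<kappa> r] P0[OF that(1)] that(2) by simp
      then have "W \<kappa> k = W \<kappa> l"
        using W(1)[OF \<kappa>] by (intro nonreal[OF \<kappa> False]) (auto simp: modes_def)
      moreover have "I (Suc \<kappa>) = I \<kappa>" using False by simp
      ultimately show ?thesis using P0 by simp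
    next
      case True
      define a where "a = (\<lambda>\<sigma> r. Re (mom \<kappa> (W \<kappa>) \<sigma> r))"
      define w where "w = (\<lambda>i. complex_vec (Re_vec (W \<kappa> i)))"
      define wt where "wt = (\<lambda>t. flow_modes M (\<mu> \<kappa>) (N \<kappa>) t w)"
      have w: "w \<in> real_modes \<kappa>"
      proof -
        have "(S \<kappa> ^^ N \<kappa>) (w i) = 0" for i
          unfolding w_def eig_shift_pow_Re[OF True] W(1)[OF \<kappa>]
          by (simp add: Re_vec_def complex_vec_def vec_eq_iff)
        moreover have "real_vec (w i)" for i by (simp add: w_def complex_vec_def real_vec_def)
        ultimately show ?thesis by (simp add: real_modes_def modes_def)
      qed
      have wt: "wt t \<in> real_modes \<kappa>" for t unfolding wt_def by (rule flow_modes_real_modes[OF \<kappa> w True])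
      have a0: "a \<sigma> r = 0" if "N \<kappa> \<le> r" for \<sigma> r
      proof -
        have "mom \<kappa> (W \<kappa>) \<sigma> r = 0" by (rule moment_zero[OF W(1)[OF \<kappa>] that])
        then show ?thesis by (simp add: a_def)
      qed
      have momt: "Re (mom \<kappa> (wt t) \<sigma> r) = (\<Sum>s<N \<kappa>. t ^ s / fact s * a \<sigma> (r + s))" for t \<sigma> r
      proof -
        have "mom \<kappa> w \<sigma> r = of_real (a \<sigma> r)" for r
          unfolding w_def a_def by (rule moment_Re[OF True])
        then have "mom \<kappa> (wt t) \<sigma> r = of_real (\<Sum>s<N \<kappa>. t ^ s / fact s * a \<sigma> (r + s))"
          unfolding wt_def moment_flow_modes by simp
        then show ?thesis by (simp only: Re_complex_of_real)
      qed
      \<comment> \<open>Moving along the flow makes all derivatives of the leading polynomial nonnegative.\<close>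
      have ev: "\<forall>\<^sub>F t in at_top. (\<forall>r. 0 \<le> Re (mom \<kappa> (wt t) \<sigma> r)) \<and> (P \<sigma> \<kappa> \<noteq> 0 \<longrightarrow> 0 < N \<kappa> \<and> 0 < Re (mom \<kappa> (wt t) \<sigma> 0))"
        if \<sigma>: "\<sigma> \<in> I \<kappa>" for \<sigma>
      proof (cases "P \<sigma> \<kappa> = 0")
        case P0: True
        have "a \<sigma> r = 0" for r
          using coeffP[of \<sigma> \<kappa> r] P0 a0[of r \<sigma>] by (cases "r < N \<kappa>") (auto simp: a_def)
        then show ?thesis using P0 by (simp add: momt)
      next
        case P0: False
        obtain j where j: "j < m" "\<mu> j = of_real (Re (\<mu> \<kappa>))" "0 < Re (lead_coeff (P \<sigma> j))"
          using dominant[OF \<kappa> P0] IH(1) \<sigma> by blast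
        have "\<mu> j = \<mu> \<kappa>" using j(2) True by (simp add: complex_is_Real_iff complex_eq_iff)
        then have "j = \<kappa>" using inj_\<mu> j(1) \<kappa> by (auto dest: inj_onD)
        define d where "d = degree (P \<sigma> \<kappa>)"
        have pos: "0 < Re (coeff (P \<sigma> \<kappa>) d)" using j(3) \<open>j = \<kappa>\<close> by (simp add: d_def)
        have dN: "d < N \<kappa>" using pos by (auto simp: coeffP split: if_splits)
        have "Re (x / fact d) = Re x / fact d" for x
          by (metis Re_divide_of_real of_real_fact)
        then have "0 < a \<sigma> d" using pos dN by (simp add: coeffP a_def zero_less_divide_iff)
        moreover have "a \<sigma> r = 0" if "d < r" for r
          using coeffP[of \<sigma> \<kappa> r] coeff_eq_0[of "P \<sigma> \<kappa>" r] that a0[of r \<sigma>]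
          by (cases "r < N \<kappa>") (auto simp: a_def d_def)
        ultimately show ?thesis
          using eventually_flow_nonneg[of "a \<sigma>" d "N \<kappa>"] dN
          by (auto simp: momt elim!: eventually_mono)
      qed
      have "\<forall>\<^sub>F t in at_top. \<forall>\<sigma>\<in>I \<kappa>. (\<forall>r. 0 \<le> Re (mom \<kappa> (wt t) \<sigma> r)) \<and>
          (P \<sigma> \<kappa> \<noteq> 0 \<longrightarrow> 0 < N \<kappa> \<and> 0 < Re (mom \<kappa> (wt t) \<sigma> 0))"
        using ev by (intro eventually_ball_finite) auto
      then obtain t where t: "\<And>\<sigma> r. \<sigma> \<in> I \<kappa> \<Longrightarrow> 0 \<le> Re (mom \<kappa> (wt t) \<sigma> r)"
        "\<And>\<sigma>. \<sigma> \<in> I \<kappa> \<Longrightarrow> P \<sigma> \<kappa> \<noteq> 0 \<Longrightarrow> 0 < N \<kappa> \<and> 0 < Re (mom \<kappa> (wt t) \<sigma> 0)"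
        using eventually_happens[of _ "at_top :: real filter"] by force
      have "P \<sigma> \<kappa> = 0" if "\<sigma> \<in> I (Suc \<kappa>)" for \<sigma>
        using that t wt[of t] True unfolding index_set_Suc_iff[OF \<kappa>] by blast
      moreover have "Re_vec (W \<kappa> k) = Re_vec (W \<kappa> l)"
      proof -
        have eq: "wt t k = wt t l" using t(1) by (intro real[OF \<kappa> True wt]) auto
        have "w k - w l = 0"
        proof (cases "0 < N \<kappa>")
          case True
          have "(S \<kappa> ^^ N \<kappa>) (w k - w l) = 0"
            using w by (simp add: eig_shift_pow_diff real_modes_def modes_def)
          then show ?thesis
          proof (rule flow_modes_injective[OF _ True])
            show "(\<Sum>s<N \<kappa>. of_real (t ^ s / fact s) *s (S \<kappa> ^^ s) (w k - w l)) = 0"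
              using eq by (simp add: wt_def flow_modes_def eig_shift_pow_diff vector_ssub_ldistrib sum_subtractf)
          qed
        next
          case False
          then show ?thesis using w by (simp add: real_modes_def modes_def)
        qed
        then show ?thesis by (simp add: w_def complex_vec_def vec_eq_iff)
      qed
      ultimately show ?thesis by blast
    qed
    moreover have "I (Suc \<kappa>) \<subseteq> I \<kappa>" by auto
    ultimately show ?case using IH by (auto simp: less_Suc_eq simp del: index_set.simps)
  qed simp
  have "\<eta> i = (\<Sum>\<kappa><m. Re_vec (W \<kappa> i))" for i
  proof -
    have "\<eta> i = Re_vec (complex_vec (\<eta> i))" by (simp add: Re_vec_def complex_vec_def vec_eq_iff)
    then show ?thesis by (simp add: W(2) Re_vec_def vec_eq_iff)
  qed
  then show ?thesis using induct[of m] by simp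
qed

lemma response_add: "response (\<lambda>i. \<eta> i + \<zeta> i) \<sigma> t = response \<eta> \<sigma> t + response \<zeta> \<sigma> t"
  by (simp add: response_def inner_add_left sum.distrib)

lemma response_scaleR: "response (\<lambda>i. c *\<^sub>R \<eta> i) \<sigma> t = c * response \<eta> \<sigma> t"
  by (simp add: response_def sum_distrib_left)

abbreviation "Re_response w \<equiv> response (\<lambda>i. Re_vec (w i))"

lemma response_real_mode:
  assumes "w \<in> modes \<kappa>" "\<mu> \<kappa> \<in> \<real>"
  shows "Re_response w \<sigma> t =
    exp (Re (\<mu> \<kappa>) * t) * (\<Sum>r<N \<kappa>. t ^ r / fact r * Re (mom \<kappa> w \<sigma> r))"
  unfolding response_def using assms by (intro Re_flow_mode_real) (auto simp: modes_def)

lemma response_growth: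
  assumes "w \<in> modes \<kappa>" "Re (\<mu> \<kappa>) < a"
  shows "\<exists>C. \<forall>t\<ge>0. \<bar>Re_response w \<sigma> t\<bar> \<le> C * exp (a * t)"
  unfolding response_def using assms by (intro flow_mode_growth) (auto simp: modes_def)

lemma mode_in_gen_eigenspace: "w \<in> modes \<kappa> \<Longrightarrow> w i \<in> gen_eigenspace M (\<mu> \<kappa>)"
  by (auto simp: modes_def gen_eigenspace_def)

text \<open>Each index removed at \<open>\<kappa>\<close> has a witness with a positive moment; their sum \<open>u\<close> serves all
removed indices. Its response may still vanish at \<open>t = 0\<close>, which one unit of time along the
flow repairs.\<close>

lemma dominating_mode:
  assumes \<kappa>: "\<kappa> < m" and real: "\<mu> \<kappa> \<in> \<real>"
  obtains w c where "w \<in> real_modes \<kappa>" "0 < c"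
    "\<And>\<sigma> t. \<sigma> \<in> I \<kappa> \<Longrightarrow> 0 \<le> t \<Longrightarrow> 0 \<le> Re_response w \<sigma> t"
    "\<And>\<sigma> t. \<sigma> \<in> I \<kappa> \<Longrightarrow> \<sigma> \<notin> I (Suc \<kappa>) \<Longrightarrow> 0 \<le> t \<Longrightarrow> c * exp (Re (\<mu> \<kappa>) * t) \<le> Re_response w \<sigma> t"
proof -
  define R where "R = I \<kappa> - I (Suc \<kappa>)"
  have "\<exists>w\<in>real_modes \<kappa>. (\<forall>\<sigma>'\<in>I \<kappa>. \<forall>r'<N \<kappa>. 0 \<le> Re (mom \<kappa> w \<sigma>' r')) \<and> (\<exists>r<N \<kappa>. 0 < Re (mom \<kappa> w \<sigma> r))"
    if "\<sigma> \<in> R" for \<sigma>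
    using that index_set_Suc_iff[OF \<kappa>, of \<sigma>] unfolding R_def by blast
  then obtain v where v: "\<And>\<sigma>. \<sigma> \<in> R \<Longrightarrow> v \<sigma> \<in> real_modes \<kappa>"
    "\<And>\<sigma> \<sigma>' r. \<sigma> \<in> R \<Longrightarrow> \<sigma>' \<in> I \<kappa> \<Longrightarrow> r < N \<kappa> \<Longrightarrow> 0 \<le> Re (mom \<kappa> (v \<sigma>) \<sigma>' r)"
    "\<And>\<sigma>. \<sigma> \<in> R \<Longrightarrow> \<exists>r<N \<kappa>. 0 < Re (mom \<kappa> (v \<sigma>) \<sigma> r)"
    by metis
  define u where "u = (\<lambda>i. \<Sum>\<sigma>\<in>R. v \<sigma> i)"
  have u: "u \<in> real_modes \<kappa>"
    using v(1) by (auto simp: u_def real_modes_def modes_def eig_shift_pow_sum real_vec_def intro!: sum_in_Reals)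
  have momu: "mom \<kappa> u \<sigma> r = (\<Sum>\<tau>\<in>R. mom \<kappa> (v \<tau>) \<sigma> r)" for \<sigma> r
    unfolding u_def by (rule moment_sum)
  have u_nonneg: "0 \<le> Re (mom \<kappa> u \<sigma> r)" if "\<sigma> \<in> I \<kappa>" for \<sigma> r
  proof (cases "r < N \<kappa>")
    case True
    then show ?thesis using v(2) that by (simp add: momu sum_nonneg)
  next
    case False
    then have "mom \<kappa> u \<sigma> r = 0"
      using u by (intro moment_zero[where d = "N \<kappa>"]) (auto simp: real_modes_def modes_def)
    then show ?thesis by simp
  qed
  have u_pos: "\<exists>r<N \<kappa>. 0 < Re (mom \<kappa> u \<sigma> r)" if \<sigma>: "\<sigma> \<in> R" for \<sigma>
  proof -
    obtain r where r: "r < N \<kappa>" "0 < Re (mom \<kappa> (v \<sigma>) \<sigma> r)" using v(3)[OF \<sigma>] by blast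
    have "Re (mom \<kappa> (v \<sigma>) \<sigma> r) \<le> (\<Sum>\<tau>\<in>R. Re (mom \<kappa> (v \<tau>) \<sigma> r))"
      using \<sigma> r(1) v(2) by (intro member_le_sum) (auto simp: R_def)
    with r show ?thesis by (auto simp: momu)
  qed
  \<comment> \<open>Moving along the flow for one unit of time makes the constant terms positive.\<close>
  define w where "w = flow_modes M (\<mu> \<kappa>) (N \<kappa>) 1 u"
  have w: "w \<in> real_modes \<kappa>" unfolding w_def by (rule flow_modes_real_modes[OF \<kappa> u real])
  have momw: "Re (mom \<kappa> w \<sigma> r) = (\<Sum>s<N \<kappa>. Re (mom \<kappa> u \<sigma> (r + s)) / fact s)" for \<sigma> r
  proof -
    have "mom \<kappa> w \<sigma> r = (\<Sum>s<N \<kappa>. of_real (1 / fact s) * mom \<kappa> u \<sigma> (r + s))"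
      unfolding w_def moment_flow_modes by simp
    moreover have "Re (of_real c * x) = c * Re x" for c x by simp
    ultimately show ?thesis by (simp only: Re_sum) simp
  qed
  have w_nonneg: "0 \<le> Re (mom \<kappa> w \<sigma> r)" if "\<sigma> \<in> I \<kappa>" for \<sigma> r
    using u_nonneg[OF that] by (simp add: momw sum_nonneg)
  have w_pos: "0 < Re (mom \<kappa> w \<sigma> 0)" if \<sigma>: "\<sigma> \<in> R" for \<sigma>
  proof -
    obtain r where r: "r < N \<kappa>" "0 < Re (mom \<kappa> u \<sigma> r)" using u_pos[OF \<sigma>] by blast
    have "0 < Re (mom \<kappa> u \<sigma> r) / fact r" using r(2) by simp
    also have "\<dots> \<le> Re (mom \<kappa> w \<sigma> 0)"
      unfolding momw using r(1) \<sigma> u_nonneg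
      by (simp add: R_def) (rule member_le_sum[of r "{..<N \<kappa>}" "\<lambda>s. Re (mom \<kappa> u \<sigma> s) / fact s"], auto)
    finally show ?thesis .
  qed
  have resp: "exp (Re (\<mu> \<kappa>) * t) * Re (mom \<kappa> w \<sigma> 0) \<le> Re_response w \<sigma> t"
    if \<sigma>: "\<sigma> \<in> I \<kappa>" and t: "0 \<le> t" for \<sigma> t
  proof -
    have "Re (mom \<kappa> w \<sigma> 0) \<le> (\<Sum>r<N \<kappa>. t ^ r / fact r * Re (mom \<kappa> w \<sigma> r))"
    proof (cases "N \<kappa>")
      case 0
      then show ?thesis using momw[of \<sigma> 0] by simp
    next
      case (Suc n)
      then have "t ^ 0 / fact 0 * Re (mom \<kappa> w \<sigma> 0) \<le> (\<Sum>r<N \<kappa>. t ^ r / fact r * Re (mom \<kappa> w \<sigma> r))"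
        using t w_nonneg[OF \<sigma>] by (intro member_le_sum[where f = "\<lambda>r. t ^ r / fact r * Re (mom \<kappa> w \<sigma> r)"]) auto
      then show ?thesis by simp
    qed
    then show ?thesis
      using response_real_mode[of w \<kappa> \<sigma> t] w real by (simp add: real_modes_def)
  qed
  obtain c where c: "0 < c" "\<And>\<sigma>. \<sigma> \<in> R \<Longrightarrow> c \<le> Re (mom \<kappa> w \<sigma> 0)"
  proof (cases "R = {}")
    case False
    show ?thesis
    proof (rule that)
      show "0 < Min ((\<lambda>\<sigma>. Re (mom \<kappa> w \<sigma> 0)) ` R)" using False w_pos by (subst Min_gr_iff) auto
    qed simp
  qed (use that[of 1] in auto)
  show ?thesis
  proof (rule that[OF w c(1)])
    fix \<sigma> and t :: real assume \<sigma>: "\<sigma> \<in> I \<kappa>" and t: "0 \<le> t"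
    have "0 \<le> exp (Re (\<mu> \<kappa>) * t) * Re (mom \<kappa> w \<sigma> 0)" using w_nonneg[OF \<sigma>] by simp
    also have "\<dots> \<le> Re_response w \<sigma> t" by (rule resp[OF \<sigma> t])
    finally show "0 \<le> Re_response w \<sigma> t" .
    assume "\<sigma> \<notin> I (Suc \<kappa>)"
    then have "c \<le> Re (mom \<kappa> w \<sigma> 0)" using c(2)[of \<sigma>] \<sigma> by (simp add: R_def)
    then have "c * exp (Re (\<mu> \<kappa>) * t) \<le> exp (Re (\<mu> \<kappa>) * t) * Re (mom \<kappa> w \<sigma> 0)" by (simp add: mult.commute)
    also have "\<dots> \<le> Re_response w \<sigma> t" by (rule resp[OF \<sigma> t])
    finally show "c * exp (Re (\<mu> \<kappa>) * t) \<le> Re_response w \<sigma> t" .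
  qed
qed

abbreviation "real_eigenvalues_below \<kappa> \<equiv> \<mu> ` {\<nu>. \<nu> < \<kappa> \<and> \<mu> \<nu> \<in> \<real>}"

text \<open>Induction on \<open>\<kappa>\<close> with \<open>h\<close> arbitrary, from the last real eigenvalue down to the first. At a real
\<open>\<mu> \<kappa>\<close>, the indices removed there have \<open>h\<close> bounded by a multiple of the exponential at rate
\<open>\<mu> \<kappa>\<close>, and a large multiple of the
dominating family outweighs it; this keeps the remaining responses nonnegative, and grows more
slowly than the exponentials of earlier real eigenvalues.\<close>

lemma compensation:
  assumes "\<kappa> \<le> m" "\<And>\<sigma> t. \<sigma> \<in> I \<kappa> \<Longrightarrow> 0 \<le> t \<Longrightarrow> 0 \<le> h \<sigma> t"
    and "\<And>\<nu> \<sigma>. \<nu> < \<kappa> \<Longrightarrow> \<mu> \<nu> \<in> \<real> \<Longrightarrow> \<exists>C. \<forall>t\<ge>0. \<bar>h \<sigma> t\<bar> \<le> C * exp (Re (\<mu> \<nu>) * t)"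
  shows "\<exists>\<eta>. (\<forall>i. complex_vec (\<eta> i) \<in> gen_eigenspace_sum M (real_eigenvalues_below \<kappa>)) \<and>
    (\<forall>\<sigma>. \<forall>t\<ge>0. 0 \<le> response \<eta> \<sigma> t + h \<sigma> t)"
  using assms
proof (induction \<kappa> arbitrary: h)
  case 0
  then show ?case
    by (intro exI[of _ "\<lambda>_. 0"]) (simp add: complex_vec_zero gen_eigenspace_sum_zero response_def)
next
  case (Suc \<kappa>)
  then have \<kappa>: "\<kappa> < m" by simp
  show ?case
  proof (cases "\<mu> \<kappa> \<in> \<real>")
    case False
    then have "real_eigenvalues_below (Suc \<kappa>) = real_eigenvalues_below \<kappa>" by (auto simp: less_Suc_eq)
    moreover have "I (Suc \<kappa>) = I \<kappa>" using False by simp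
    ultimately show ?thesis using Suc.IH[of h] Suc.prems \<kappa> by (auto simp del: index_set.simps)
  next
    case True
    obtain w c where w: "w \<in> real_modes \<kappa>" and c: "0 < c"
      and nonneg: "\<And>\<sigma> t. \<sigma> \<in> I \<kappa> \<Longrightarrow> 0 \<le> t \<Longrightarrow> 0 \<le> Re_response w \<sigma> t"
      and pos: "\<And>\<sigma> t. \<sigma> \<in> I \<kappa> \<Longrightarrow> \<sigma> \<notin> I (Suc \<kappa>) \<Longrightarrow> 0 \<le> t \<Longrightarrow> c * exp (Re (\<mu> \<kappa>) * t) \<le> Re_response w \<sigma> t"
      using dominating_mode[OF \<kappa> True] by blast
    have "\<exists>C. \<forall>t\<ge>0. \<bar>h \<sigma> t\<bar> \<le> C * exp (Re (\<mu> \<kappa>) * t)" for \<sigma>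
      using Suc.prems(3)[of \<kappa> \<sigma>] True by simp
    then obtain C where C: "\<And>\<sigma> t. 0 \<le> t \<Longrightarrow> \<bar>h \<sigma> t\<bar> \<le> C \<sigma> * exp (Re (\<mu> \<kappa>) * t)" by metis
    \<comment> \<open>One multiple for all removed indices: the sum of the growth constants bounds each of them.\<close>
    define Q where "Q = (\<Sum>\<sigma>\<in>UNIV. \<bar>C \<sigma>\<bar>) / c"
    have Q: "0 \<le> Q" using c by (simp add: Q_def sum_nonneg)
    have CQ: "C \<sigma> \<le> Q * c" for \<sigma>
    proof -
      have "C \<sigma> \<le> \<bar>C \<sigma>\<bar>" by simp
      also have "\<dots> \<le> (\<Sum>\<sigma>\<in>UNIV. \<bar>C \<sigma>\<bar>)" by (intro member_le_sum) auto
      finally show ?thesis using c by (simp add: Q_def)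
    qed
    define h' where "h' = (\<lambda>\<sigma> t. Q * Re_response w \<sigma> t + h \<sigma> t)"
    have h'_nonneg: "0 \<le> h' \<sigma> t" if \<sigma>: "\<sigma> \<in> I \<kappa>" and t: "0 \<le> t" for \<sigma> t
    proof (cases "\<sigma> \<in> I (Suc \<kappa>)")
      case True
      then show ?thesis using Suc.prems(2)[OF True t] nonneg[OF \<sigma> t] Q by (simp add: h'_def)
    next
      case False
      have "- h \<sigma> t \<le> C \<sigma> * exp (Re (\<mu> \<kappa>) * t)" using C[OF t, of \<sigma>] by linarith
      also have "\<dots> \<le> Q * c * exp (Re (\<mu> \<kappa>) * t)" using CQ by (intro mult_right_mono) auto
      also have "\<dots> = Q * (c * exp (Re (\<mu> \<kappa>) * t))" by simp
      also have "\<dots> \<le> Q * Re_response w \<sigma> t" by (intro mult_left_mono pos[OF \<sigma> False t] Q)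
      finally show ?thesis by (simp add: h'_def)
    qed
    have h'_growth: "\<exists>C. \<forall>t\<ge>0. \<bar>h' \<sigma> t\<bar> \<le> C * exp (Re (\<mu> \<nu>) * t)" if \<nu>: "\<nu> < \<kappa>" "\<mu> \<nu> \<in> \<real>" for \<nu> \<sigma>
    proof -
      obtain C1 where C1: "\<forall>t\<ge>0. \<bar>h \<sigma> t\<bar> \<le> C1 * exp (Re (\<mu> \<nu>) * t)"
        using Suc.prems(3)[of \<nu> \<sigma>] \<nu> by auto
      obtain C2 where C2: "\<forall>t\<ge>0. \<bar>Re_response w \<sigma> t\<bar> \<le> C2 * exp (Re (\<mu> \<nu>) * t)"
        using response_growth[of w \<kappa> "Re (\<mu> \<nu>)" \<sigma>] w Re_\<mu>_strict[OF \<nu>(1) \<kappa> \<nu>(2) True]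
        by (auto simp: real_modes_def)
      have "\<bar>h' \<sigma> t\<bar> \<le> (Q * C2 + C1) * exp (Re (\<mu> \<nu>) * t)" if t: "0 \<le> t" for t
      proof -
        have "\<bar>h' \<sigma> t\<bar> \<le> Q * \<bar>Re_response w \<sigma> t\<bar> + \<bar>h \<sigma> t\<bar>"
          unfolding h'_def using abs_triangle_ineq[of "Q * Re_response w \<sigma> t" "h \<sigma> t"] Q
          by (simp add: abs_mult)
        also have "\<dots> \<le> Q * (C2 * exp (Re (\<mu> \<nu>) * t)) + C1 * exp (Re (\<mu> \<nu>) * t)"
          using C1 C2 t Q by (intro add_mono mult_left_mono) auto
        finally show ?thesis by (simp add: algebra_simps)
      qed
      then show ?thesis by blast
    qed
    obtain \<eta> where \<eta>: "\<And>i. complex_vec (\<eta> i) \<in> gen_eigenspace_sum M (real_eigenvalues_below \<kappa>)"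
      "\<And>\<sigma> t. 0 \<le> t \<Longrightarrow> 0 \<le> response \<eta> \<sigma> t + h' \<sigma> t"
      using Suc.IH[of h'] \<kappa> h'_nonneg h'_growth by fastforce
    define \<zeta> where "\<zeta> = (\<lambda>i. \<eta> i + Q *\<^sub>R Re_vec (w i))"
    have "complex_vec (\<zeta> i) \<in> gen_eigenspace_sum M (real_eigenvalues_below (Suc \<kappa>))" for i
    proof -
      have "complex_vec (\<zeta> i) = complex_vec (\<eta> i) + of_real Q *s w i"
        using w by (simp add: \<zeta>_def complex_vec_add complex_vec_scaleR complex_vec_Re_vec real_modes_def)
      moreover have "w i \<in> gen_eigenspace_sum M (real_eigenvalues_below (Suc \<kappa>))"
        using w True mode_in_gen_eigenspace[of w \<kappa> i]
        by (intro gen_eigenspace_sum_member[of _ "\<mu> \<kappa>"]) (auto simp: real_modes_def)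
      moreover have "complex_vec (\<eta> i) \<in> gen_eigenspace_sum M (real_eigenvalues_below (Suc \<kappa>))"
        using gen_eigenspace_sum_mono[of "real_eigenvalues_below (Suc \<kappa>)" "real_eigenvalues_below \<kappa>" "M"] \<eta>(1)[of i]
        by fastforce
      ultimately show ?thesis by (simp add: gen_eigenspace_sum_add gen_eigenspace_sum_scale)
    qed
    moreover have "0 \<le> response \<zeta> \<sigma> t + h \<sigma> t" if "0 \<le> t" for \<sigma> t
      using \<eta>(2)[OF that, of \<sigma>] by (simp add: \<zeta>_def response_add response_scaleR h'_def)
    ultimately show ?thesis by blast
  qed
qed

lemma compensated_difference:
  assumes dual: "\<And>\<eta>. \<eta> \<in> dual_cone A B \<Longrightarrow> \<eta> k = \<eta> l" and "\<kappa> < m"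
    and "\<And>\<sigma> t. \<sigma> \<in> I \<kappa> \<Longrightarrow> 0 \<le> t \<Longrightarrow> 0 \<le> Re_response w \<sigma> t"
    and "\<And>\<nu> \<sigma>. \<nu> < \<kappa> \<Longrightarrow> \<mu> \<nu> \<in> \<real> \<Longrightarrow>
      \<exists>C. \<forall>t\<ge>0. \<bar>Re_response w \<sigma> t\<bar> \<le> C * exp (Re (\<mu> \<nu>) * t)"
  shows "complex_vec (Re_vec (w k - w l)) \<in> gen_eigenspace_sum M (real_eigenvalues_below \<kappa>)"
proof -
  obtain \<eta> where \<eta>: "\<And>i. complex_vec (\<eta> i) \<in> gen_eigenspace_sum M (real_eigenvalues_below \<kappa>)"
    "\<And>\<sigma> t. 0 \<le> t \<Longrightarrow> 0 \<le> response \<eta> \<sigma> t + Re_response w \<sigma> t"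
    using compensation[of \<kappa> "Re_response w"] assms(2-4) by fastforce
  have "(\<lambda>i. \<eta> i + Re_vec (w i)) \<in> dual_cone A B"
    using \<eta>(2) by (simp add: dual_cone_response response_add)
  then have "\<eta> k + Re_vec (w k) = \<eta> l + Re_vec (w l)" by (rule dual)
  then have "Re_vec (w k - w l) = \<eta> l - \<eta> k"
    by (simp add: Re_vec_def vec_eq_iff algebra_simps)
  then show ?thesis using \<eta>(1) by (simp add: complex_vec_diff gen_eigenspace_sum_diff)
qed

text \<open>The compensated family lies in the dual cone, so it takes the same value at \<open>k\<close> and \<open>l\<close>. The
difference \<open>w k - w l\<close> then lies in the generalized eigenspaces of the real eigenvalues before
\<open>\<kappa>\<close>, and these meet the one at \<open>\<kappa>\<close> only in zero.\<close>

lemma dual_imp_criterion_real: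
  assumes dual: "\<And>\<eta>. \<eta> \<in> dual_cone A B \<Longrightarrow> \<eta> k = \<eta> l"
    and \<kappa>: "\<kappa> < m" "\<mu> \<kappa> \<in> \<real>" and w: "w \<in> real_modes \<kappa>"
    and nonneg: "\<forall>\<sigma>\<in>I \<kappa>. \<forall>r<N \<kappa>. 0 \<le> Re (mom \<kappa> w \<sigma> r)"
  shows "w k = w l"
proof -
  have mode: "w \<in> modes \<kappa>" using w by (simp add: real_modes_def)
  have "complex_vec (Re_vec (w k - w l)) \<in> gen_eigenspace_sum M (real_eigenvalues_below \<kappa>)"
  proof (rule compensated_difference[OF dual \<kappa>(1)])
    show "0 \<le> Re_response w \<sigma> t" if "\<sigma> \<in> I \<kappa>" "0 \<le> t" for \<sigma> t
      unfolding response_real_mode[OF mode \<kappa>(2)]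
      using nonneg that by (intro mult_nonneg_nonneg sum_nonneg) auto
    show "\<exists>C. \<forall>t\<ge>0. \<bar>Re_response w \<sigma> t\<bar> \<le> C * exp (Re (\<mu> \<nu>) * t)"
      if "\<nu> < \<kappa>" "\<mu> \<nu> \<in> \<real>" for \<nu> \<sigma>
      using that \<kappa> by (intro response_growth[OF mode] Re_\<mu>_strict)
  qed
  moreover have "real_vec (w k - w l)"
    using w by (auto simp: real_modes_def real_vec_def)
  ultimately have "w k - w l \<in> gen_eigenspace_sum M (real_eigenvalues_below \<kappa>)"
    by (simp add: complex_vec_Re_vec)
  moreover have "w k - w l \<in> gen_eigenspace M (\<mu> \<kappa>)"
    using mode by (auto simp: gen_eigenspace_def modes_def eig_shift_pow_diff intro!: exI[of _ "N \<kappa>"])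
  moreover have "\<mu> \<kappa> \<notin> real_eigenvalues_below \<kappa>"
    using inj_\<mu> \<kappa>(1) by (auto dest: inj_onD)
  ultimately have "w k - w l = 0"
    by (intro gen_eigenspace_sum_disjoint[of "real_eigenvalues_below \<kappa>"]) auto
  then show ?thesis by simp
qed

text \<open>Here the real part of the family is compensated. Its difference between \<open>k\<close> and \<open>l\<close> has one
component at \<open>\<mu> \<kappa>\<close> and one at the conjugate eigenvalue, and both differ from all real eigenvalues.\<close>

lemma dual_imp_criterion_nonreal:
  assumes dual: "\<And>\<eta>. \<eta> \<in> dual_cone A B \<Longrightarrow> \<eta> k = \<eta> l"
    and \<kappa>: "\<kappa> < m" "\<mu> \<kappa> \<notin> \<real>" and w: "w \<in> modes \<kappa>"
    and semisimple: "(\<exists>\<nu><m. complex_of_real (Re (\<mu> \<kappa>)) = \<mu> \<nu>) \<Longrightarrow> \<forall>i<N \<kappa>. \<forall>j<N \<kappa>. \<Lambda> \<kappa> i j = 0"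
    and zero: "\<forall>\<sigma>\<in>I \<kappa>. \<forall>r<N \<kappa>. mom \<kappa> w \<sigma> r = 0"
  shows "w k = w l"
proof -
  interpret E: eigenspace_coordinates A "\<mu> \<kappa>" "N \<kappa>" "U \<kappa>" "D \<kappa>" "\<Lambda> \<kappa>"
    by (rule coordinates[OF \<kappa>(1)])
  define u where "u = w k - w l"
  have Re_u: "complex_vec (Re_vec u) \<in> gen_eigenspace_sum M (real_eigenvalues_below \<kappa>)"
    unfolding u_def
  proof (rule compensated_difference[OF dual \<kappa>(1)])
    show "0 \<le> Re_response w \<sigma> t" if "\<sigma> \<in> I \<kappa>" "0 \<le> t" for \<sigma> t
    proof -
      have "Re_response w \<sigma> t =
          Re (exp (cnj (\<mu> \<kappa>) * of_real t) * (\<Sum>r<N \<kappa>. of_real (t ^ r / fact r) * mom \<kappa> w \<sigma> r))"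
        unfolding response_def using w by (intro Re_flow_mode) (auto simp: modes_def)
      then show ?thesis using zero that by simp
    qed
    show "\<exists>C. \<forall>t\<ge>0. \<bar>Re_response w \<sigma> t\<bar> \<le> C * exp (Re (\<mu> \<nu>) * t)"
      if \<nu>: "\<nu> < \<kappa>" "\<mu> \<nu> \<in> \<real>" for \<nu> \<sigma>
    proof (cases "Re (\<mu> \<kappa>) < Re (\<mu> \<nu>)")
      case True
      then show ?thesis by (rule response_growth[OF w])
    next
      case False
      then have "Re (\<mu> \<kappa>) = Re (\<mu> \<nu>)" using Re_\<mu>_antimono[of \<nu> \<kappa>] \<nu> \<kappa> by simp
      then have "complex_of_real (Re (\<mu> \<kappa>)) = \<mu> \<nu>" using \<nu>(2) by (simp add: complex_is_Real_iff complex_eq_iff)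
      then have \<Lambda>0: "\<forall>i<N \<kappa>. \<forall>j<N \<kappa>. \<Lambda> \<kappa> i j = 0" using semisimple \<nu>(1) \<kappa>(1) by (meson less_trans)
      have "(S \<kappa> ^^ 1) (w i) = 0" for i
      proof -
        obtain c where "w i = (\<Sum>j<N \<kappa>. c j *s U \<kappa> j)"
          using gen_eigenspace_matrix_range[OF E.V] w by (auto simp: modes_def)
        then have "(S \<kappa> ^^ 1) (w i) = (\<Sum>j<N \<kappa>. c j *s S \<kappa> (U \<kappa> j))"
          by (simp only: eig_shift_pow_sum eig_shift_pow_scale) simp
        also have "\<dots> = 0" using \<Lambda>0 by (intro sum.neutral ballI) (simp add: E.shift_column)
        finally show ?thesis .
      qed
      then show ?thesis
        unfolding response_def using \<open>Re (\<mu> \<kappa>) = Re (\<mu> \<nu>)\<close> by (intro flow_mode_growth[where d = 1]) auto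
    qed
  qed
  have u: "u \<in> gen_eigenspace M (\<mu> \<kappa>)"
    using w by (auto simp: u_def gen_eigenspace_def modes_def eig_shift_pow_diff intro!: exI[of _ "N \<kappa>"])
  let ?Z = "insert (cnj (\<mu> \<kappa>)) (real_eigenvalues_below \<kappa>)"
  have "cnj_vec u \<in> gen_eigenspace_sum M ?Z"
    using gen_eigenspace_cnj[OF u] by (intro gen_eigenspace_sum_member[of _ "cnj (\<mu> \<kappa>)"]) auto
  moreover have "complex_vec (Re_vec u) \<in> gen_eigenspace_sum M ?Z"
    using Re_u gen_eigenspace_sum_mono[of ?Z "real_eigenvalues_below \<kappa>" M] by fastforce
  moreover have "u = 2 *s complex_vec (Re_vec u) - cnj_vec u"
    by (simp add: vec_eq_iff complex_vec_def Re_vec_def cnj_vec_def complex_eq_iff)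
  ultimately have "u \<in> gen_eigenspace_sum M ?Z"
    by (metis gen_eigenspace_sum_diff gen_eigenspace_sum_scale)
  moreover have "\<mu> \<kappa> \<notin> ?Z" using \<kappa>(2) by (auto simp: complex_is_Real_iff complex_eq_iff)
  ultimately have "u = 0"
    using u by (intro gen_eigenspace_sum_disjoint[of ?Z]) auto
  then show ?thesis by (simp add: u_def)
qed

end

theorem theorem5:
  fixes A :: "real^'n^'n"
    and B :: "'q::finite \<Rightarrow> 'p::finite \<Rightarrow> real^'n"
    and k l :: 'q
    and m :: nat
    and \<mu> :: "nat \<Rightarrow> complex"
    and N :: "nat \<Rightarrow> nat"
    and U :: "nat \<Rightarrow> nat \<Rightarrow> complex^'n"
    and D \<Lambda> :: "nat \<Rightarrow> nat \<Rightarrow> nat \<Rightarrow> complex"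
  assumes "CARD('q) \<ge> 2"
    and "relative_actuation B"
    and "k \<noteq> l"
    and "ordered_eigenvalues (conj_transpose (complex_matrix A)) m \<mu>"
    and "\<forall>\<kappa><m. N \<kappa> = alg_multiplicity (conj_transpose (complex_matrix A)) (\<mu> \<kappa>)"
    and "\<forall>\<kappa><m. gen_eigenspace_matrix (conj_transpose (complex_matrix A)) (\<mu> \<kappa>) (N \<kappa>) (U \<kappa>)"
    and "\<forall>\<kappa><m. restriction_matrix (conj_transpose (complex_matrix A)) (N \<kappa>) (U \<kappa>) (D \<kappa>)"
    and "\<forall>\<kappa><m. \<Lambda> \<kappa> = nilpotent_part (\<mu> \<kappa>) (D \<kappa>)"
    and "\<forall>\<kappa><m. \<mu> \<kappa> \<notin> \<real> \<and> (\<exists>\<nu><m. complex_of_real (Re (\<mu> \<kappa>)) = \<mu> \<nu>) \<longrightarrow>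
           (\<forall>i<N \<kappa>. \<forall>j<N \<kappa>. \<Lambda> \<kappa> i j = 0)"
    and "difference_range k l \<subseteq> closure (positively_reachable A B) \<longrightarrow>
           difference_range k l \<subseteq> positively_reachable A B"
  shows "positively_controllable A B k l \<longleftrightarrow>
    (\<forall>\<kappa><m. \<mu> \<kappa> \<in> \<real> \<longrightarrow>
       strongly_connected_pair (N \<kappa>) k l (index_set B \<mu> N U \<Lambda> \<kappa> \<times> {..<N \<kappa>})
         (inc_Q B (N \<kappa>) (U \<kappa>) (\<Lambda> \<kappa>))) \<and>
    (\<forall>\<kappa><m. \<mu> \<kappa> \<notin> \<real> \<longrightarrow>
       connected_pair (N \<kappa>) k l (index_set B \<mu> N U \<Lambda> \<kappa> \<times> {..<N \<kappa>})
         (inc_Q B (N \<kappa>) (U \<kappa>) (\<Lambda> \<kappa>)))"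
proof -
  interpret array_spectrum A B m \<mu> N U D \<Lambda>
    using assms(4-8) by unfold_locales (simp_all add: adjoint_matrix_def)
  have strong: "strongly_connected_pair (N \<kappa>) k l (I \<kappa> \<times> {..<N \<kappa>}) (inc_Q B (N \<kappa>) (U \<kappa>) (\<Lambda> \<kappa>)) \<longleftrightarrow>
      (\<forall>w\<in>real_modes \<kappa>. (\<forall>\<sigma>\<in>I \<kappa>. \<forall>r<N \<kappa>. 0 \<le> Re (mom \<kappa> w \<sigma> r)) \<longrightarrow> w k = w l)"
    if "\<kappa> < m" "\<mu> \<kappa> \<in> \<real>" for \<kappa>
    using eigenspace_coordinates.strongly_connected_pair_iff[OF coordinates[OF that(1)] that(2) assms(2,3), of "I \<kappa>"]
    by (simp add: real_modes_eq[OF that(1)])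
  have conn: "connected_pair (N \<kappa>) k l (I \<kappa> \<times> {..<N \<kappa>}) (inc_Q B (N \<kappa>) (U \<kappa>) (\<Lambda> \<kappa>)) \<longleftrightarrow>
      (\<forall>w\<in>modes \<kappa>. (\<forall>\<sigma>\<in>I \<kappa>. \<forall>r<N \<kappa>. mom \<kappa> w \<sigma> r = 0) \<longrightarrow> w k = w l)"
    if "\<kappa> < m" for \<kappa>
    using eigenspace_coordinates.connected_pair_iff[OF coordinates[OF that] assms(2,3), of "I \<kappa>"]
    by (simp add: modes_def imp_conjL)
  have "positively_controllable A B k l \<longleftrightarrow> (\<forall>\<eta>\<in>dual_cone A B. \<eta> k = \<eta> l)"
    by (rule positively_controllable_iff_dual[OF assms(2,3,10)])
  also have "\<dots> \<longleftrightarrow>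
      (\<forall>\<kappa><m. \<mu> \<kappa> \<in> \<real> \<longrightarrow> (\<forall>w\<in>real_modes \<kappa>. (\<forall>\<sigma>\<in>I \<kappa>. \<forall>r<N \<kappa>. 0 \<le> Re (mom \<kappa> w \<sigma> r)) \<longrightarrow> w k = w l)) \<and>
      (\<forall>\<kappa><m. \<mu> \<kappa> \<notin> \<real> \<longrightarrow> (\<forall>w\<in>modes \<kappa>. (\<forall>\<sigma>\<in>I \<kappa>. \<forall>r<N \<kappa>. mom \<kappa> w \<sigma> r = 0) \<longrightarrow> w k = w l))"
    (is "?dual \<longleftrightarrow> ?criterion")
  proof
    assume ?dual
    then show ?criterion
      using dual_imp_criterion_real[of k l] dual_imp_criterion_nonreal[of k l] assms(9) by blast
  next
    assume ?criterion
    then show ?dual using criterion_imp_dual[of k l] by blast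
  qed
  also have "\<dots> \<longleftrightarrow> (\<forall>\<kappa><m. \<mu> \<kappa> \<in> \<real> \<longrightarrow>
       strongly_connected_pair (N \<kappa>) k l (I \<kappa> \<times> {..<N \<kappa>}) (inc_Q B (N \<kappa>) (U \<kappa>) (\<Lambda> \<kappa>))) \<and>
    (\<forall>\<kappa><m. \<mu> \<kappa> \<notin> \<real> \<longrightarrow>
       connected_pair (N \<kappa>) k l (I \<kappa> \<times> {..<N \<kappa>}) (inc_Q B (N \<kappa>) (U \<kappa>) (\<Lambda> \<kappa>)))"
    using strong conn by (auto simp del: index_set.simps)
  finally show ?thesis .
qed

end
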